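(* Let $\sigma$ be an automorphism of an algebra $\mathcal{A}$ and write $d_\sigma(a)=D\,a-\sigma(a)\,D$. (Graded case.) Let $(\mathcal{A},\mathfrak{H},D)$ be a graded $\sigma$-spectral triple, with grading operator $\gamma$, such that $D^{-1}\in\mathcal{L}^{n,\infty}$ for some even $n\in\mathbb{N}$. Then the $(n+1)$-linear form on $\mathcal{A}$ $$\Psi_{D,\sigma}(a^0,a^1,\ldots,a^n):=\mathrm{Tr}_\omega\Big(\gamma\,a^0\,d_\sigma(\sigma^{-1}(a^1))\cdots d_\sigma(\sigma^{-n}(a^n))\,D^{-n}\Big)$$ is a Hochschild cocycle in $Z^n(\mathcal{A},\mathcal{A}^* )$. (Ungraded case.) Let $(\mathcal{A},\mathfrak{H},D)$ be an ungraded Lipschitz-regular $\sigma$-spectral triple such that $D^{-1}\in\mathcal{L}^{n,\infty}$ with $n\in\mathbb{N}$ odd. Then $$\Psi_{D,\sigma}(a^0,a^1,\ldots,a^n):=\mathrm{Tr}_\omega\Big(a^0\,d_\sigma(\sigma^{-1}(a^1))\cdots d_\sigma(\sigma^{-n}(a^n))\,|D|^{-n}\Big)$$ is a Hochschild cocycle in $Z^n(\mathcal{A},\mathcal{A}^* )$.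
   Context: Let $\sigma$ be an automorphism of the algebra $\mathcal{A}$. An ungraded $\sigma$-spectral triple $(\mathcal{A},\mathfrak{H},D)$ is given by an action of $\mathcal{A}$ by bounded operators on a Hilbert space $\mathfrak{H}$ and a self-adjoint operator $D$ on $\mathfrak{H}$ with compact resolvent such that $Da-\sigma(a)D$ is bounded for all $a\in\mathcal{A}$ (that is, $a$ preserves $\mathrm{Dom}(D)$ and $Da-\sigma(a)D$ extends to a bounded operator, denoted by the same expression). It is graded if in addition there is a grading operator $\gamma=\gamma^*$, $\gamma^2=I$, commuting with the action of $\mathcal{A}$ and with $D\gamma=-\gamma D$. It is Lipschitz-regular if $|D|a-\sigma(a)|D|$ is bounded for all $a\in\mathcal{A}$. Writing $D^{-1}\in\mathcal{L}^{n,\infty}$ includes the assumption that $D$ is invertible. With $\mu_k(T)$ the singular values of $T$ in decreasing order, $\mathcal{L}^{n,\infty}$ is, for $n>1$, the ideal of compact operators with $\mu_k(T)=O(k^{-1/n})$ and, for $n=1$, that of compact operators with $\sum_{k\le N}\mu_k(T)=O(\log N)$. $\mathrm{Tr}_\omega$ is a (fixed) Dixmier trace on $\mathcal{L}^{1,\infty}$. An $(n+1)$-linear form $\Psi$ on $\mathcal{A}$ is a Hochschild cocycle in $Z^n(\mathcal{A},\mathcal{A}^* )$ if $b\Psi=0$, where $b\Psi(a^0,\ldots,a^{n+1})=\sum_{i=0}^{n}(-1)^i\Psi(a^0,\ldots,a^ia^{i+1},\ldots,a^{n+1})+(-1)^{n+1}\Psi(a^{n+1}a^0,a^1,\ldots,a^n)$.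 *)

theory Defs
  imports "HOL-Analysis.Analysis" "HOL-Library.Landau_Symbols"
begin

class complex_vector = ab_group_add +
  fixes scaleC :: "complex \<Rightarrow> 'a \<Rightarrow> 'a"  (infixr "*\<^sub>C" 75)
  assumes scaleC_add_right: "c *\<^sub>C (x + y) = c *\<^sub>C x + c *\<^sub>C y"
    and scaleC_add_left: "(c + d) *\<^sub>C x = c *\<^sub>C x + d *\<^sub>C x"
    and scaleC_scaleC: "c *\<^sub>C (d *\<^sub>C x) = (c * d) *\<^sub>C x"
    and scaleC_one: "1 *\<^sub>C x = x"

text \<open>Associative algebras over the complex numbers; no unit is required.\<close>

class complex_algebra = complex_vector + ring +
  assumes mult_scaleC_left: "(c *\<^sub>C x) * y = c *\<^sub>C (x * y)"
    and mult_scaleC_right: "x * (c *\<^sub>C y) = c *\<^sub>C (x * y)"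

text \<open>The inner product is linear in the second argument.  The underlying real Hilbert space is
  part of the class, so that the library's norm, topology and completeness apply.\<close>

class complex_hilbert_space = complex_vector + real_inner + complete_space +
  fixes cinner :: "'a \<Rightarrow> 'a \<Rightarrow> complex"
  assumes scaleR_eq_scaleC: "r *\<^sub>R x = complex_of_real r *\<^sub>C x"
    and inner_eq_Re_cinner: "inner x y = Re (cinner x y)"
    and cinner_commute: "cinner x y = cnj (cinner y x)"
    and cinner_add_right: "cinner x (y + z) = cinner x y + cinner x z"
    and cinner_scaleC_right: "cinner x (c *\<^sub>C y) = c * cinner x y"

interpretation complex_vector: vector_space "scaleC :: complex \<Rightarrow> 'a \<Rightarrow> 'a::complex_vector"
  by unfold_locales (fact scaleC_add_right scaleC_add_left scaleC_scaleC scaleC_one)+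

definition bounded_op :: "('h::complex_hilbert_space \<Rightarrow> 'h) \<Rightarrow> bool" where
  "bounded_op T \<longleftrightarrow> Vector_Spaces.linear scaleC scaleC T \<and> bounded_linear T"

definition compact_op :: "('h::complex_hilbert_space \<Rightarrow> 'h) \<Rightarrow> bool" where
  "compact_op T \<longleftrightarrow> bounded_op T \<and> compact (closure (T ` cball 0 1))"

definition adj :: "('h::complex_hilbert_space \<Rightarrow> 'h) \<Rightarrow> ('h \<Rightarrow> 'h)" where
  "adj T = (THE S. \<forall>x y. cinner (S x) y = cinner x (T y))"

definition positive_op :: "('h::complex_hilbert_space \<Rightarrow> 'h) \<Rightarrow> bool" where
  "positive_op T \<longleftrightarrow> (\<forall>x. Im (cinner x (T x)) = 0 \<and> 0 \<le> Re (cinner x (T x)))"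

text \<open>The singular values of a compact operator \<open>T\<close>, indexed from \<open>0\<close>: the square roots of the
  eigenvalues of \<open>T\<^sup>* T\<close>, in decreasing order, each positive one repeated according to its
  multiplicity; if there are only finitely many of them, the sequence continues with zeros.
  (Convergence to zero rules out infinite repetition, which \<open>card\<close> would not detect.)\<close>

definition singular_value :: "('h::complex_hilbert_space \<Rightarrow> 'h) \<Rightarrow> nat \<Rightarrow> real" where
  "singular_value T = (THE s. decseq s \<and> s \<longlonglongrightarrow> 0 \<and>
     (\<forall>r>0. card {k. s k = r} =
        complex_vector.dim {x. adj T (T x) = complex_of_real (r\<^sup>2) *\<^sub>C x}))"

text \<open>The ideal \<open>\<L>\<^bsup>n,\<infinity>\<^esup>\<close>, meaningful for \<open>n \<ge> 1\<close>.  For \<open>n = 1\<close> it is defined by the partial sums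
  and is strictly larger than the class of operators with \<open>\<mu>\<^sub>k = O(1/k)\<close>.\<close>

definition weak_schatten :: "nat \<Rightarrow> ('h::complex_hilbert_space \<Rightarrow> 'h) set" where
  "weak_schatten n = {T. compact_op T \<and>
     (if n = 1 then (\<lambda>N. \<Sum>k\<le>N. singular_value T k) \<in> O(\<lambda>N. ln (real N))
      else singular_value T \<in> O(\<lambda>k. real k powr (- 1 / real n)))}"

text \<open>The limiting functionals \<open>\<omega>\<close> on bounded sequences used by Dixmier and Connes: linear,
  positive, extending the limit, and invariant under
  \<open>(x\<^sub>0, x\<^sub>1, \<dots>) \<mapsto> (x\<^sub>0, x\<^sub>0, x\<^sub>1, x\<^sub>1, \<dots>)\<close>.\<close>

definition dixmier_limit :: "((nat \<Rightarrow> real) \<Rightarrow> real) \<Rightarrow> bool" where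
  "dixmier_limit \<omega> \<longleftrightarrow>
     (\<forall>x y. Bseq x \<longrightarrow> Bseq y \<longrightarrow> \<omega> (\<lambda>N. x N + y N) = \<omega> x + \<omega> y) \<and>
     (\<forall>c x. Bseq x \<longrightarrow> \<omega> (\<lambda>N. c * x N) = c * \<omega> x) \<and>
     (\<forall>x. Bseq x \<longrightarrow> (\<forall>N. 0 \<le> x N) \<longrightarrow> 0 \<le> \<omega> x) \<and>
     (\<forall>x l. x \<longlonglongrightarrow> l \<longrightarrow> \<omega> x = l) \<and>
     (\<forall>x. Bseq x \<longrightarrow> \<omega> (\<lambda>N. x (N div 2)) = \<omega> x)"

text \<open>A Dixmier trace is the linear functional on \<open>\<L>\<^bsup>1,\<infinity>\<^esup>\<close> which on positive operators is the
  \<open>\<omega>\<close>-limit of the logarithmic means of the singular values.  The terms \<open>N = 0, 1\<close> of the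
  sequence of means are \<open>0\<close> by the conventions for \<open>ln 0\<close> and for division by \<open>0\<close>; they do not
  influence its \<open>\<omega>\<close>-limit.  Nothing is said about the values of \<open>Tr\<close> outside
  \<open>\<L>\<^bsup>1,\<infinity>\<^esup>\<close>.\<close>

definition dixmier_trace :: "(('h::complex_hilbert_space \<Rightarrow> 'h) \<Rightarrow> complex) \<Rightarrow> bool" where
  "dixmier_trace Tr \<longleftrightarrow> (\<exists>\<omega>. dixmier_limit \<omega> \<and>
     (\<forall>T\<in>weak_schatten 1. positive_op T \<longrightarrow>
        Tr T = complex_of_real (\<omega> (\<lambda>N. (\<Sum>k<N. singular_value T k) / ln (real N)))) \<and>
     (\<forall>S\<in>weak_schatten 1. \<forall>T\<in>weak_schatten 1. Tr (\<lambda>x. S x + T x) = Tr S + Tr T) \<and>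
     (\<forall>c. \<forall>T\<in>weak_schatten 1. Tr (\<lambda>x. c *\<^sub>C T x) = c * Tr T))"

text \<open>An unbounded operator is a partial map \<open>D :: 'h \<rightharpoonup> 'h\<close> with domain \<open>dom D\<close>.  Equality of maps
  is equality of operators including their domains, and \<open>A \<circ>\<^sub>m B\<close> is the product on its natural
  domain.\<close>

definition linear_op :: "('h::complex_hilbert_space \<rightharpoonup> 'h) \<Rightarrow> bool" where
  "linear_op D \<longleftrightarrow> complex_vector.subspace (dom D) \<and>
     (\<forall>x\<in>dom D. \<forall>y\<in>dom D. the (D (x + y)) = the (D x) + the (D y)) \<and>
     (\<forall>c. \<forall>x\<in>dom D. the (D (c *\<^sub>C x)) = c *\<^sub>C the (D x))"

definition adjoint_op :: "('h::complex_hilbert_space \<rightharpoonup> 'h) \<Rightarrow> ('h \<rightharpoonup> 'h)" where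
  "adjoint_op D = (\<lambda>y. if \<exists>z. \<forall>x\<in>dom D. cinner y (the (D x)) = cinner z x
     then Some (THE z. \<forall>x\<in>dom D. cinner y (the (D x)) = cinner z x) else None)"

definition self_adjoint :: "('h::complex_hilbert_space \<rightharpoonup> 'h) \<Rightarrow> bool" where
  "self_adjoint D \<longleftrightarrow> linear_op D \<and> closure (dom D) = UNIV \<and> adjoint_op D = D"

text \<open>The absolute value \<open>(D\<^sup>* D)\<^bsup>1/2\<^esup>\<close>: the positive self-adjoint square root of \<open>D\<^sup>* D\<close>.\<close>

definition abs_op :: "('h::complex_hilbert_space \<rightharpoonup> 'h) \<Rightarrow> ('h \<rightharpoonup> 'h)" where
  "abs_op D = (THE A. self_adjoint A \<and> (\<forall>x\<in>dom A. 0 \<le> Re (cinner x (the (A x)))) \<and>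
     A \<circ>\<^sub>m A = adjoint_op D \<circ>\<^sub>m D)"

definition inverse_op :: "('h::complex_hilbert_space \<rightharpoonup> 'h) \<Rightarrow> ('h \<Rightarrow> 'h)" where
  "inverse_op D y = (THE x. D x = Some y)"

definition invertible_op :: "('h::complex_hilbert_space \<rightharpoonup> 'h) \<Rightarrow> bool" where
  "invertible_op D \<longleftrightarrow> (\<forall>y. \<exists>!x. D x = Some y) \<and> bounded_op (inverse_op D)"

definition shift_op :: "('h::complex_hilbert_space \<rightharpoonup> 'h) \<Rightarrow> complex \<Rightarrow> ('h \<rightharpoonup> 'h)" where
  "shift_op D z = (\<lambda>x. map_option (\<lambda>y. y - z *\<^sub>C x) (D x))"

definition compact_resolvent :: "('h::complex_hilbert_space \<rightharpoonup> 'h) \<Rightarrow> bool" where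
  "compact_resolvent D \<longleftrightarrow>
     (\<exists>z. invertible_op (shift_op D z) \<and> compact_op (inverse_op (shift_op D z)))"

definition algebra_automorphism :: "('a::complex_algebra \<Rightarrow> 'a) \<Rightarrow> bool" where
  "algebra_automorphism \<sigma> \<longleftrightarrow> bij \<sigma> \<and> Vector_Spaces.linear scaleC scaleC \<sigma> \<and>
     (\<forall>a b. \<sigma> (a * b) = \<sigma> a * \<sigma> b)"

definition bounded_action ::
    "('a::complex_algebra \<Rightarrow> 'h::complex_hilbert_space \<Rightarrow> 'h) \<Rightarrow> bool" where
  "bounded_action \<pi> \<longleftrightarrow> (\<forall>a. bounded_op (\<pi> a)) \<and>
     (\<forall>a b x. \<pi> (a + b) x = \<pi> a x + \<pi> b x) \<and>
     (\<forall>c a x. \<pi> (c *\<^sub>C a) x = c *\<^sub>C \<pi> a x) \<and>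
     (\<forall>a b. \<pi> (a * b) = \<pi> a \<circ> \<pi> b)"

definition extends_twisted_commutator where
  "extends_twisted_commutator \<sigma> \<pi> D a T \<longleftrightarrow>
     bounded_op T \<and> (\<forall>x\<in>dom D. T x = the (D (\<pi> a x)) - \<pi> (\<sigma> a) (the (D x)))"

definition bounded_twisted_commutators where
  "bounded_twisted_commutators \<sigma> \<pi> D \<longleftrightarrow>
     (\<forall>a. (\<forall>x\<in>dom D. \<pi> a x \<in> dom D) \<and> (\<exists>T. extends_twisted_commutator \<sigma> \<pi> D a T))"

definition twisted_commutator where
  "twisted_commutator \<sigma> \<pi> D a = (THE T. extends_twisted_commutator \<sigma> \<pi> D a T)"

definition twisted_spectral_triple ::
    "('a::complex_algebra \<Rightarrow> 'a) \<Rightarrow> ('a \<Rightarrow> 'h::complex_hilbert_space \<Rightarrow> 'h) \<Rightarrow> ('h \<rightharpoonup> 'h) \<Rightarrow> bool" where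
  "twisted_spectral_triple \<sigma> \<pi> D \<longleftrightarrow> bounded_action \<pi> \<and> self_adjoint D \<and> compact_resolvent D \<and>
     bounded_twisted_commutators \<sigma> \<pi> D"

definition graded_twisted_spectral_triple ::
    "('a::complex_algebra \<Rightarrow> 'a) \<Rightarrow> ('a \<Rightarrow> 'h::complex_hilbert_space \<Rightarrow> 'h) \<Rightarrow> ('h \<rightharpoonup> 'h) \<Rightarrow>
     ('h \<Rightarrow> 'h) \<Rightarrow> bool" where
  "graded_twisted_spectral_triple \<sigma> \<pi> D \<gamma> \<longleftrightarrow> twisted_spectral_triple \<sigma> \<pi> D \<and>
     bounded_op \<gamma> \<and> adj \<gamma> = \<gamma> \<and> \<gamma> \<circ> \<gamma> = id \<and>
     (\<forall>a. \<gamma> \<circ> \<pi> a = \<pi> a \<circ> \<gamma>) \<and>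
     (\<forall>x. D (\<gamma> x) = map_option (\<lambda>y. - \<gamma> y) (D x))"

definition lipschitz_regular ::
    "('a::complex_algebra \<Rightarrow> 'a) \<Rightarrow> ('a \<Rightarrow> 'h::complex_hilbert_space \<Rightarrow> 'h) \<Rightarrow> ('h \<rightharpoonup> 'h) \<Rightarrow> bool" where
  "lipschitz_regular \<sigma> \<pi> D \<longleftrightarrow> bounded_twisted_commutators \<sigma> \<pi> (abs_op D)"

text \<open>The product \<open>d\<^sub>\<sigma>(\<sigma>\<^bsup>-1\<^esup>(a\<^sup>1)) \<cdots> d\<^sub>\<sigma>(\<sigma>\<^bsup>-n\<^esup>(a\<^sup>n))\<close>.\<close>

definition twisted_commutator_product where
  "twisted_commutator_product \<sigma> \<pi> D n a =
     foldr (\<circ>) (map (\<lambda>j. twisted_commutator \<sigma> \<pi> D ((inv \<sigma> ^^ j) (a j))) [1..<Suc n]) id"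

definition graded_character ::
    "(('h::complex_hilbert_space \<Rightarrow> 'h) \<Rightarrow> complex) \<Rightarrow> ('a::complex_algebra \<Rightarrow> 'a) \<Rightarrow>
     ('a \<Rightarrow> 'h \<Rightarrow> 'h) \<Rightarrow> ('h \<rightharpoonup> 'h) \<Rightarrow> ('h \<Rightarrow> 'h) \<Rightarrow> nat \<Rightarrow> (nat \<Rightarrow> 'a) \<Rightarrow> complex" where
  "graded_character Tr \<sigma> \<pi> D \<gamma> n a =
     Tr (\<gamma> \<circ> \<pi> (a 0) \<circ> twisted_commutator_product \<sigma> \<pi> D n a \<circ> (inverse_op D ^^ n))"

definition ungraded_character ::
    "(('h::complex_hilbert_space \<Rightarrow> 'h) \<Rightarrow> complex) \<Rightarrow> ('a::complex_algebra \<Rightarrow> 'a) \<Rightarrow>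
     ('a \<Rightarrow> 'h \<Rightarrow> 'h) \<Rightarrow> ('h \<rightharpoonup> 'h) \<Rightarrow> nat \<Rightarrow> (nat \<Rightarrow> 'a) \<Rightarrow> complex" where
  "ungraded_character Tr \<sigma> \<pi> D n a =
     Tr (\<pi> (a 0) \<circ> twisted_commutator_product \<sigma> \<pi> D n a \<circ> (inverse_op (abs_op D) ^^ n))"

text \<open>An \<open>(n+1)\<close>-linear form is encoded as a function of sequences \<open>a\<close> that depends only on the
  entries \<open>a 0, \<dots>, a n\<close>.\<close>

definition multilinear_form :: "nat \<Rightarrow> ((nat \<Rightarrow> 'a::complex_algebra) \<Rightarrow> complex) \<Rightarrow> bool" where
  "multilinear_form n \<Psi> \<longleftrightarrow>
     (\<forall>a b. (\<forall>j\<le>n. a j = b j) \<longrightarrow> \<Psi> a = \<Psi> b) \<and>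
     (\<forall>a. \<forall>j\<le>n. \<forall>x y. \<Psi> (a(j := x + y)) = \<Psi> (a(j := x)) + \<Psi> (a(j := y))) \<and>
     (\<forall>a. \<forall>j\<le>n. \<forall>c x. \<Psi> (a(j := c *\<^sub>C x)) = c * \<Psi> (a(j := x)))"

definition hochschild_b ::
    "nat \<Rightarrow> ((nat \<Rightarrow> 'a::complex_algebra) \<Rightarrow> complex) \<Rightarrow> (nat \<Rightarrow> 'a) \<Rightarrow> complex" where
  "hochschild_b n \<Psi> a =
     (\<Sum>i\<le>n. (-1) ^ i * \<Psi> (\<lambda>j. if j < i then a j else if j = i then a i * a (i + 1) else a (j + 1)))
     + (-1) ^ (n + 1) * \<Psi> (\<lambda>j. if j = 0 then a (n + 1) * a 0 else a j)"

definition hochschild_cocycle :: "nat \<Rightarrow> ((nat \<Rightarrow> 'a::complex_algebra) \<Rightarrow> complex) \<Rightarrow> bool" where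
  "hochschild_cocycle n \<Psi> \<longleftrightarrow> multilinear_form n \<Psi> \<and> (\<forall>a. hochschild_b n \<Psi> a = 0)"

end

theory Submission
  imports Defs
begin

text \<open>
  The singular values of a compact operator are its approximation numbers, by the spectral theorem;
  hence \<open>\<mu>\<^bsub>i+j\<^esub>\<close> is subadditive and submultiplicative.  It follows that \<open>\<L>\<^bsup>1,\<infinity>\<^esup>\<close> is an ideal containing
  all products \<open>D\<^bsup>-k\<^esup> d D\<^bsup>-(n-k)\<^esup>\<close> with \<open>d\<close> bounded, and that a product of an operator in \<open>\<L>\<^bsup>1,\<infinity>\<^esup>\<close>
  with a compact one has partial sums \<open>o(log N)\<close>, so that the Dixmier trace vanishes on it.  Unitary
  invariance, applied to Cayley transforms, gives \<open>Tr(AT) = Tr(TA)\<close> for bounded \<open>A\<close>.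

  By the twisted Leibniz rule \<open>b\<Psi>\<close> telescopes to the difference of
  \<open>Tr(X c D\<^bsup>-n\<^esup>)\<close> and \<open>Tr(\<sigma>\<^sup>n(c) X D\<^bsup>-n\<^esup>) = Tr(X D\<^bsup>-n\<^esup> \<sigma>\<^sup>n(c))\<close> with \<open>c = \<sigma>\<^bsup>-n\<^esup>(a\<^bsup>n+1\<^esup>)\<close>.  Since
  \<open>c D\<^sup>-\<^sup>1 - D\<^sup>-\<^sup>1 \<sigma>(c) = D\<^sup>-\<^sup>1 d\<^sub>\<sigma>(c) D\<^sup>-\<^sup>1\<close>, the operator \<open>c D\<^bsup>-n\<^esup> - D\<^bsup>-n\<^esup> \<sigma>\<^sup>n(c)\<close> is a sum of terms
  \<open>D\<^bsup>-k\<^esup> d D\<^bsup>-(n+1-k)\<^esup>\<close>, on which the trace vanishes.  The odd case is the same with \<open>|D|\<close> in place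
  of \<open>D\<close> in these identities, which is what Lipschitz regularity provides.
\<close>

subsection \<open>Complex inner products and bounded operators\<close>

text \<open>\<open>singular_value\<close>, \<open>adj\<close>, \<open>abs_op\<close> and
  \<open>twisted_commutator\<close> are definite descriptions and yield facts only once existence
  and uniqueness are shown; for singular values and |D| an explicit eigensystem supplies both.
  \<open>Tr\<close> is prescribed on positive operators and otherwise only known to be linear, so
  vanishing and unitary invariance must be brought down to positive summands with controlled
  singular values. Distance to operators of finite rank is the common measure because it also makes
  sense for bounded non-compact factors. Writing a bounded operator as a combination of unitaries
  usually takes square roots of non-compact operators; the Cayley transform takes only an inverse,
  which a fixed point argument gives. The decisive count: passing c through the n-th power of S, the
  inverse of D or of |D|, creates n + 1 factors S. With n of them the product already lies in
  \<open>weak_schatten 1\<close>, and the spare one is compact and kills the trace. The case n = 1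
  stands apart in this count, since members of \<open>weak_schatten 1\<close> need not have singular
  values of order 1/k.\<close>

lemma cinner_add_left: "cinner (x + y) (z::'h::complex_hilbert_space) = cinner x z + cinner y z"
  by (metis cinner_commute cinner_add_right complex_cnj_add)

lemma cinner_scaleC_left: "cinner (c *\<^sub>C x) (y::'h::complex_hilbert_space) = cnj c * cinner x y"
  by (metis cinner_commute cinner_scaleC_right complex_cnj_mult)

lemma cinner_self: "cinner x (x::'h::complex_hilbert_space) = complex_of_real ((norm x)\<^sup>2)"
proof (rule complex_eqI)
  show "Re (cinner x x) = Re (complex_of_real ((norm x)\<^sup>2))"
    by (simp add: inner_eq_Re_cinner[symmetric] power2_norm_eq_inner)
  show "Im (cinner x x) = Im (complex_of_real ((norm x)\<^sup>2))"
    using arg_cong[OF cinner_commute[of x x], of Im] by simp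
qed

lemma norm_scaleC: "norm (c *\<^sub>C (x::'h::complex_hilbert_space)) = cmod c * norm x"
proof -
  have "complex_of_real ((norm (c *\<^sub>C x))\<^sup>2) = complex_of_real ((cmod c * norm x)\<^sup>2)"
    unfolding cinner_self[symmetric] cinner_scaleC_left cinner_scaleC_right
    by (simp add: cinner_self complex_norm_square[symmetric] power_mult_distrib mult_ac
        flip: of_real_power)
  then have "(norm (c *\<^sub>C x))\<^sup>2 = (cmod c * norm x)\<^sup>2"
    by (simp only: of_real_eq_iff)
  then show ?thesis
    by (simp add: power2_eq_iff_nonneg)
qed

text \<open>Multiplying \<open>y\<close> by the conjugate phase of the inner product makes it real
  and nonnegative, so the real Cauchy-Schwarz inequality applies.\<close>

lemma cmod_cinner_le: "cmod (cinner x y) \<le> norm x * norm (y::'h::complex_hilbert_space)"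
proof (cases "cinner x y = 0")
  case False
  define c where "c = cnj (sgn (cinner x y))"
  have "c * cinner x y = complex_of_real (cmod (cinner x y))"
    unfolding c_def using False complex_norm_square[of "cinner x y"]
    by (simp add: sgn_div_norm scaleR_conv_of_real field_simps power2_eq_square)
  then have "cmod (cinner x y) = inner x (c *\<^sub>C y)"
    by (simp add: inner_eq_Re_cinner cinner_scaleC_right)
  also have "\<dots> \<le> norm x * norm (c *\<^sub>C y)"
    by (rule norm_cauchy_schwarz)
  also have "\<dots> = norm x * norm y"
    using False by (simp add: norm_scaleC c_def norm_sgn)
  finally show ?thesis .
qed simp

interpretation cinner: bounded_bilinear "cinner :: 'h::complex_hilbert_space \<Rightarrow> _"
proof
  show "\<exists>K. \<forall>a b::'h. norm (cinner a b) \<le> norm a * norm b * K"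
    using cmod_cinner_le by (intro exI[of _ 1]) auto
qed (auto simp: cinner_add_left cinner_add_right scaleR_eq_scaleC cinner_scaleC_left
    cinner_scaleC_right scaleR_conv_of_real)

interpretation scaleC: bounded_bilinear "scaleC :: complex \<Rightarrow> 'h::complex_hilbert_space \<Rightarrow> _"
proof
  show "\<exists>K. \<forall>a. \<forall>b::'h. norm (a *\<^sub>C b) \<le> norm a * norm b * K"
    by (intro exI[of _ 1]) (simp add: norm_scaleC)
  show "(r *\<^sub>R a) *\<^sub>C b = r *\<^sub>R (a *\<^sub>C b)" for r a and b :: 'h
    by (simp add: scaleR_eq_scaleC scaleC_scaleC scaleR_conv_of_real)
  show "a *\<^sub>C (r *\<^sub>R b) = r *\<^sub>R (a *\<^sub>C b)" for r a and b :: 'h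
    by (simp add: scaleR_eq_scaleC scaleC_scaleC mult.commute)
qed (auto simp: scaleC_add_left scaleC_add_right)

lemma cinner_eqI: "(\<And>y. cinner y x = cinner y z) \<Longrightarrow> x = (z::'h::complex_hilbert_space)"
proof -
  assume "\<And>y. cinner y x = cinner y z"
  then have "cinner (x - z) (x - z) = 0"
    by (simp add: cinner.diff_right)
  then show ?thesis
    by (simp add: cinner_self)
qed

lemma cinner_eqI_left: "(\<And>y. cinner x y = cinner z y) \<Longrightarrow> x = (z::'h::complex_hilbert_space)"
  by (metis cinner_eqI cinner_commute)

lemma Im_cinner: "Im (cinner x y) = - inner x (\<i> *\<^sub>C (y::'h::complex_hilbert_space))"
  by (simp add: inner_eq_Re_cinner cinner_scaleC_right)

lemma clinear_iff:
  "Vector_Spaces.linear scaleC scaleC (T :: 'a::complex_vector \<Rightarrow> 'b::complex_vector) \<longleftrightarrow>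
    (\<forall>x y. T (x + y) = T x + T y) \<and> (\<forall>c x. T (c *\<^sub>C x) = c *\<^sub>C T x)"
  using complex_vector.vector_space_axioms[where 'a='a] complex_vector.vector_space_axioms[where 'a='b]
  unfolding linear_iff_module_hom module_hom_iff
  by (auto simp: module_iff_vector_space)

lemma bounded_op_iff:
  "bounded_op T \<longleftrightarrow> (\<forall>x y. T (x + y) = T x + T y) \<and> (\<forall>c x. T (c *\<^sub>C x) = c *\<^sub>C T x) \<and>
     (\<exists>K. \<forall>x. norm (T x) \<le> norm x * K)"
  unfolding bounded_op_def clinear_iff bounded_linear_def bounded_linear_axioms_def linear_iff
  by (auto simp: scaleR_eq_scaleC)

lemma bounded_opI:
  assumes "\<And>x y. T (x + y) = T x + T y" "\<And>c x. T (c *\<^sub>C x) = c *\<^sub>C T x"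
    "\<And>x. norm (T x) \<le> K * norm x"
  shows "bounded_op T"
  using assms unfolding bounded_op_iff by (metis mult.commute)

lemma bounded_opD:
  assumes "bounded_op T"
  shows "T (x + y) = T x + T y" "T (c *\<^sub>C x) = c *\<^sub>C T x" "T 0 = 0" "T (- x) = - T x"
    "T (x - y) = T x - T y" "T (\<Sum>i\<in>I. f i) = (\<Sum>i\<in>I. T (f i))" "bounded_linear T"
proof -
  show "bounded_linear T" using assms by (simp add: bounded_op_def)
  then interpret bounded_linear T .
  show "T (x + y) = T x + T y" "T (c *\<^sub>C x) = c *\<^sub>C T x" "T 0 = 0" "T (- x) = - T x"
    "T (x - y) = T x - T y" "T (\<Sum>i\<in>I. f i) = (\<Sum>i\<in>I. T (f i))"
    using assms unfolding bounded_op_iff by (auto simp: add diff zero neg sum)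
qed

lemma bounded_op_bound:
  assumes "bounded_op T"
  obtains K where "K > 0" "\<And>x. norm (T x) \<le> K * norm x"
  using bounded_linear.pos_bounded[OF bounded_opD(7)[OF assms]] by (metis mult.commute)

lemma bounded_op_id: "bounded_op id" "bounded_op (\<lambda>x. x)"
  by (auto intro!: bounded_opI[of _ 1])

lemma bounded_op_zero: "bounded_op (\<lambda>x. 0)"
  by (auto intro!: bounded_opI[of _ 1])

lemma bounded_op_add:
  assumes "bounded_op S" "bounded_op T"
  shows "bounded_op (\<lambda>x. S x + T x)"
  using assms unfolding bounded_op_def clinear_iff
  by (auto simp: scaleC_add_right intro: bounded_linear_add)

lemma bounded_op_scaleC:
  assumes "bounded_op T"
  shows "bounded_op (\<lambda>x. c *\<^sub>C T x)"
  using assms unfolding bounded_op_def clinear_iff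
  by (auto simp: scaleC_add_right scaleC_scaleC mult.commute
      intro: bounded_linear_compose[OF scaleC.bounded_linear_right])

lemma minus_eq_scaleC: "- x = (- 1) *\<^sub>C (x::'h::complex_hilbert_space)"
  by (simp add: scaleC.minus_left scaleC_one)

lemma bounded_op_diff:
  assumes "bounded_op S" "bounded_op T"
  shows "bounded_op (\<lambda>x. S x - T x)"
  using bounded_op_add[OF assms(1) bounded_op_scaleC[OF assms(2), of "-1"]]
  by (simp add: scaleC.minus_left scaleC_one)

lemma bounded_op_comp:
  assumes "bounded_op S" "bounded_op T"
  shows "bounded_op (S \<circ> T)"
  using assms unfolding bounded_op_def clinear_iff
  by (auto simp: o_def intro: bounded_linear_compose)

lemma bounded_op_power:
  assumes "bounded_op T"
  shows "bounded_op (T ^^ k)"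
  by (induction k) (auto simp del: o_apply intro: bounded_op_id bounded_op_comp assms)

lemma bounded_op_tendsto:
  assumes "bounded_op T" "(f \<longlongrightarrow> l) F"
  shows "((\<lambda>x. T (f x)) \<longlongrightarrow> T l) F"
  by (rule bounded_linear.tendsto[OF bounded_opD(7)[OF assms(1)] assms(2)])

subsection \<open>Riesz representation and adjoints\<close>

text \<open>The representing vector is the minimizer of |x|^2 - 2 f(x). The parallelogram law makes
  a minimizing sequence Cauchy, and the first-order condition at its limit \<open>z\<close> says f =
  inner z.\<close>

lemma riesz_representation:
  fixes f :: "'h::{real_inner,complete_space} \<Rightarrow> real"
  assumes "bounded_linear f"
  shows "\<exists>z. \<forall>x. f x = inner z x"
proof -
  interpret bounded_linear f by fact
  obtain K where K: "K > 0" "\<And>x. \<bar>f x\<bar> \<le> norm x * K"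
    using pos_bounded by auto
  define \<phi> where "\<phi> x = (norm x)\<^sup>2 - 2 * f x" for x
  have lower: "- K\<^sup>2 \<le> \<phi> x" for x
  proof -
    have "0 \<le> (norm x - K)\<^sup>2" by simp
    then have "2 * (norm x * K) \<le> (norm x)\<^sup>2 + K\<^sup>2"
      by (simp add: power2_diff)
    then show ?thesis
      using K(2)[of x] by (simp add: \<phi>_def)
  qed
  have bdd: "bdd_below (range \<phi>)"
    using lower by (intro bdd_belowI[of _ "- K\<^sup>2"]) auto
  define m where "m = Inf (range \<phi>)"
  have m_le: "m \<le> \<phi> x" for x
    unfolding m_def by (rule cInf_lower[OF _ bdd]) auto
  have "\<exists>x. \<phi> x < m + inverse (real (Suc n))" for n
  proof -
    have "Inf (range \<phi>) < m + inverse (real (Suc n))"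
      by (simp add: m_def)
    then show ?thesis
      by (subst (asm) cInf_less_iff[OF _ bdd]) auto
  qed
  then obtain X where X: "\<And>n. \<phi> (X n) < m + inverse (real (Suc n))"
    by metis
  have par: "(norm (x - y))\<^sup>2 \<le> 2 * (\<phi> x - m) + 2 * (\<phi> y - m)" for x y
  proof -
    define w where "w = (1/2) *\<^sub>R (x + y)"
    have "(norm (x - y))\<^sup>2 + 4 * \<phi> w = 2 * \<phi> x + 2 * \<phi> y"
      unfolding \<phi>_def power2_norm_eq_inner w_def
      by (simp add: inner_simps inner_commute scale add algebra_simps)
    then show ?thesis using m_le[of w] by simp
  qed
  have inv0: "(\<lambda>n. inverse (real (Suc n))) \<longlonglongrightarrow> 0"
    by (rule LIMSEQ_inverse_real_of_nat)
  have "Cauchy X"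
  proof (rule metric_CauchyI)
    fix e :: real assume e: "0 < e"
    then have "eventually (\<lambda>n. inverse (real (Suc n)) < e\<^sup>2 / 4) sequentially"
      using order_tendstoD(2)[OF inv0, of "e\<^sup>2 / 4"] by simp
    then obtain M where M: "\<And>n. n \<ge> M \<Longrightarrow> inverse (real (Suc n)) < e\<^sup>2 / 4"
      by (auto simp: eventually_sequentially)
    show "\<exists>M. \<forall>i\<ge>M. \<forall>j\<ge>M. dist (X i) (X j) < e"
    proof (intro exI[of _ M] allI impI)
      have close: "\<phi> (X k) < m + e\<^sup>2 / 4" if "k \<ge> M" for k
        using X[of k] M[OF that] by (rule order.strict_trans2[OF _ add_left_mono[OF less_imp_le]])
      fix i j assume "i \<ge> M" "j \<ge> M"
      then have "(norm (X i - X j))\<^sup>2 < e\<^sup>2"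
        using par[of "X i" "X j"] close[of i] close[of j] by argo
      then show "dist (X i) (X j) < e"
        using e by (simp add: dist_norm power_less_imp_less_base)
    qed
  qed
  then obtain z where z: "X \<longlonglongrightarrow> z"
    using Cauchy_convergent convergent_def by blast
  have "(\<lambda>n. \<phi> (X n)) \<longlonglongrightarrow> \<phi> z"
    unfolding \<phi>_def by (intro tendsto_intros z tendsto)
  moreover have "(\<lambda>n. m + inverse (real (Suc n))) \<longlonglongrightarrow> m + 0"
    by (intro tendsto_intros inv0)
  ultimately have "\<phi> z \<le> m + 0"
    by (rule LIMSEQ_le) (use X less_imp_le in blast)
  then have min: "\<phi> z \<le> \<phi> x" for x
    using m_le[of x] by simp
  have "f x = inner z x" for x
  proof (rule ccontr)
    define d where "d = inner z x - f x"
    assume "f x \<noteq> inner z x"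
    then have d: "d \<noteq> 0" by (simp add: d_def)
    have quad: "0 \<le> 2 * t * d + t\<^sup>2 * (norm x)\<^sup>2" for t
      using min[of "z + t *\<^sub>R x"] unfolding \<phi>_def power2_norm_eq_inner d_def
      by (simp add: inner_simps inner_commute scale add algebra_simps power2_eq_square)
    \<comment> \<open>The minimizer of the quadratic with |x|^2 + 1 in place of |x|^2; the added 1
      keeps the denominator positive without a case distinction.\<close>
    define t where "t = - d / ((norm x)\<^sup>2 + 1)"
    have "2 * t * d + t\<^sup>2 * (norm x)\<^sup>2 \<le> 2 * t * d + t\<^sup>2 * ((norm x)\<^sup>2 + 1)"
      by (simp add: algebra_simps)
    also have "\<dots> = - d\<^sup>2 / ((norm x)\<^sup>2 + 1)"
      unfolding t_def by (simp add: field_simps power2_eq_square add_nonneg_eq_0_iff)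
    also have "\<dots> < 0"
      using d by (simp add: divide_neg_pos add_nonneg_pos)
    finally show False using quad[of t] by simp
  qed
  then show ?thesis by blast
qed

lemma adj_eqI:
  assumes "\<And>x y. cinner (S x) y = cinner x (T y)"
  shows "adj T = S"
  unfolding adj_def
proof (rule the_equality)
  show "\<forall>x y. cinner (S x) y = cinner x (T y)" using assms by blast
  fix R assume "\<forall>x y. cinner (R x) y = cinner x (T y)"
  then show "R = S"
    using assms by (intro ext cinner_eqI_left) metis
qed

text \<open>Riesz is applied to the real inner product; replacing \<open>y\<close> by
  \<open>\<i> *\<^sub>C y\<close> recovers the imaginary part, because \<open>T\<close> is complex
  linear.\<close>

lemma ex_adjoint:
  assumes "bounded_op T"
  shows "\<exists>S. \<forall>x y. cinner (S x) y = cinner x (T y)"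
proof -
  have "\<exists>z. \<forall>y. cinner z y = cinner x (T y)" for x
  proof -
    have "bounded_linear (\<lambda>y. inner x (T y))"
      by (rule bounded_linear_compose[OF bounded_linear_inner_right bounded_opD(7)[OF assms]])
    from riesz_representation[OF this] obtain z where z: "\<And>y. inner x (T y) = inner z y"
      by blast
    have "cinner z y = cinner x (T y)" for y
    proof (rule complex_eqI)
      show "Re (cinner z y) = Re (cinner x (T y))"
        using z by (simp add: inner_eq_Re_cinner)
      show "Im (cinner z y) = Im (cinner x (T y))"
        unfolding Im_cinner bounded_opD(2)[OF assms, symmetric] z ..
    qed
    then show ?thesis by blast
  qed
  then show ?thesis by metis
qed

lemma cinner_adj_left:
  assumes "bounded_op T"
  shows "cinner (adj T x) y = cinner x (T y)"
proof -
  obtain S where "\<And>x y. cinner (S x) y = cinner x (T y)"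
    using ex_adjoint[OF assms] by blast
  then show ?thesis using adj_eqI by metis
qed

lemma cinner_adj_right:
  assumes "bounded_op T"
  shows "cinner x (adj T y) = cinner (T x) y"
  by (metis assms cinner_adj_left cinner_commute)

lemma norm_adj_le:
  assumes "bounded_op T" "\<And>x. norm (T x) \<le> K * norm x" "K \<ge> 0"
  shows "norm (adj T x) \<le> K * norm x"
proof -
  have "complex_of_real ((norm (adj T x))\<^sup>2) = cinner x (T (adj T x))"
    by (simp only: cinner_self[symmetric] cinner_adj_left[OF assms(1)])
  then have "(norm (adj T x))\<^sup>2 = cmod (cinner x (T (adj T x)))"
    by (metis norm_of_real abs_of_nonneg zero_le_power2)
  also have "\<dots> \<le> norm x * (K * norm (adj T x))"
    by (rule order_trans[OF cmod_cinner_le mult_left_mono[OF assms(2)]]) simp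
  finally have "norm (adj T x) * norm (adj T x) \<le> (K * norm x) * norm (adj T x)"
    by (simp add: power2_eq_square mult_ac)
  then show ?thesis
    using assms(3) by (cases "norm (adj T x) = 0") (auto dest: mult_right_le_imp_le)
qed

lemma bounded_op_adj:
  assumes "bounded_op T"
  shows "bounded_op (adj T)"
proof -
  obtain K where K: "K > 0" "\<And>x. norm (T x) \<le> K * norm x"
    using bounded_op_bound[OF assms] by blast
  show ?thesis
  proof (rule bounded_opI)
    show "adj T (x + y) = adj T x + adj T y" for x y
      by (rule cinner_eqI) (simp add: cinner_adj_right[OF assms] cinner_add_right)
    show "adj T (c *\<^sub>C x) = c *\<^sub>C adj T x" for c x
      by (rule cinner_eqI) (simp add: cinner_adj_right[OF assms] cinner_scaleC_right)
    show "norm (adj T x) \<le> K * norm x" for x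
      using norm_adj_le[OF assms K(2)] K(1) by simp
  qed
qed

subsection \<open>Compact operators\<close>

text \<open>Makes diagonal choices of subsequences available. For the converse, points of the
  closure are replaced by image points at distance below 1/(n+1), which does not change
  limits.\<close>

lemma compact_op_iff_seq:
  "compact_op T \<longleftrightarrow> bounded_op T \<and>
     (\<forall>f::nat \<Rightarrow> 'h::complex_hilbert_space. (\<forall>n. norm (f n) \<le> 1) \<longrightarrow>
        (\<exists>l r. strict_mono r \<and> (\<lambda>n. T (f (r n))) \<longlonglongrightarrow> l))"
proof (intro iffI conjI allI impI; (elim conjE)?)
  assume T: "compact_op T"
  then show "bounded_op T" by (simp add: compact_op_def)
  fix f :: "nat \<Rightarrow> 'h" assume f: "\<forall>n. norm (f n) \<le> 1"
  have "\<forall>n. T (f n) \<in> closure (T ` cball 0 1)"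
    using f closure_subset[of "T ` cball 0 1"] by auto
  then show "\<exists>l r. strict_mono r \<and> (\<lambda>n. T (f (r n))) \<longlonglongrightarrow> l"
    using T seq_compactE[of "closure (T ` cball 0 1)" "\<lambda>n. T (f n)"]
      compact_imp_seq_compact[of "closure (T ` cball 0 1)"]
    unfolding compact_op_def o_def by metis
next
  assume b: "bounded_op T" and seq: "\<forall>f::nat \<Rightarrow> 'h. (\<forall>n. norm (f n) \<le> 1) \<longrightarrow>
        (\<exists>l r. strict_mono r \<and> (\<lambda>n. T (f (r n))) \<longlonglongrightarrow> l)"
  show "compact_op T"
    unfolding compact_op_def compact_def
  proof (intro conjI b allI impI)
    fix f :: "nat \<Rightarrow> 'h" assume f: "\<forall>n. f n \<in> closure (T ` cball 0 1)"
    have "\<exists>x. norm x \<le> 1 \<and> dist (T x) (f n) < inverse (real (Suc n))" for n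
    proof -
      have "inverse (real (Suc n)) > 0" by simp
      with f have "\<exists>y\<in>T ` cball 0 1. dist y (f n) < inverse (real (Suc n))"
        unfolding closure_approachable by blast
      then show ?thesis by (auto simp: image_iff)
    qed
    then obtain x where x: "\<And>n. norm (x n) \<le> 1"
      "\<And>n. dist (T (x n)) (f n) < inverse (real (Suc n))"
      by metis
    obtain l r where r: "strict_mono r" "(\<lambda>n. T (x (r n))) \<longlonglongrightarrow> l"
      using seq x(1) by blast
    have "(\<lambda>n. T (x n) - f n) \<longlonglongrightarrow> 0"
      by (rule tendsto_norm_zero_cancel, rule tendsto_sandwich[OF _ _ tendsto_const
            LIMSEQ_inverse_real_of_nat])
         (use x(2) in \<open>auto simp: dist_norm intro!: always_eventually less_imp_le\<close>)
    then have "(\<lambda>n. T (x (r n)) - f (r n)) \<longlonglongrightarrow> 0"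
      using LIMSEQ_subseq_LIMSEQ[OF _ r(1)] by (fastforce simp: o_def)
    from tendsto_diff[OF r(2) this] have lim: "(f \<circ> r) \<longlonglongrightarrow> l"
      by (simp add: o_def)
    have "l \<in> closure (T ` cball 0 1)"
      by (rule closed_sequentially[OF closed_closure _ lim]) (use f in auto)
    with r lim show "\<exists>l\<in>closure (T ` cball 0 1). \<exists>r. strict_mono r \<and> (f \<circ> r) \<longlonglongrightarrow> l"
      by blast
  qed
qed

lemma compact_op_bounded: "compact_op T \<Longrightarrow> bounded_op T"
  by (simp add: compact_op_def)

lemma compact_op_subseq:
  fixes f :: "nat \<Rightarrow> 'h::complex_hilbert_space"
  assumes "compact_op T" "\<And>n. norm (f n) \<le> B"
  obtains l r where "strict_mono r" "(\<lambda>n. T (f (r n))) \<longlonglongrightarrow> l"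
proof -
  define b where "b = max B 1"
  have b: "b > 0" "\<And>n. norm (f n) \<le> b"
    using assms(2) by (auto simp: b_def intro: max.coboundedI1)
  have "\<forall>n. norm ((1/b) *\<^sub>R f n) \<le> 1"
    using b by simp
  then obtain l r where r: "strict_mono r" "(\<lambda>n. T ((1/b) *\<^sub>R f (r n))) \<longlonglongrightarrow> l"
    using assms(1) unfolding compact_op_iff_seq by (auto dest: spec[of _ "\<lambda>n. (1/b) *\<^sub>R f n"])
  have "(\<lambda>n. b *\<^sub>R T ((1/b) *\<^sub>R f (r n))) \<longlonglongrightarrow> b *\<^sub>R l"
    by (intro tendsto_intros r)
  then have "(\<lambda>n. T (f (r n))) \<longlonglongrightarrow> b *\<^sub>R l"
    using b(1) bounded_opD(7)[OF compact_op_bounded[OF assms(1)]]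
    by (simp add: linear_simps)
  with r(1) show ?thesis by (rule that)
qed

lemma compact_op_add:
  assumes "compact_op S" "compact_op T"
  shows "compact_op (\<lambda>x. S x + T x)"
  unfolding compact_op_iff_seq
proof (intro conjI allI impI)
  show "bounded_op (\<lambda>x. S x + T x)"
    by (intro bounded_op_add compact_op_bounded assms)
  fix f :: "nat \<Rightarrow> 'a" assume f: "\<forall>n. norm (f n) \<le> 1"
  obtain l r where r: "strict_mono r" "(\<lambda>n. S (f (r n))) \<longlonglongrightarrow> l"
    using compact_op_subseq[OF assms(1)] f by blast
  obtain l' r' where r': "strict_mono r'" "(\<lambda>n. T (f (r (r' n)))) \<longlonglongrightarrow> l'"
    by (rule compact_op_subseq[OF assms(2), of "\<lambda>n. f (r n)" 1]) (use f in auto)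
  have "(\<lambda>n. S (f (r (r' n)))) \<longlonglongrightarrow> l"
    using LIMSEQ_subseq_LIMSEQ[OF r(2) r'(1)] by (simp add: o_def)
  from tendsto_add[OF this r'(2)] strict_mono_o[OF r(1) r'(1)]
  show "\<exists>l ra. strict_mono ra \<and> (\<lambda>n. S (f (ra n)) + T (f (ra n))) \<longlonglongrightarrow> l"
    by (intro exI[of _ "l + l'"] exI[of _ "r \<circ> r'"]) simp
qed

lemma compact_op_comp_left:
  assumes "bounded_op S" "compact_op T"
  shows "compact_op (S \<circ> T)"
  unfolding compact_op_iff_seq
proof (intro conjI allI impI)
  show "bounded_op (S \<circ> T)"
    by (intro bounded_op_comp compact_op_bounded assms)
  fix f :: "nat \<Rightarrow> 'a" assume f: "\<forall>n. norm (f n) \<le> 1"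
  obtain l r where r: "strict_mono r" "(\<lambda>n. T (f (r n))) \<longlonglongrightarrow> l"
    using compact_op_subseq[OF assms(2)] f by blast
  with bounded_op_tendsto[OF assms(1) r(2)]
  show "\<exists>l r. strict_mono r \<and> (\<lambda>n. (S \<circ> T) (f (r n))) \<longlonglongrightarrow> l"
    by auto
qed

lemma compact_op_comp_right:
  assumes "compact_op S" "bounded_op T"
  shows "compact_op (S \<circ> T)"
  unfolding compact_op_iff_seq
proof (intro conjI allI impI)
  show "bounded_op (S \<circ> T)"
    by (intro bounded_op_comp compact_op_bounded assms)
  fix f :: "nat \<Rightarrow> 'a" assume f: "\<forall>n. norm (f n) \<le> 1"
  obtain K where K: "K > 0" "\<And>x. norm (T x) \<le> K * norm x"
    using bounded_op_bound[OF assms(2)] by blast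
  have "norm (T (f n)) \<le> K" for n
    using K(2)[of "f n"] mult_left_le[of "norm (f n)" K] f K(1) by (meson less_imp_le order_trans)
  then obtain l r where r: "strict_mono r" "(\<lambda>n. S (T (f (r n)))) \<longlonglongrightarrow> l"
    by (rule compact_op_subseq[OF assms(1), of "\<lambda>n. T (f n)" K]) blast
  then show "\<exists>l r. strict_mono r \<and> (\<lambda>n. (S \<circ> T) (f (r n))) \<longlonglongrightarrow> l"
    by auto
qed

lemma compact_op_scaleC:
  assumes "compact_op T"
  shows "compact_op (\<lambda>x. c *\<^sub>C T x)"
  using compact_op_comp_left[OF bounded_op_scaleC[OF bounded_op_id(2), of c] assms]
  by (simp add: o_def)

text \<open>Since |T'x - T'y|^2 = <x - y, T T'(x - y)> for the adjoint T', a subsequence along which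
  the compact operator \<open>T \<circ> adj T\<close> converges is Cauchy under
  \<open>adj T\<close>.\<close>

lemma compact_op_adj:
  assumes "compact_op T"
  shows "compact_op (adj T)"
proof -
  note b = compact_op_bounded[OF assms]
  show ?thesis
    unfolding compact_op_iff_seq
  proof (intro conjI allI impI)
    show "bounded_op (adj T)" by (rule bounded_op_adj[OF b])
    fix f :: "nat \<Rightarrow> 'a" assume f: "\<forall>n. norm (f n) \<le> 1"
    obtain l r where r: "strict_mono r" "(\<lambda>n. (T \<circ> adj T) (f (r n))) \<longlonglongrightarrow> l"
      using compact_op_subseq[OF compact_op_comp_right[OF assms bounded_op_adj[OF b]]] f by blast
    have est: "(norm (adj T x - adj T y))\<^sup>2 \<le> 2 * norm (T (adj T x) - T (adj T y))"
      if "norm x \<le> 1" "norm y \<le> 1" for x y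
    proof -
      have "complex_of_real ((norm (adj T x - adj T y))\<^sup>2)
          = cinner (x - y) (T (adj T x) - T (adj T y))"
        unfolding cinner_self[symmetric]
        by (simp add: cinner_adj_left[OF b] cinner.diff_left cinner.diff_right)
      then have "(norm (adj T x - adj T y))\<^sup>2 = cmod (cinner (x - y) (T (adj T x) - T (adj T y)))"
        by (metis norm_of_real abs_of_nonneg zero_le_power2)
      also have "\<dots> \<le> norm (x - y) * norm (T (adj T x) - T (adj T y))"
        by (rule cmod_cinner_le)
      also have "\<dots> \<le> 2 * norm (T (adj T x) - T (adj T y))"
        using norm_triangle_ineq4[of x y] that by (intro mult_right_mono) auto
      finally show ?thesis .
    qed
    have "Cauchy (\<lambda>n. adj T (f (r n)))"
    proof (rule metric_CauchyI)
      fix e :: real assume e: "0 < e"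
      have "Cauchy (\<lambda>n. T (adj T (f (r n))))"
        using r(2) by (auto intro: LIMSEQ_imp_Cauchy)
      then obtain M where M: "\<And>i j. i \<ge> M \<Longrightarrow> j \<ge> M \<Longrightarrow>
          dist (T (adj T (f (r i)))) (T (adj T (f (r j)))) < e\<^sup>2 / 2"
        using metric_CauchyD[of _ "e\<^sup>2 / 2"] e by force
      show "\<exists>M. \<forall>i\<ge>M. \<forall>j\<ge>M. dist (adj T (f (r i))) (adj T (f (r j))) < e"
      proof (intro exI[of _ M] allI impI)
        fix i j assume "i \<ge> M" "j \<ge> M"
        then have "(norm (adj T (f (r i)) - adj T (f (r j))))\<^sup>2 < e\<^sup>2"
          using est[of "f (r i)" "f (r j)"] M[of i j] f by (force simp: dist_norm)
        then show "dist (adj T (f (r i))) (adj T (f (r j))) < e"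
          using e by (simp add: dist_norm power_less_imp_less_base)
      qed
    qed
    then show "\<exists>l r. strict_mono r \<and> (\<lambda>n. adj T (f (r n))) \<longlonglongrightarrow> l"
      using r(1) Cauchy_convergent convergent_def by blast
  qed
qed

subsection \<open>The spectral theorem for compact self-adjoint operators\<close>

text \<open>With \<open>m\<close> the norm of \<open>T\<close> on \<open>M\<close>, a maximizing
  sequence satisfies T^2 x - m^2 x -> 0, and compactness turns this into a vector with T^2 x = m^2
  x. The invariant subspace \<open>M\<close> is there for the iteration that follows;
  \<open>x0\<close> guarantees m > 0.\<close>

lemma compact_self_adjoint_eigenvector:
  fixes T :: "'h::complex_hilbert_space \<Rightarrow> 'h"
  assumes cpt: "compact_op T" and sa: "\<And>x y. cinner (T x) y = cinner x (T y)"
    and M: "complex_vector.subspace M" "closed M" "\<And>x. x \<in> M \<Longrightarrow> T x \<in> M"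
    and x0: "x0 \<in> M" "T x0 \<noteq> 0"
  shows "\<exists>e\<in>M. \<exists>l::real. norm e = 1 \<and> l \<noteq> 0 \<and> T e = l *\<^sub>R e \<and> (\<forall>x\<in>M. norm (T x) \<le> \<bar>l\<bar> * norm x)"
proof -
  note b = compact_op_bounded[OF cpt]
  interpret T: bounded_linear T by (rule bounded_opD(7)[OF b])
  have M_scaleR: "r *\<^sub>R x \<in> M" if "x \<in> M" for r x
    using M(1) that unfolding complex_vector.subspace_def scaleR_eq_scaleC by blast
  have M_add: "x + y \<in> M" if "x \<in> M" "y \<in> M" for x y
    using M(1) that unfolding complex_vector.subspace_def by blast
  have sa_inner: "inner (T x) y = inner x (T y)" for x y
    by (simp add: inner_eq_Re_cinner sa)
  obtain K where K: "K > 0" "\<And>x. norm (T x) \<le> K * norm x"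
    using bounded_op_bound[OF b] by blast
  define V where "V = {norm (T x) | x. x \<in> M \<and> norm x \<le> 1}"
  have bdd: "bdd_above V"
  proof (rule bdd_aboveI[of _ K])
    fix v assume "v \<in> V"
    then obtain x where "v = norm (T x)" "norm x \<le> 1" by (auto simp: V_def)
    then show "v \<le> K"
      using K(2)[of x] mult_left_le[of "norm x" K] K(1) by linarith
  qed
  define m where "m = Sup V"
  have m_ge: "norm (T x) \<le> m" if "x \<in> M" "norm x \<le> 1" for x
    unfolding m_def by (rule cSup_upper[OF _ bdd]) (use that in \<open>auto simp: V_def\<close>)
  have m_bound: "norm (T x) \<le> m * norm x" if "x \<in> M" for x
  proof (cases "x = 0")
    case False
    have "norm (T ((1 / norm x) *\<^sub>R x)) \<le> m"
      by (rule m_ge) (use that M_scaleR False in auto)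
    then show ?thesis using False by (simp add: T.scaleR field_simps)
  qed (simp add: T.zero)
  have "0 < m * norm x0"
    using m_bound[OF x0(1)] x0(2) by (metis norm_le_zero_iff not_le order_trans)
  then have m_pos: "m > 0"
    by (metis norm_ge_zero mult_nonpos_nonneg not_le)
  have "\<exists>x. x \<in> M \<and> norm x \<le> 1 \<and> m - inverse (real (Suc n)) < norm (T x)" for n
  proof -
    have "\<exists>v\<in>V. m - inverse (real (Suc n)) < v"
      by (subst less_cSup_iff[symmetric])
         (use bdd x0 M_scaleR[of x0 0] in \<open>auto simp: m_def V_def\<close>)
    then show ?thesis by (auto simp: V_def)
  qed
  then obtain X where X: "\<And>n. X n \<in> M" "\<And>n. norm (X n) \<le> 1"
      "\<And>n. m - inverse (real (Suc n)) < norm (T (X n))"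
    by metis
  have "(\<lambda>n. m - inverse (real (Suc n))) \<longlonglongrightarrow> m - 0"
    by (intro tendsto_intros LIMSEQ_inverse_real_of_nat)
  then have "(\<lambda>n. m - inverse (real (Suc n))) \<longlonglongrightarrow> m" by simp
  then have lim_m: "(\<lambda>n. norm (T (X n))) \<longlonglongrightarrow> m"
    by (rule tendsto_sandwich[OF _ _ _ tendsto_const, rotated 2])
       (use X m_ge in \<open>auto intro!: always_eventually less_imp_le[OF X(3)] simp del: of_nat_Suc\<close>)
  \<comment> \<open>The square is expanded using self-adjointness; both outer terms are bounded
    through \<open>m\<close>. The right-hand side vanishes along the maximizing sequence.\<close>
  have defect: "(norm (T (T x) - m\<^sup>2 *\<^sub>R x))\<^sup>2 \<le> m\<^sup>2 * (m\<^sup>2 - (norm (T x))\<^sup>2)"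
    if "x \<in> M" "norm x \<le> 1" for x
  proof -
    have "(norm (T (T x) - m\<^sup>2 *\<^sub>R x))\<^sup>2
        = (norm (T (T x)))\<^sup>2 - 2 * m\<^sup>2 * (norm (T x))\<^sup>2 + m^4 * (norm x)\<^sup>2"
      unfolding power2_norm_eq_inner
      using sa_inner[of "T x" x]
      by (simp add: inner_simps inner_commute algebra_simps power2_eq_square numeral_eq_Suc)
    moreover have "(norm (T (T x)))\<^sup>2 \<le> m\<^sup>2 * (norm (T x))\<^sup>2"
      unfolding power_mult_distrib[symmetric]
      by (rule power_mono[OF m_bound]) (use M(3) that in auto)
    moreover have "m^4 * (norm x)\<^sup>2 \<le> m^4 * 1"
      by (rule mult_left_mono) (use that in \<open>auto simp: power_le_one\<close>)
    moreover have "m\<^sup>2 * (m\<^sup>2 - (norm (T x))\<^sup>2) = m ^ 4 * 1 - m\<^sup>2 * (norm (T x))\<^sup>2"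
      by (simp add: algebra_simps power2_eq_square numeral_eq_Suc)
    ultimately show ?thesis by linarith
  qed
  have defect_lim: "(\<lambda>n. T (T (X n)) - m\<^sup>2 *\<^sub>R X n) \<longlonglongrightarrow> 0"
  proof -
    have "(\<lambda>n. m\<^sup>2 * (m\<^sup>2 - (norm (T (X n)))\<^sup>2)) \<longlonglongrightarrow> m\<^sup>2 * (m\<^sup>2 - m\<^sup>2)"
      by (intro tendsto_intros lim_m)
    then have "(\<lambda>n. m\<^sup>2 * (m\<^sup>2 - (norm (T (X n)))\<^sup>2)) \<longlonglongrightarrow> 0" by simp
    then have "(\<lambda>n. (norm (T (T (X n)) - m\<^sup>2 *\<^sub>R X n))\<^sup>2) \<longlonglongrightarrow> 0"
      by (rule tendsto_sandwich[OF _ _ tendsto_const, rotated 2]) (use defect X in auto)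
    from tendsto_real_sqrt[OF this]
    have "(\<lambda>n. norm (T (T (X n)) - m\<^sup>2 *\<^sub>R X n)) \<longlonglongrightarrow> 0" by simp
    then show ?thesis by (rule tendsto_norm_zero_cancel)
  qed
  obtain y r where r: "strict_mono r" "(\<lambda>n. T (X (r n))) \<longlonglongrightarrow> y"
    by (rule compact_op_subseq[OF cpt X(2)])
  have "(\<lambda>n. T (T (X (r n))) - (T (T (X (r n))) - m\<^sup>2 *\<^sub>R X (r n))) \<longlonglongrightarrow> T y - 0"
    by (rule tendsto_diff[OF T.tendsto[OF r(2)] LIMSEQ_subseq_LIMSEQ[OF defect_lim r(1), unfolded o_def]])
  from tendsto_scaleR[OF tendsto_const this, of "1 / m\<^sup>2"]
  have x: "(\<lambda>n. X (r n)) \<longlonglongrightarrow> (1 / m\<^sup>2) *\<^sub>R T y"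
    using m_pos by simp
  define x where "x = (1 / m\<^sup>2) *\<^sub>R T y"
  note x = x[folded x_def]
  have "x \<in> M"
    by (rule closed_sequentially[OF M(2) _ x]) (rule X(1))
  have "(\<lambda>n. T (T (X (r n))) - m\<^sup>2 *\<^sub>R X (r n)) \<longlonglongrightarrow> T (T x) - m\<^sup>2 *\<^sub>R x"
    by (rule tendsto_diff[OF T.tendsto[OF T.tendsto[OF x]] tendsto_scaleR[OF tendsto_const x]])
  from LIMSEQ_unique[OF this LIMSEQ_subseq_LIMSEQ[OF defect_lim r(1), unfolded o_def]]
  have TTx: "T (T x) = m\<^sup>2 *\<^sub>R x" by simp
  have "(\<lambda>n. norm (T (X (r n)))) \<longlonglongrightarrow> norm (T x)"
    by (rule tendsto_norm[OF T.tendsto[OF x]])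
  from LIMSEQ_unique[OF this LIMSEQ_subseq_LIMSEQ[OF lim_m r(1), unfolded o_def]]
  have "norm (T x) = m" .
  with m_pos have "x \<noteq> 0" by (auto simp: T.zero)
  \<comment> \<open>Factor (T - m)(T + m) x = 0: either \<open>x\<close> is an eigenvector for -m,
    or T x + m x is one for m.\<close>
  have "\<exists>z\<in>M. \<exists>l. z \<noteq> 0 \<and> \<bar>l\<bar> = m \<and> T z = l *\<^sub>R z"
  proof (cases "T x + m *\<^sub>R x = 0")
    case True
    then have "T x = (- m) *\<^sub>R x" by (simp add: eq_neg_iff_add_eq_0)
    then show ?thesis using \<open>x \<in> M\<close> \<open>x \<noteq> 0\<close> m_pos by (intro bexI[of _ x] exI[of _ "- m"]) auto
  next
    case False
    have "T (T x + m *\<^sub>R x) = m *\<^sub>R (T x + m *\<^sub>R x)"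
      by (simp add: T.add T.scaleR TTx scaleR_add_right power2_eq_square)
    then show ?thesis using False \<open>x \<in> M\<close> m_pos M
      by (intro bexI[of _ "T x + m *\<^sub>R x"] exI[of _ m]) (auto intro: M_add M_scaleR)
  qed
  then obtain z l where z: "z \<in> M" "z \<noteq> 0" "\<bar>l\<bar> = m" "T z = l *\<^sub>R z" by blast
  show ?thesis
    by (rule bexI[of _ "(1 / norm z) *\<^sub>R z"], rule exI[of _ l])
       (use z m_pos m_bound M_scaleR in \<open>auto simp: T.scaleR\<close>)
qed

text \<open>The system of eigenvectors may be finite, for instance if the space is
  finite-dimensional; it is then continued by zero vectors with eigenvalue zero.\<close>

definition eigensystem ::
    "('h::complex_hilbert_space \<Rightarrow> 'h) \<Rightarrow> (nat \<Rightarrow> 'h) \<Rightarrow> (nat \<Rightarrow> real) \<Rightarrow> bool" where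
  "eigensystem T e l \<longleftrightarrow>
     (\<forall>i j. i \<noteq> j \<longrightarrow> cinner (e i) (e j) = 0) \<and>
     (\<forall>i. norm (e i) = 1 \<and> l i \<noteq> 0 \<or> e i = 0 \<and> l i = 0) \<and>
     (\<forall>i. T (e i) = l i *\<^sub>R e i) \<and>
     decseq (\<lambda>i. \<bar>l i\<bar>) \<and> l \<longlonglongrightarrow> 0 \<and>
     (\<forall>k x. (\<forall>j<k. cinner (e j) x = 0) \<longrightarrow> norm (T x) \<le> \<bar>l k\<bar> * norm x)"

text \<open>Greedy choice: each new eigenvector realizes the norm of \<open>T\<close> on the
  orthogonal complement of the earlier ones, which \<open>T\<close> preserves by self-adjointness.
  Once \<open>T\<close> vanishes there, the pair (0, 0) is appended.\<close>

theorem compact_self_adjoint_eigensystem: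
  assumes cpt: "compact_op T" and sa: "\<And>x y. cinner (T x) y = cinner x (T y)"
  shows "\<exists>e l. eigensystem T e l"
proof -
  note b = compact_op_bounded[OF cpt]
  interpret T: bounded_linear T by (rule bounded_opD(7)[OF b])
  define M where "M f n = {x. \<forall>j<n. cinner (fst (f j)) x = 0}" for f :: "nat \<Rightarrow> 'a \<times> real" and n
  define P where "P f n p \<longleftrightarrow> fst p \<in> M f n \<and> T (fst p) = snd p *\<^sub>R fst p \<and>
     (\<forall>x\<in>M f n. norm (T x) \<le> \<bar>snd p\<bar> * norm x) \<and>
     (norm (fst p) = 1 \<and> snd p \<noteq> 0 \<or> fst p = 0 \<and> snd p = 0)"
    for f n and p :: "'a \<times> real"
  have "\<exists>f. \<forall>n. P f n (f n)"
  proof (rule dependent_wellorder_choice)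
    show "P f n p = P g n p" if "\<And>y. y < n \<Longrightarrow> f y = g y" for p f g n
    proof -
      have "M f n = M g n" using that by (auto simp: M_def)
      then show ?thesis by (simp add: P_def)
    qed
    show "\<exists>p. P f n p" if f: "\<And>y. y < n \<Longrightarrow> P f y (f y)" for n f
    proof (cases "\<exists>x0\<in>M f n. T x0 \<noteq> 0")
      case True
      then obtain x0 where x0: "x0 \<in> M f n" "T x0 \<noteq> 0" by blast
      have sub: "complex_vector.subspace (M f n)"
        unfolding complex_vector.subspace_def M_def
        by (auto simp: cinner_add_right cinner_scaleC_right cinner.zero_right)
      have cl: "closed (M f n)"
      proof -
        have "M f n = (\<Inter>j\<in>{..<n}. {x. cinner (fst (f j)) x = 0})"
          by (auto simp: M_def)
        moreover have "closed {x. cinner a x = 0}" for a :: 'a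
          by (rule closed_Collect_eq[OF
                bounded_linear.continuous_on[OF cinner.bounded_linear_right continuous_on_id]
                continuous_on_const])
        ultimately show ?thesis by auto
      qed
      have inv: "T x \<in> M f n" if "x \<in> M f n" for x
        using f that by (auto simp: M_def P_def sa[symmetric] cinner.scaleR_left)
      from compact_self_adjoint_eigenvector[OF cpt sa sub cl inv x0]
      obtain e and l :: real where "e \<in> M f n" "norm e = 1" "l \<noteq> 0" "T e = l *\<^sub>R e"
          "\<forall>x\<in>M f n. norm (T x) \<le> \<bar>l\<bar> * norm x" by blast
      then show ?thesis by (intro exI[of _ "(e, l)"]) (simp add: P_def)
    next
      case False
      then show ?thesis
        by (intro exI[of _ "(0, 0)"]) (auto simp: P_def M_def cinner.zero_right T.zero)
    qed
  qed
  then obtain f where f: "\<And>n. P f n (f n)" by blast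
  define e l where "e n = fst (f n)" and "l n = snd (f n)" for n
  have in_M: "cinner (e j) (e n) = 0" if "j < n" for j n
    using f[of n] that by (auto simp: P_def M_def e_def)
  have eig: "T (e n) = l n *\<^sub>R e n" for n
    using f[of n] by (auto simp: P_def e_def l_def)
  have unit: "norm (e n) = 1 \<and> l n \<noteq> 0 \<or> e n = 0 \<and> l n = 0" for n
    using f[of n] by (auto simp: P_def e_def l_def)
  have bound: "norm (T x) \<le> \<bar>l k\<bar> * norm x" if "\<forall>j<k. cinner (e j) x = 0" for k x
    using f[of k] that by (auto simp: P_def M_def e_def l_def)
  have orth: "cinner (e i) (e j) = 0" if "i \<noteq> j" for i j
    using in_M[of i j] in_M[of j i] that cinner_commute[of "e i" "e j"]
    by (cases i j rule: linorder_cases) auto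
  have "\<bar>l n\<bar> \<le> \<bar>l k\<bar>" if "k \<le> n" for k n
  proof (cases "e n = 0")
    case True
    then show ?thesis using unit[of n] by auto
  next
    case False
    have "norm (T (e n)) \<le> \<bar>l k\<bar> * norm (e n)"
      by (rule bound) (use that in_M in auto)
    then show ?thesis using False unit[of n] by (simp add: eig)
  qed
  then have dec: "decseq (\<lambda>i. \<bar>l i\<bar>)" by (auto simp: decseq_def)
  obtain L where L: "(\<lambda>i. \<bar>l i\<bar>) \<longlonglongrightarrow> L" "\<And>i. L \<le> \<bar>l i\<bar>"
    by (rule decseq_convergent[OF dec, of 0]) auto
  have "L \<ge> 0"
    by (rule LIMSEQ_le_const[OF L(1)]) auto
  \<comment> \<open>A positive limit \<open>L\<close> would keep the vectors T(e_i) at mutual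
    distance at least \<open>L\<close>, so no subsequence of them could converge.\<close>
  have "L = 0"
  proof (rule ccontr)
    assume "L \<noteq> 0"
    with \<open>L \<ge> 0\<close> have Lpos: "L > 0" by simp
    have nrm: "norm (e i) = 1" for i
      using unit[of i] L(2)[of i] Lpos by auto
    obtain y r where r: "strict_mono r" "(\<lambda>n. T (e (r n))) \<longlonglongrightarrow> y"
      by (rule compact_op_subseq[OF cpt, of e 1]) (simp add: nrm)
    then have "Cauchy (\<lambda>n. T (e (r n)))" by (auto intro: LIMSEQ_imp_Cauchy)
    then obtain N where N: "\<And>i j. i \<ge> N \<Longrightarrow> j \<ge> N \<Longrightarrow> dist (T (e (r i))) (T (e (r j))) < L"
      using metric_CauchyD[OF _ Lpos] by blast
    define i j where "i = r N" and "j = r (Suc N)"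
    have "i \<noteq> j" using strict_monoD[OF r(1), of N "Suc N"] by (simp add: i_def j_def)
    then have "inner (e i) (e j) = 0" using orth by (simp add: inner_eq_Re_cinner)
    then have "(norm (l i *\<^sub>R e i - l j *\<^sub>R e j))\<^sup>2 = (l i)\<^sup>2 * (norm (e i))\<^sup>2 + (l j)\<^sup>2 * (norm (e j))\<^sup>2"
      unfolding power2_norm_eq_inner by (simp add: inner_simps inner_commute power2_eq_square)
    also have "\<dots> \<ge> (l i)\<^sup>2" by (simp add: nrm)
    finally have "(l i)\<^sup>2 \<le> (norm (T (e i) - T (e j)))\<^sup>2" by (simp add: eig)
    then have "\<bar>l i\<bar> \<le> norm (T (e i) - T (e j))"
      by (metis abs_le_square_iff abs_norm_cancel)
    with L(2)[of i] N[of N "Suc N"] show False by (simp add: dist_norm i_def j_def)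
  qed
  with L(1) have "l \<longlonglongrightarrow> 0" by (simp add: tendsto_rabs_zero_iff)
  then have "eigensystem T e l"
    unfolding eigensystem_def using orth unit eig dec bound by blast
  then show ?thesis by blast
qed

subsection \<open>Diagonal operators\<close>

text \<open>Puts the Cauchy criterion for series of vectors at disposal.\<close>

instance complex_hilbert_space \<subseteq> banach ..

definition orthosystem :: "(nat \<Rightarrow> 'h::complex_hilbert_space) \<Rightarrow> bool" where
  "orthosystem e \<longleftrightarrow> (\<forall>i j. i \<noteq> j \<longrightarrow> cinner (e i) (e j) = 0) \<and> (\<forall>i. norm (e i) = 1 \<or> e i = 0)"

lemma orthosystem_coeff:
  assumes "orthosystem e"
  shows "cinner (e i) (e j) * cinner (e j) x = (if i = j then cinner (e j) x else 0)"
proof -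
  have "norm (e j) = 1 \<or> e j = 0" "i \<noteq> j \<Longrightarrow> cinner (e i) (e j) = 0"
    using assms unfolding orthosystem_def by blast+
  then show ?thesis
    by (elim disjE) (auto simp: cinner_self cinner.zero_left)
qed

lemma orthosystem_norm_le: "orthosystem e \<Longrightarrow> norm (e i) \<le> 1"
  unfolding orthosystem_def by (auto dest: spec[of _ i])

lemma eigensystem_orthosystem: "eigensystem T e l \<Longrightarrow> orthosystem e"
  unfolding eigensystem_def orthosystem_def by blast

lemma norm_sum_orthosystem:
  assumes "orthosystem e" "finite A"
  shows "(norm (\<Sum>k\<in>A. a k *\<^sub>C e k))\<^sup>2 = (\<Sum>k\<in>A. (cmod (a k))\<^sup>2 * (norm (e k))\<^sup>2)"
  using assms(2)
proof (induction A rule: finite_induct)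
  case (insert j A)
  have "cinner (a j *\<^sub>C e j) (\<Sum>k\<in>A. a k *\<^sub>C e k) = 0"
    unfolding cinner.sum_right
    by (rule sum.neutral) (use insert assms(1) in
      \<open>auto simp: cinner_scaleC_left cinner_scaleC_right orthosystem_def, metis\<close>)
  then have "inner (a j *\<^sub>C e j) (\<Sum>k\<in>A. a k *\<^sub>C e k) = 0"
    by (simp add: inner_eq_Re_cinner)
  then show ?case
    using insert by (simp add: power2_norm_eq_inner inner_simps inner_commute norm_scaleC)
      (simp add: power2_norm_eq_inner[symmetric] norm_scaleC power_mult_distrib)
qed simp

lemma cinner_orthosystem_sum:
  assumes "orthosystem e" "finite A" "j \<in> A"
  shows "cinner (e j) (\<Sum>k\<in>A. cinner (e k) x *\<^sub>C e k) = cinner (e j) x"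
proof -
  have "cinner (e j) (\<Sum>k\<in>A. cinner (e k) x *\<^sub>C e k)
      = (\<Sum>k\<in>A. if k = j then cinner (e j) x else 0)"
    unfolding cinner.sum_right
    by (rule sum.cong) (auto simp: cinner_scaleC_right mult.commute[of "cinner _ x"]
        orthosystem_coeff[OF assms(1)])
  also have "\<dots> = cinner (e j) x" using assms by simp
  finally show ?thesis .
qed

lemma norm_orthogonal_sum:
  assumes "cinner x y = 0"
  shows "(norm (x + y))\<^sup>2 = (norm x)\<^sup>2 + (norm y)\<^sup>2"
  using assms unfolding power2_norm_eq_inner
  by (simp add: inner_simps inner_commute inner_eq_Re_cinner[of x y])

lemma
  assumes "orthosystem e" "finite A"
  shows bessel_inequality: "(\<Sum>k\<in>A. (cmod (cinner (e k) x))\<^sup>2) \<le> (norm x)\<^sup>2"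
    and norm_orthogonal_remainder: "norm (x - (\<Sum>k\<in>A. cinner (e k) x *\<^sub>C e k)) \<le> norm x"
proof -
  define p where "p = (\<Sum>k\<in>A. cinner (e k) x *\<^sub>C e k)"
  have p2: "(norm p)\<^sup>2 = (\<Sum>k\<in>A. (cmod (cinner (e k) x))\<^sup>2)"
    unfolding p_def norm_sum_orthosystem[OF assms]
    by (rule sum.cong) (use assms(1) in \<open>auto simp: orthosystem_def cinner.zero_left\<close>,
        metis cinner.zero_left power_one)
  have "cinner (x - p) p = (\<Sum>k\<in>A. cinner (e k) x * cnj (cinner (e k) (x - p)))"
    unfolding p_def cinner.sum_right
    by (rule sum.cong) (auto simp: cinner_scaleC_right cinner_commute[of _ "e _"])
  also have "\<dots> = 0"
    unfolding p_def
    by (rule sum.neutral) (use cinner_orthosystem_sum[OF assms] in \<open>auto simp: cinner.diff_right\<close>)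
  finally have "(norm x)\<^sup>2 = (norm (x - p))\<^sup>2 + (norm p)\<^sup>2"
    using norm_orthogonal_sum[of "x - p" p] by simp
  then have "(norm p)\<^sup>2 \<le> (norm x)\<^sup>2" "(norm (x - p))\<^sup>2 \<le> (norm x)\<^sup>2"
    by simp_all
  then show "(\<Sum>k\<in>A. (cmod (cinner (e k) x))\<^sup>2) \<le> (norm x)\<^sup>2"
    "norm (x - (\<Sum>k\<in>A. cinner (e k) x *\<^sub>C e k)) \<le> norm x"
    unfolding p2[symmetric] p_def by (auto intro: power2_le_imp_le)
qed

text \<open>A functional calculus: when \<open>e\<close> are the eigenvectors of a compact
  self-adjoint operator, suitable coefficients produce its sign, its absolute value and its spectral
  cut-offs.\<close>

definition diag :: "(nat \<Rightarrow> 'h::complex_hilbert_space) \<Rightarrow> (nat \<Rightarrow> real) \<Rightarrow> 'h \<Rightarrow> 'h" where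
  "diag e c x = (\<Sum>k. (complex_of_real (c k) * cinner (e k) x) *\<^sub>C e k)"

context
  fixes e :: "nat \<Rightarrow> 'h::complex_hilbert_space"
  assumes os: "orthosystem e"
begin

lemma norm_diag_partial_sum:
  assumes "\<forall>k. \<bar>c k\<bar> \<le> C" "finite A"
  shows "(norm (\<Sum>k\<in>A. (complex_of_real (c k) * cinner (e k) x) *\<^sub>C e k))\<^sup>2
    \<le> C\<^sup>2 * (\<Sum>k\<in>A. (cmod (cinner (e k) x))\<^sup>2)"
proof -
  have "(cmod (complex_of_real (c k) * cinner (e k) x))\<^sup>2 * (norm (e k))\<^sup>2
      \<le> C\<^sup>2 * (cmod (cinner (e k) x))\<^sup>2" for k
  proof -
    have "(c k)\<^sup>2 \<le> C\<^sup>2" using order_trans[OF assms(1)[rule_format] abs_ge_self, of k]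
      by (simp add: abs_le_square_iff[symmetric])
    moreover have "(norm (e k))\<^sup>2 \<le> 1"
      using orthosystem_norm_le[OF os] by (simp add: power_le_one)
    ultimately have "(c k)\<^sup>2 * (cmod (cinner (e k) x))\<^sup>2 * (norm (e k))\<^sup>2
        \<le> C\<^sup>2 * (cmod (cinner (e k) x))\<^sup>2 * 1"
      by (intro mult_mono) auto
    then show ?thesis by (simp add: norm_mult power_mult_distrib)
  qed
  then show ?thesis
    unfolding norm_sum_orthosystem[OF os assms(2)] sum_distrib_left by (rule sum_mono)
qed

text \<open>By orthogonality the norm of a block of the series is at most a constant times a block
  of the Bessel series, which converges.\<close>

lemma diag_sums:
  assumes C: "\<forall>k. \<bar>c k\<bar> \<le> C"
  shows "(\<lambda>k. (complex_of_real (c k) * cinner (e k) x) *\<^sub>C e k) sums diag e c x"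
  unfolding diag_def
proof (rule summable_sums, unfold summable_Cauchy, intro allI impI)
  fix \<epsilon> :: real assume \<epsilon>: "\<epsilon> > 0"
  \<comment> \<open>\<open>C\<close> may be 0, and its square is to be divided by.\<close>
  define D where "D = \<bar>C\<bar> + 1"
  have D: "\<forall>k. \<bar>c k\<bar> \<le> D"
  proof
    fix k show "\<bar>c k\<bar> \<le> D" using C[rule_format, of k] unfolding D_def by linarith
  qed
  have Dpos: "D\<^sup>2 > 0" by (simp add: D_def add_nonneg_pos)
  have "summable (\<lambda>k. (cmod (cinner (e k) x))\<^sup>2)"
    by (rule summableI_nonneg_bounded[of _ "(norm x)\<^sup>2"]) (auto intro: bessel_inequality os)
  then obtain N where N: "\<And>m n. m \<ge> N \<Longrightarrow>
      norm (\<Sum>k=m..<n. (cmod (cinner (e k) x))\<^sup>2) < \<epsilon>\<^sup>2 / D\<^sup>2"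
    unfolding summable_Cauchy using \<epsilon> Dpos by (auto dest!: spec[of _ "\<epsilon>\<^sup>2 / D\<^sup>2"])
  show "\<exists>N. \<forall>m\<ge>N. \<forall>n. norm (\<Sum>k=m..<n. (complex_of_real (c k) * cinner (e k) x) *\<^sub>C e k) < \<epsilon>"
  proof (intro exI[of _ N] allI impI)
    fix m n assume "m \<ge> N"
    have "(norm (\<Sum>k=m..<n. (complex_of_real (c k) * cinner (e k) x) *\<^sub>C e k))\<^sup>2
        \<le> D\<^sup>2 * (\<Sum>k=m..<n. (cmod (cinner (e k) x))\<^sup>2)"
      by (rule norm_diag_partial_sum[OF D]) simp
    also have "\<dots> < D\<^sup>2 * (\<epsilon>\<^sup>2 / D\<^sup>2)"
      using N[OF \<open>m \<ge> N\<close>, of n] Dpos by (intro mult_strict_left_mono) (auto simp: sum_nonneg)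
    also have "\<dots> = \<epsilon>\<^sup>2" using Dpos by simp
    finally show "norm (\<Sum>k=m..<n. (complex_of_real (c k) * cinner (e k) x) *\<^sub>C e k) < \<epsilon>"
      using \<epsilon> by (simp add: power_less_imp_less_base)
  qed
qed

lemma norm_diag_le:
  assumes C: "\<forall>k. \<bar>c k\<bar> \<le> C"
  shows "norm (diag e c x) \<le> C * norm x"
proof (rule LIMSEQ_le_const2)
  show "(\<lambda>n. norm (\<Sum>k<n. (complex_of_real (c k) * cinner (e k) x) *\<^sub>C e k)) \<longlonglongrightarrow> norm (diag e c x)"
    using diag_sums[OF C] unfolding sums_def by (rule tendsto_norm)
  have "C \<ge> 0" using C abs_ge_zero order_trans by blast
  have "norm (\<Sum>k<n. (complex_of_real (c k) * cinner (e k) x) *\<^sub>C e k) \<le> C * norm x" for n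
  proof (rule power2_le_imp_le)
    have "(norm (\<Sum>k<n. (complex_of_real (c k) * cinner (e k) x) *\<^sub>C e k))\<^sup>2
        \<le> C\<^sup>2 * (\<Sum>k<n. (cmod (cinner (e k) x))\<^sup>2)"
      by (rule norm_diag_partial_sum[OF C]) simp
    also have "\<dots> \<le> C\<^sup>2 * (norm x)\<^sup>2"
      by (intro mult_left_mono bessel_inequality os) auto
    finally show "(norm (\<Sum>k<n. (complex_of_real (c k) * cinner (e k) x) *\<^sub>C e k))\<^sup>2
        \<le> (C * norm x)\<^sup>2" by (simp add: power_mult_distrib)
  qed (use \<open>C \<ge> 0\<close> in simp)
  then show "\<exists>N. \<forall>n\<ge>N. norm (\<Sum>k<n. (complex_of_real (c k) * cinner (e k) x) *\<^sub>C e k)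
      \<le> C * norm x" by blast
qed

lemma bounded_op_diag:
  assumes C: "\<forall>k. \<bar>c k\<bar> \<le> C"
  shows "bounded_op (diag e c)"
proof (rule bounded_opI)
  show "diag e c (x + y) = diag e c x + diag e c y" for x y
    by (rule sums_unique2[OF diag_sums[OF C, of "x + y"]])
       (use sums_add[OF diag_sums[OF C, of x] diag_sums[OF C, of y]] in
         \<open>simp add: cinner_add_right distrib_left scaleC_add_left\<close>)
  show "diag e c (z *\<^sub>C x) = z *\<^sub>C diag e c x" for z x
    by (rule sums_unique2[OF diag_sums[OF C, of "z *\<^sub>C x"]])
       (use bounded_linear.sums[OF scaleC.bounded_linear_right diag_sums[OF C, of x], of z] in
         \<open>simp add: cinner_scaleC_right scaleC_scaleC mult_ac\<close>)
qed (rule norm_diag_le[OF C])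

lemma cinner_diag:
  assumes C: "\<forall>k. \<bar>c k\<bar> \<le> C"
  shows "cinner (e j) (diag e c x) = complex_of_real (c j) * cinner (e j) x"
proof -
  have "cinner (e j) ((complex_of_real (c k) * cinner (e k) x) *\<^sub>C e k)
      = (if k = j then complex_of_real (c j) * cinner (e j) x else 0)" for k
    using orthosystem_coeff[OF os, of j k x]
    by (simp add: cinner_scaleC_right mult.assoc mult.commute[of "cinner _ x"])
  then show ?thesis
    using sums_unique2[OF bounded_linear.sums[OF cinner.bounded_linear_right diag_sums[OF C, of x]],
        of "e j" "complex_of_real (c j) * cinner (e j) x"]
      sums_single[of j "\<lambda>_. complex_of_real (c j) * cinner (e j) x"]
    by simp
qed

lemma diag_sym:
  assumes C: "\<forall>k. \<bar>c k\<bar> \<le> C"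
  shows "cinner (diag e c x) y = cinner x (diag e c y)"
proof -
  have "cinner ((complex_of_real (c k) * cinner (e k) x) *\<^sub>C e k) y
      = cinner x ((complex_of_real (c k) * cinner (e k) y) *\<^sub>C e k)" for k
    by (simp add: cinner_scaleC_left cinner_scaleC_right cinner_commute[of x "e k"] mult_ac)
  then show ?thesis
    using sums_unique2[OF
        bounded_linear.sums[OF cinner.bounded_linear_left diag_sums[OF C, of x], of y],
        of "cinner x (diag e c y)"]
      bounded_linear.sums[OF cinner.bounded_linear_right diag_sums[OF C, of y], of x]
    by simp
qed

lemma positive_op_diag:
  assumes C: "\<forall>k. \<bar>c k\<bar> \<le> C" and "\<And>k. c k \<ge> 0"
  shows "positive_op (diag e c)"
  unfolding positive_op_def
proof (intro allI)
  fix x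
  have "cinner x ((complex_of_real (c k) * cinner (e k) x) *\<^sub>C e k)
      = complex_of_real (c k * (cmod (cinner (e k) x))\<^sup>2)" for k
    using complex_norm_square[of "cinner (e k) x"]
    by (simp add: cinner_scaleC_right cinner_commute[of x "e k"] mult.assoc)
  then have s: "(\<lambda>k. complex_of_real (c k * (cmod (cinner (e k) x))\<^sup>2)) sums cinner x (diag e c x)"
    using bounded_linear.sums[OF cinner.bounded_linear_right diag_sums[OF C, of x], of x] by simp
  have "Im (cinner x (diag e c x)) = 0"
    using bounded_linear.sums[OF bounded_linear_Im s] by (simp add: sums_iff)
  moreover have "(\<lambda>k. c k * (cmod (cinner (e k) x))\<^sup>2) sums Re (cinner x (diag e c x))"
    using bounded_linear.sums[OF bounded_linear_Re s] by simp
  then have "0 \<le> Re (cinner x (diag e c x))"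
    by (rule sums_le[OF _ sums_zero, rotated]) (use assms(2) in auto)
  ultimately show "Im (cinner x (diag e c x)) = 0 \<and> 0 \<le> Re (cinner x (diag e c x))" ..
qed

lemma diag_diag:
  assumes "\<forall>k. \<bar>c k\<bar> \<le> C" "\<forall>k. \<bar>d k\<bar> \<le> D"
  shows "diag e c (diag e d x) = diag e (\<lambda>k. c k * d k) x"
  unfolding diag_def[of e c] diag_def[of e "\<lambda>k. c k * d k"] cinner_diag[OF assms(2)]
  by (simp add: mult_ac)

lemma diag_add:
  assumes "\<forall>k. \<bar>c k\<bar> \<le> C" "\<forall>k. \<bar>d k\<bar> \<le> D"
  shows "diag e (\<lambda>k. c k + d k) x = diag e c x + diag e d x"
proof -
  have "\<forall>k. \<bar>c k + d k\<bar> \<le> C + D"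
    using assms by (meson abs_triangle_ineq add_mono order_trans)
  from sums_unique2[OF diag_sums[OF this, of x], of "diag e c x + diag e d x"]
    sums_add[OF diag_sums[OF assms(1), of x] diag_sums[OF assms(2), of x]]
  show ?thesis by (simp add: distrib_right scaleC_add_left)
qed

end

lemma eigensystem_bounded:
  assumes "eigensystem T e l"
  shows "\<forall>k. \<bar>l k\<bar> \<le> \<bar>l 0\<bar>"
  using assms unfolding eigensystem_def decseq_def by blast

text \<open>Such an \<open>x\<close> satisfies the last clause of \<open>eigensystem\<close> for
  every \<open>k\<close>, and the bounds |l k| tend to 0.\<close>

lemma eigensystem_orthogonal_kernel:
  assumes "eigensystem T e l" "\<And>k. cinner (e k) x = 0"
  shows "T x = 0"
proof -
  have "norm (T x) \<le> 0 * norm x"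
  proof (rule LIMSEQ_le_const)
    show "(\<lambda>k. \<bar>l k\<bar> * norm x) \<longlonglongrightarrow> 0 * norm x"
      using assms(1) unfolding eigensystem_def
      by (intro tendsto_mult_right) (auto simp: tendsto_rabs_zero_iff)
    show "\<exists>N. \<forall>k\<ge>N. norm (T x) \<le> \<bar>l k\<bar> * norm x"
      using assms unfolding eigensystem_def by simp
  qed
  then show ?thesis by simp
qed

text \<open>\<open>diag\<close> with constant coefficient 1 is the projection onto the closed span
  of \<open>e\<close>; the remainder is orthogonal to all \<open>e k\<close>, hence killed by
  \<open>T\<close>.\<close>

lemma eigensystem_diag:
  assumes "eigensystem T e l" "bounded_op T"
  shows "T x = diag e l x"
proof -
  note os = eigensystem_orthosystem[OF assms(1)]
  have one: "\<forall>k::nat. \<bar>1::real\<bar> \<le> 1" by simp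
  have "cinner (e k) (x - diag e (\<lambda>_. 1) x) = 0" for k
    by (simp add: cinner.diff_right cinner_diag[OF os one])
  then have "T (x - diag e (\<lambda>_. 1) x) = 0"
    by (rule eigensystem_orthogonal_kernel[OF assms(1)])
  then have "T x = T (diag e (\<lambda>_. 1) x)"
    by (simp add: bounded_opD(5)[OF assms(2)])
  also have "\<dots> = diag e l x"
  proof -
    have "T (cinner (e k) x *\<^sub>C e k) = (complex_of_real (l k) * cinner (e k) x) *\<^sub>C e k" for k
      using assms(1) unfolding eigensystem_def
      by (simp add: bounded_opD(2)[OF assms(2)] scaleR_eq_scaleC scaleC_scaleC mult.commute)
    then show ?thesis
      using sums_unique2[OF diag_sums[OF os eigensystem_bounded[OF assms(1)], of x],
          of "T (diag e (\<lambda>_. 1) x)"]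
        bounded_linear.sums[OF bounded_opD(7)[OF assms(2)] diag_sums[OF os one, of x]]
      by simp
  qed
  finally show ?thesis .
qed

subsection \<open>Singular values as approximation numbers\<close>

text \<open>The uniqueness behind the description of \<open>singular_value\<close>. At the first
  index \<open>k\<close> with, say, t k < s k, the value s k occurs in \<open>t\<close> only before
  \<open>k\<close>, where the sequences agree, so strictly less often than in \<open>s\<close>;
  convergence to 0 makes these counts finite.\<close>

lemma decseq_eq_if_multiplicities_eq:
  fixes s t :: "nat \<Rightarrow> real"
  assumes "decseq s" "s \<longlonglongrightarrow> 0" "decseq t" "t \<longlonglongrightarrow> 0"
    and card: "\<And>r. r > 0 \<Longrightarrow> card {k. s k = r} = card {k. t k = r}"
  shows "s = t"
proof -
  have no_gap: "\<not> t k < s k"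
    if "decseq s" "s \<longlonglongrightarrow> 0" "decseq t" "t \<longlonglongrightarrow> 0"
      "\<And>r. r > 0 \<Longrightarrow> card {k. s k = r} = card {k. t k = r}" "\<And>j. j < k \<Longrightarrow> s j = t j"
    for s t :: "nat \<Rightarrow> real" and k
  proof
    assume less: "t k < s k"
    have "0 \<le> t k" using decseq_ge[OF that(3,4)] .
    with less have pos: "0 < s k" by linarith
    have "\<forall>\<^sub>F n in sequentially. s n < s k"
      using order_tendstoD(2)[OF that(2) pos] .
    then obtain N where N: "\<And>n. n \<ge> N \<Longrightarrow> s n < s k"
      by (auto simp: eventually_sequentially)
    have "{j. s j = s k} \<subseteq> {..<N}"
    proof
      fix j assume "j \<in> {j. s j = s k}"
      then show "j \<in> {..<N}" using N[of j] by (cases "N \<le> j") auto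
    qed
    then have fin: "finite {j. s j = s k}" by (rule finite_subset) simp
    have "{j. t j = s k} \<subset> {j. s j = s k}"
    proof
      show "{j. t j = s k} \<subseteq> {j. s j = s k}"
      proof
        fix j assume j: "j \<in> {j. t j = s k}"
        have "j < k"
        proof (rule ccontr)
          assume "\<not> j < k"
          then have "t j \<le> t k" using that(3) by (simp add: decseq_def)
          then show False using j less by simp
        qed
        then show "j \<in> {j. s j = s k}" using j that(6) by simp
      qed
      have "k \<in> {j. s j = s k}" "k \<notin> {j. t j = s k}" using less by auto
      then show "{j. t j = s k} \<noteq> {j. s j = s k}" by metis
    qed
    from psubset_card_mono[OF fin this] that(5)[OF pos] show False by simp
  qed
  have "s k = t k" for k
  proof (induction k rule: less_induct)
    case (less k)
    have "\<not> t k < s k" by (rule no_gap) (use assms less in auto)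
    moreover have "\<not> s k < t k" by (rule no_gap) (use assms less in auto)
    ultimately show ?case by simp
  qed
  then show ?thesis by blast
qed

text \<open>The \<open>e k\<close> with \<open>m k = r\<close> form a basis: they are orthonormal as
  r is nonzero, finitely many as m tends to 0, and they span the eigenspace.\<close>

lemma dim_eigenspace:
  assumes es: "eigensystem S e m" and b: "bounded_op S" and r: "r \<noteq> 0"
  shows "complex_vector.dim {x. S x = complex_of_real r *\<^sub>C x} = card {k. m k = r}"
proof -
  define I where "I = {k. m k = r}"
  have orth: "cinner (e i) (e j) = 0" if "i \<noteq> j" for i j
    using es that unfolding eigensystem_def by blast
  have unit: "norm (e i) = 1" if "i \<in> I" for i
    using es that r unfolding eigensystem_def I_def by fastforce
  have unit': "cinner (e i) (e i) = 1" if "i \<in> I" for i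
    using unit[OF that] by (simp add: cinner_self)
  have eig: "S (e k) = m k *\<^sub>R e k" for k
    using es unfolding eigensystem_def by blast
  have os: "orthosystem e" by (rule eigensystem_orthosystem[OF es])
  have "finite I"
  proof -
    have "m \<longlonglongrightarrow> 0" using es unfolding eigensystem_def by blast
    then have "(\<lambda>k. \<bar>m k\<bar>) \<longlonglongrightarrow> 0" by (simp add: tendsto_rabs_zero_iff)
    then have "\<forall>\<^sub>F k in sequentially. \<bar>m k\<bar> < \<bar>r\<bar>"
      by (rule order_tendstoD(2)) (use r in simp)
    then obtain N where N: "\<And>k. k \<ge> N \<Longrightarrow> \<bar>m k\<bar> < \<bar>r\<bar>"
      by (auto simp: eventually_sequentially)
    have "I \<subseteq> {..<N}"
    proof
      fix k assume "k \<in> I"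
      then show "k \<in> {..<N}" using N[of k] by (cases "N \<le> k") (auto simp: I_def)
    qed
    then show ?thesis by (rule finite_subset) simp
  qed
  have inj: "inj_on e I"
  proof (rule inj_onI)
    fix i j assume "i \<in> I" "j \<in> I" "e i = e j"
    then show "i = j" using orth[of i j] unit'[of j] by (cases "i = j") auto
  qed
  have "complex_vector.dim {x. S x = complex_of_real r *\<^sub>C x} = card I"
  proof (rule complex_vector.dim_unique)
    show "e ` I \<subseteq> {x. S x = complex_of_real r *\<^sub>C x}"
      by (auto simp: eig I_def scaleR_eq_scaleC)
    show "card (e ` I) = card I" by (rule card_image[OF inj])
    show "complex_vector.independent (e ` I)"
    proof (rule complex_vector.independent_if_scalars_zero)
      show "finite (e ` I)" using \<open>finite I\<close> by simp
      fix f x assume f: "(\<Sum>x\<in>e ` I. f x *\<^sub>C x) = 0" and "x \<in> e ` I"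
      then obtain i where i: "x = e i" "i \<in> I" by blast
      have "0 = cinner (e i) (\<Sum>j\<in>I. f (e j) *\<^sub>C e j)"
        using f by (simp add: sum.reindex[OF inj] cinner.zero_right)
      also have "\<dots> = (\<Sum>j\<in>I. if j = i then f (e i) else 0)"
        unfolding cinner.sum_right
        by (rule sum.cong) (use i orth unit' in \<open>auto simp: cinner_scaleC_right\<close>)
      also have "\<dots> = f x" using i \<open>finite I\<close> by simp
      finally show "f x = 0" by simp
    qed
    show "{x. S x = complex_of_real r *\<^sub>C x} \<subseteq> complex_vector.span (e ` I)"
    proof
      fix x assume "x \<in> {x. S x = complex_of_real r *\<^sub>C x}"
      then have x: "S x = complex_of_real r *\<^sub>C x" by simp
      define p where "p = (\<Sum>k\<in>I. cinner (e k) x *\<^sub>C e k)"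
      have coeff: "cinner (e k) (S x) = complex_of_real (m k) * cinner (e k) x" for k
        unfolding eigensystem_diag[OF es b]
        by (rule cinner_diag[OF os eigensystem_bounded[OF es]])
      have "cinner (e k) (x - p) = 0" for k
      proof (cases "k \<in> I")
        case True
        then show ?thesis
          using cinner_orthosystem_sum[OF os \<open>finite I\<close> True] by (simp add: p_def cinner.diff_right)
      next
        case False
        have "complex_of_real r * cinner (e k) x = complex_of_real (m k) * cinner (e k) x"
          using coeff[of k] by (simp add: x cinner_scaleC_right)
        then have "cinner (e k) x = 0" using False by (auto simp: I_def)
        moreover have "cinner (e k) (e j) = 0" if "j \<in> I" for j
          using orth that False by metis
        then have "cinner (e k) p = 0"
          unfolding p_def cinner.sum_right
          by (intro sum.neutral) (simp add: cinner_scaleC_right)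
        ultimately show ?thesis by (simp add: cinner.diff_right)
      qed
      \<comment> \<open>The difference x - p lies both in the kernel of \<open>S\<close> and in its
        r-eigenspace, hence is 0.\<close>
      then have "S (x - p) = 0" by (rule eigensystem_orthogonal_kernel[OF es])
      moreover have "S p = complex_of_real r *\<^sub>C p"
        unfolding p_def bounded_opD(6)[OF b] scaleC.sum_right
        by (rule sum.cong)
          (auto simp: bounded_opD(2)[OF b] eig I_def scaleR_eq_scaleC scaleC_scaleC mult.commute)
      ultimately have "complex_of_real r *\<^sub>C (x - p) = 0"
        by (simp add: bounded_opD(5)[OF b] x scaleC.diff_right)
      then have "x = p" using r by (metis eq_iff_diff_eq_0 mult_eq_0_iff norm_eq_zero norm_of_real norm_scaleC of_real_eq_0_iff abs_eq_0)
      moreover have "p \<in> complex_vector.span (e ` I)"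
        unfolding p_def
        by (rule complex_vector.span_sum, rule complex_vector.span_scale, rule complex_vector.span_base) auto
      ultimately show "x \<in> complex_vector.span (e ` I)" by simp
    qed
  qed
  then show ?thesis by (simp add: I_def)
qed

lemma singular_value_eqI:
  assumes "eigensystem (\<lambda>x. adj T (T x)) e m" "bounded_op (\<lambda>x. adj T (T x))" "\<And>k. m k \<ge> 0"
  shows "singular_value T = (\<lambda>k. sqrt (m k))"
  unfolding singular_value_def
proof (rule the_equality)
  have "m \<longlonglongrightarrow> 0" and dec: "decseq m"
    using assms(1,3) unfolding eigensystem_def by auto
  have lim: "(\<lambda>k. sqrt (m k)) \<longlonglongrightarrow> 0"
    using tendsto_real_sqrt[OF \<open>m \<longlonglongrightarrow> 0\<close>] by simp
  have card: "card {k. sqrt (m k) = r}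
      = complex_vector.dim {x. adj T (T x) = complex_of_real (r\<^sup>2) *\<^sub>C x}" if "r > 0" for r
  proof -
    have "sqrt (m k) = r \<longleftrightarrow> m k = r\<^sup>2" for k
      using assms(3)[of k] that by (auto simp: real_sqrt_unique)
    then show ?thesis
      using dim_eigenspace[OF assms(1,2), of "r\<^sup>2"] that by simp
  qed
  show *: "decseq (\<lambda>k. sqrt (m k)) \<and> (\<lambda>k. sqrt (m k)) \<longlonglongrightarrow> 0 \<and> (\<forall>r>0. card {k. sqrt (m k) = r}
      = complex_vector.dim {x. adj T (T x) = complex_of_real (r\<^sup>2) *\<^sub>C x})"
    using dec lim card by (auto simp: decseq_def)
  fix s assume s: "decseq s \<and> s \<longlonglongrightarrow> 0 \<and>
     (\<forall>r>0. card {k. s k = r} = complex_vector.dim {x. adj T (T x) = complex_of_real (r\<^sup>2) *\<^sub>C x})"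
  show "s = (\<lambda>k. sqrt (m k))"
    by (rule decseq_eq_if_multiplicities_eq) (use s * in auto)
qed

lemma singular_value_eigensystem:
  assumes "compact_op T"
  obtains e m where "eigensystem (\<lambda>x. adj T (T x)) e m" "\<And>k. m k \<ge> 0"
    "singular_value T = (\<lambda>k. sqrt (m k))"
proof -
  note b = compact_op_bounded[OF assms]
  have cpt: "compact_op (\<lambda>x. adj T (T x))"
    using compact_op_comp_left[OF bounded_op_adj[OF b] assms] by (simp add: o_def)
  have "cinner (adj T (T x)) y = cinner x (adj T (T y))" for x y
    by (simp add: cinner_adj_left[OF b] cinner_adj_right[OF b])
  from compact_self_adjoint_eigensystem[OF cpt this]
  obtain e m where es: "eigensystem (\<lambda>x. adj T (T x)) e m" by blast
  have nonneg: "m k \<ge> 0" for k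
  proof -
    have "norm (e k) = 1 \<or> m k = 0" "adj T (T (e k)) = m k *\<^sub>R e k"
      using es unfolding eigensystem_def by blast+
    moreover have "complex_of_real ((norm (T (e k)))\<^sup>2) = cinner (e k) (adj T (T (e k)))"
      by (simp only: cinner_adj_right[OF b] cinner_self)
    ultimately have "m k = 0 \<or> complex_of_real ((norm (T (e k)))\<^sup>2) = complex_of_real (m k)"
      by (auto simp: cinner.scaleR_right cinner_self scaleR_conv_of_real)
    then have "m k = 0 \<or> (norm (T (e k)))\<^sup>2 = m k" by (simp only: of_real_eq_iff)
    then show ?thesis by (metis order_refl zero_le_power2)
  qed
  from that[OF es nonneg singular_value_eqI[OF es compact_op_bounded[OF cpt] nonneg]]
  show ?thesis .
qed

lemma singular_value_decseq: "compact_op T \<Longrightarrow> decseq (singular_value T)"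
  by (erule singular_value_eigensystem) (auto simp: eigensystem_def decseq_def)

lemma singular_value_nonneg: "compact_op T \<Longrightarrow> 0 \<le> singular_value T k"
  by (erule singular_value_eigensystem) auto

lemma singular_value_tendsto: "compact_op T \<Longrightarrow> singular_value T \<longlonglongrightarrow> 0"
proof (erule singular_value_eigensystem)
  fix e m assume "eigensystem (\<lambda>x. adj T (T x)) e m" "singular_value T = (\<lambda>k. sqrt (m k))"
  then show "singular_value T \<longlonglongrightarrow> 0"
    using tendsto_real_sqrt[of m 0] by (simp add: eigensystem_def)
qed

text \<open>\<open>c\<close> bounds the distance of \<open>T\<close> to some operator of rank at most \<open>k\<close>.  A rank-\<open>k\<close> operator is
  given by two families of vectors, so that adjoints and compositions are visibly of finite rank.\<close>

definition rank_approx :: "nat \<Rightarrow> ('h::complex_hilbert_space \<Rightarrow> 'h) \<Rightarrow> real \<Rightarrow> bool" where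
  "rank_approx k T c \<longleftrightarrow>
     (\<exists>f g. \<forall>x. norm (T x - (\<Sum>j<k. cinner (f j) x *\<^sub>C g j)) \<le> c * norm x)"

text \<open>The approximant is \<open>T\<close> after projection to the first \<open>k\<close>
  eigenvectors \<open>e j\<close> of \<open>adj T \<circ> T\<close>. On their orthogonal complement
  |T y|^2 = <y, adj T (T y)> is at most m k times |y|^2.\<close>

lemma rank_approx_singular_value:
  assumes "compact_op T"
  shows "rank_approx k T (singular_value T k)"
proof -
  note b = compact_op_bounded[OF assms]
  obtain e m where es: "eigensystem (\<lambda>x. adj T (T x)) e m" and m: "\<And>k. m k \<ge> 0"
    "singular_value T = (\<lambda>k. sqrt (m k))"
    using singular_value_eigensystem[OF assms] by blast
  note os = eigensystem_orthosystem[OF es]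
  have "norm (T x - (\<Sum>j<k. cinner (e j) x *\<^sub>C T (e j))) \<le> sqrt (m k) * norm x" for x
  proof -
    define y where "y = x - (\<Sum>j<k. cinner (e j) x *\<^sub>C e j)"
    have y: "T x - (\<Sum>j<k. cinner (e j) x *\<^sub>C T (e j)) = T y" "norm y \<le> norm x"
      using norm_orthogonal_remainder[OF os] by (simp_all add: y_def bounded_opD[OF b])
    have "\<forall>j<k. cinner (e j) y = 0"
      using cinner_orthosystem_sum[OF os, of "{..<k}"] by (simp add: y_def cinner.diff_right)
    then have Sy: "norm (adj T (T y)) \<le> m k * norm y"
      using es m(1)[of k] unfolding eigensystem_def by (metis abs_of_nonneg)
    have "complex_of_real ((norm (T y))\<^sup>2) = cinner y (adj T (T y))"
      by (simp only: cinner_adj_right[OF b] cinner_self)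
    then have "(norm (T y))\<^sup>2 = cmod (cinner y (adj T (T y)))"
      by (metis norm_of_real abs_of_nonneg zero_le_power2)
    also have "\<dots> \<le> norm y * (m k * norm y)"
      by (rule order_trans[OF cmod_cinner_le mult_left_mono[OF Sy]]) simp
    also have "\<dots> = (sqrt (m k) * norm y)\<^sup>2"
      using m(1)[of k] by (simp add: power_mult_distrib power2_eq_square mult_ac)
    finally have "norm (T y) \<le> sqrt (m k) * norm y"
      by (rule power2_le_imp_le) (use m(1)[of k] in simp)
    also have "\<dots> \<le> sqrt (m k) * norm x"
      by (rule mult_left_mono[OF y(2)]) (use m(1)[of k] in simp)
    finally show ?thesis using y(1) by simp
  qed
  then show ?thesis
    unfolding rank_approx_def m(2) by (intro exI[of _ e] exI[of _ "\<lambda>j. T (e j)"] allI)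
qed

text \<open>An operator of rank at most \<open>k\<close> kills a nontrivial combination of
  \<open>k + 1\<close> vectors. Linear dependence is a property of sets, so coinciding images are
  treated apart, with coefficients 1 and -1.\<close>

lemma exists_vanishing_combination:
  fixes f e :: "nat \<Rightarrow> 'h::complex_hilbert_space"
  shows "\<exists>c. (\<exists>i\<le>k. c i \<noteq> 0) \<and> (\<Sum>i\<le>k. c i *\<^sub>C (\<Sum>j<k. cinner (f j) (e i) *\<^sub>C g j)) = 0"
proof -
  define v where "v i = (\<Sum>j<k. cinner (f j) (e i) *\<^sub>C g j)" for i
  have v_span: "v i \<in> complex_vector.span (g ` {..<k})" for i
    unfolding v_def
    by (rule complex_vector.span_sum, rule complex_vector.span_scale, rule complex_vector.span_base) auto
  show ?thesis
  proof (cases "inj_on v {..k}")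
    case True
    have "card (v ` {..k}) = Suc k" by (simp add: card_image[OF True])
    moreover have "card (g ` {..<k}) \<le> k" using card_image_le[of "{..<k}" g] by simp
    ultimately have "complex_vector.dependent (v ` {..k})"
      using complex_vector.independent_span_bound[of "g ` {..<k}" "v ` {..k}"] v_span by fastforce
    then obtain u where u: "(\<Sum>x\<in>v ` {..k}. u x *\<^sub>C x) = 0" "\<exists>x\<in>v ` {..k}. u x \<noteq> 0"
      using complex_vector.independent_if_scalars_zero[of "v ` {..k}"]
        complex_vector.dependent_finite[of "v ` {..k}"] by auto
    then show ?thesis
      by (intro exI[of _ "\<lambda>i. u (v i)"]) (auto simp: sum.reindex[OF True] v_def[symmetric])
  next
    case False
    then obtain a b where ab: "a \<le> k" "b \<le> k" "a \<noteq> b" "v a = v b"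
      by (auto simp: inj_on_def)
    define c where "c i = (if i = a then 1 else if i = b then - 1 else (0::complex))" for i
    have "(\<Sum>i\<le>k. c i *\<^sub>C v i) = (\<Sum>i\<le>k. (if i = a then v a else 0) + (if i = b then - v b else 0))"
      by (rule sum.cong) (use ab(3) in \<open>auto simp: c_def scaleC_one scaleC.minus_left scaleC.zero_left\<close>)
    also have "\<dots> = 0" using ab by (simp add: sum.distrib)
    finally have "(\<Sum>i\<le>k. c i *\<^sub>C v i) = 0" .
    moreover have "c a \<noteq> 0" by (simp add: c_def)
    ultimately show ?thesis using ab(1) unfolding v_def by blast
  qed
qed

text \<open>Some nontrivial combination \<open>x\<close> of the first \<open>k + 1\<close>
  eigenvectors of \<open>adj T \<circ> T\<close> is killed by the approximant. On it |T x| is at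
  most c |x|, while |T x|^2 is at least m k times |x|^2.\<close>

lemma singular_value_le_rank_approx:
  assumes "compact_op T" "rank_approx k T c" "c \<ge> 0"
  shows "singular_value T k \<le> c"
proof -
  note b = compact_op_bounded[OF assms(1)]
  obtain e m where es: "eigensystem (\<lambda>x. adj T (T x)) e m" and m: "\<And>k. m k \<ge> 0"
    "singular_value T = (\<lambda>k. sqrt (m k))"
    using singular_value_eigensystem[OF assms(1)] by blast
  note os = eigensystem_orthosystem[OF es]
  have "m k \<le> c\<^sup>2"
  proof (cases "m k = 0")
    case False
    have mdec: "m k \<le> m i" if "i \<le> k" for i
      using es m(1) that unfolding eigensystem_def decseq_def by force
    \<comment> \<open>A nonzero \<open>m k\<close> means that the padding by zero vectors has not
      begun by index \<open>k\<close>.\<close>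
    have unit: "norm (e i) = 1" if "i \<le> k" for i
      using es mdec[OF that] False m(1)[of k] unfolding eigensystem_def
      by (metis order_antisym)
    obtain f g where fg: "\<And>x. norm (T x - (\<Sum>j<k. cinner (f j) x *\<^sub>C g j)) \<le> c * norm x"
      using assms(2) unfolding rank_approx_def by blast
    obtain a where a: "\<exists>i\<le>k. a i \<noteq> 0" "(\<Sum>i\<le>k. a i *\<^sub>C (\<Sum>j<k. cinner (f j) (e i) *\<^sub>C g j)) = 0"
      using exists_vanishing_combination[of k f e g] by blast
    define x where "x = (\<Sum>i\<le>k. a i *\<^sub>C e i)"
    have "(\<Sum>j<k. cinner (f j) x *\<^sub>C g j) = (\<Sum>j<k. \<Sum>i\<le>k. (a i * cinner (f j) (e i)) *\<^sub>C g j)"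
      unfolding x_def cinner.sum_right scaleC.sum_left cinner_scaleC_right ..
    also have "\<dots> = (\<Sum>i\<le>k. a i *\<^sub>C (\<Sum>j<k. cinner (f j) (e i) *\<^sub>C g j))"
      unfolding scaleC.sum_right scaleC_scaleC by (rule sum.swap)
    finally have "norm (T x) \<le> c * norm x" using fg[of x] a(2) by simp
    then have upper: "(norm (T x))\<^sup>2 \<le> c\<^sup>2 * (norm x)\<^sup>2"
      by (metis norm_ge_zero power_mono power_mult_distrib)
    have nx: "(norm x)\<^sup>2 = (\<Sum>i\<le>k. (cmod (a i))\<^sup>2)"
      unfolding x_def norm_sum_orthosystem[OF os finite_atMost] by (simp add: unit)
    have Sx: "adj T (T x) = (\<Sum>i\<le>k. (complex_of_real (m i) * a i) *\<^sub>C e i)"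
    proof -
      have "adj T (T (e i)) = complex_of_real (m i) *\<^sub>C e i" for i
        using es by (simp add: eigensystem_def scaleR_eq_scaleC)
      then show ?thesis
        unfolding x_def by (simp add: bounded_opD[OF b] bounded_opD[OF bounded_op_adj[OF b]]
            scaleC_scaleC mult.commute)
    qed
    have "complex_of_real ((norm (T x))\<^sup>2) = cinner x (adj T (T x))"
      by (simp only: cinner_adj_right[OF b] cinner_self)
    also have "\<dots> = (\<Sum>i\<le>k. complex_of_real (m i) * a i * cinner x (e i))"
      unfolding Sx cinner.sum_right cinner_scaleC_right ..
    also have "\<dots> = (\<Sum>i\<le>k. complex_of_real (m i * (cmod (a i))\<^sup>2))"
    proof (rule sum.cong[OF refl])
      fix i assume i: "i \<in> {..k}"
      have "cinner (e i) x = (\<Sum>j\<le>k. if j = i then a i else 0)"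
        unfolding x_def cinner.sum_right
        by (rule sum.cong) (use os unit i in \<open>auto simp: cinner_scaleC_right cinner_self orthosystem_def\<close>)
      also have "\<dots> = a i" using i by simp
      finally have "cinner x (e i) = cnj (a i)" by (metis cinner_commute)
      then show "complex_of_real (m i) * a i * cinner x (e i) = complex_of_real (m i * (cmod (a i))\<^sup>2)"
        using complex_norm_square[of "a i"] by (simp add: mult.assoc)
    qed
    also have "\<dots> = complex_of_real (\<Sum>i\<le>k. m i * (cmod (a i))\<^sup>2)" by simp
    finally have "(norm (T x))\<^sup>2 = (\<Sum>i\<le>k. m i * (cmod (a i))\<^sup>2)" by (simp only: of_real_eq_iff)
    moreover have "(\<Sum>i\<le>k. m k * (cmod (a i))\<^sup>2) \<le> (\<Sum>i\<le>k. m i * (cmod (a i))\<^sup>2)"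
      by (intro sum_mono mult_right_mono mdec) auto
    ultimately have "m k * (norm x)\<^sup>2 \<le> c\<^sup>2 * (norm x)\<^sup>2"
      using upper by (simp add: nx sum_distrib_left)
    moreover have "(norm x)\<^sup>2 > 0"
      unfolding nx using a(1) by (auto intro!: sum_pos2[of _ _ "\<lambda>i. (cmod (a i))\<^sup>2"])
    ultimately show ?thesis by simp
  qed simp
  then have "sqrt (m k) \<le> c" using assms(3) by (simp add: real_le_lsqrt)
  then show ?thesis by (simp add: m(2))
qed

section \<open>Finite rank approximation and singular values of sums, products and adjoints\<close>

lemma sum_lessThan_add:
  fixes f :: "nat \<Rightarrow> 'b::comm_monoid_add"
  shows "(\<Sum>k<i + j. f k) = (\<Sum>k<i. f k) + (\<Sum>k<j. f (i + k))"
  by (induction j) (simp_all add: add.assoc)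

lemma rank_approx_add:
  assumes "rank_approx i S c" "rank_approx j T d"
  shows "rank_approx (i + j) (\<lambda>x. S x + T x) (c + d)"
proof -
  obtain f g where fg: "\<And>x. norm (S x - (\<Sum>k<i. cinner (f k) x *\<^sub>C g k)) \<le> c * norm x"
    using assms(1) unfolding rank_approx_def by blast
  obtain f' g' where fg': "\<And>x. norm (T x - (\<Sum>k<j. cinner (f' k) x *\<^sub>C g' k)) \<le> d * norm x"
    using assms(2) unfolding rank_approx_def by blast
  define F G where "F k = (if k < i then f k else f' (k - i))"
    and "G k = (if k < i then g k else g' (k - i))" for k
  have split: "(\<Sum>k<i + j. cinner (F k) x *\<^sub>C G k)
      = (\<Sum>k<i. cinner (f k) x *\<^sub>C g k) + (\<Sum>k<j. cinner (f' k) x *\<^sub>C g' k)" for x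
    unfolding F_def G_def sum_lessThan_add by simp
  have "norm (S x + T x - (\<Sum>k<i + j. cinner (F k) x *\<^sub>C G k)) \<le> (c + d) * norm x" for x
    using norm_triangle_ineq[of "S x - (\<Sum>k<i. cinner (f k) x *\<^sub>C g k)"
        "T x - (\<Sum>k<j. cinner (f' k) x *\<^sub>C g' k)"] fg[of x] fg'[of x]
    by (simp add: split algebra_simps)
  then show ?thesis unfolding rank_approx_def by blast
qed

text \<open>With approximants V of S and W of T, the operator V T + (S - V) W has rank at most i +
  j, and its difference from S T is (S - V)(T - W).\<close>

lemma rank_approx_comp:
  assumes S: "bounded_op S" "rank_approx i S c" "c \<ge> 0" and T: "bounded_op T" "rank_approx j T d"
  shows "rank_approx (i + j) (S \<circ> T) (c * d)"
proof -
  obtain f g where fg: "\<And>x. norm (S x - (\<Sum>k<i. cinner (f k) x *\<^sub>C g k)) \<le> c * norm x"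
    using S(2) unfolding rank_approx_def by blast
  obtain f' g' where fg': "\<And>x. norm (T x - (\<Sum>k<j. cinner (f' k) x *\<^sub>C g' k)) \<le> d * norm x"
    using T(2) unfolding rank_approx_def by blast
  define V where "V x = (\<Sum>k<i. cinner (f k) x *\<^sub>C g k)" for x
  define W where "W x = (\<Sum>k<j. cinner (f' k) x *\<^sub>C g' k)" for x
  have V: "V (x + y) = V x + V y" "V (z *\<^sub>C x) = z *\<^sub>C V x" for x y z
    by (simp_all add: V_def cinner_add_right cinner_scaleC_right scaleC_add_left sum.distrib
        scaleC_scaleC scaleC.sum_right)
  \<comment> \<open>The first \<open>i\<close> terms represent V T, whose functionals <f k, T x> are
    <adj T (f k), x>; the remaining \<open>j\<close> represent (S - V) W.\<close>
  define F G where "F k = (if k < i then adj T (f k) else f' (k - i))"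
    and "G k = (if k < i then g k else S (g' (k - i)) - V (g' (k - i)))" for k
  have V0: "V (\<Sum>k<j. a k *\<^sub>C y k) = (\<Sum>k<j. a k *\<^sub>C V (y k))" for a y and j :: nat
    by (induction j) (simp_all add: V, simp add: V_def cinner.zero_right scaleC.zero_left)
  have "(\<Sum>k<i + j. cinner (F k) x *\<^sub>C G k) = V (T x) + (S (W x) - V (W x))" for x
    unfolding F_def G_def sum_lessThan_add
    by (simp add: cinner_adj_left[OF T(1)] V_def[symmetric] scaleC.diff_right sum_subtractf
        W_def bounded_opD(2,6)[OF S(1)] V0)
  then have "S (T x) - (\<Sum>k<i + j. cinner (F k) x *\<^sub>C G k) = S (T x - W x) - V (T x - W x)" for x
    using V(1)[of "T x - W x" "W x"] by (simp add: bounded_opD(5)[OF S(1)])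
  moreover have "norm (S y - V y) \<le> c * norm y" for y
    using fg[of y] by (simp add: V_def)
  moreover have "norm (T x - W x) \<le> d * norm x" for x
    using fg'[of x] by (simp add: W_def)
  ultimately have "norm ((S \<circ> T) x - (\<Sum>k<i + j. cinner (F k) x *\<^sub>C G k)) \<le> (c * d) * norm x" for x
    using mult_left_mono[of "norm (T x - W x)" "d * norm x" c] S(3)
    by (simp add: mult.assoc) (meson order_trans)
  then show ?thesis unfolding rank_approx_def by blast
qed

lemma rank_approx_zero: "(\<And>x. norm (T x) \<le> c * norm x) \<Longrightarrow> rank_approx 0 T c"
  by (simp add: rank_approx_def)

text \<open>Taking adjoints exchanges the families \<open>f\<close> and \<open>g\<close> and does
  not increase the norm of the remainder.\<close>

lemma rank_approx_adj:
  assumes "bounded_op T" "rank_approx k T c" "c \<ge> 0"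
  shows "rank_approx k (adj T) c"
proof -
  obtain f g where fg: "\<And>x. norm (T x - (\<Sum>j<k. cinner (f j) x *\<^sub>C g j)) \<le> c * norm x"
    using assms(2) unfolding rank_approx_def by blast
  define R where "R x = T x - (\<Sum>j<k. cinner (f j) x *\<^sub>C g j)" for x
  have R: "bounded_op R"
    by (rule bounded_opI[of _ c])
      (simp_all add: R_def bounded_opD[OF assms(1)] cinner_add_right cinner_scaleC_right fg
        scaleC_add_left sum.distrib scaleC.diff_right scaleC.sum_right scaleC_scaleC)
  have "adj R = (\<lambda>x. adj T x - (\<Sum>j<k. cinner (g j) x *\<^sub>C f j))"
    by (rule adj_eqI)
      (simp add: R_def cinner.diff_left cinner.diff_right cinner_adj_left[OF assms(1)]
        cinner.sum_left cinner.sum_right cinner_scaleC_left cinner_scaleC_right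
        cinner_commute[of _ "g _"] mult.commute)
  moreover have "norm (adj R x) \<le> c * norm x" for x
    by (rule norm_adj_le[OF R _ assms(3)]) (simp add: R_def fg)
  ultimately show ?thesis unfolding rank_approx_def by metis
qed

lemma singular_value_add:
  assumes "compact_op S" "compact_op T"
  shows "singular_value (\<lambda>x. S x + T x) (i + j) \<le> singular_value S i + singular_value T j"
  by (intro singular_value_le_rank_approx compact_op_add rank_approx_add
      rank_approx_singular_value add_nonneg_nonneg singular_value_nonneg assms)

lemma singular_value_comp:
  assumes "compact_op S" "compact_op T"
  shows "singular_value (S \<circ> T) (i + j) \<le> singular_value S i * singular_value T j"
  by (intro singular_value_le_rank_approx compact_op_comp_left rank_approx_comp
      rank_approx_singular_value mult_nonneg_nonneg singular_value_nonneg assms compact_op_bounded)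

lemma singular_value_comp_left:
  assumes "bounded_op A" "\<And>x. norm (A x) \<le> K * norm x" "K \<ge> 0" "compact_op T"
  shows "singular_value (A \<circ> T) k \<le> K * singular_value T k"
  using rank_approx_comp[OF assms(1) rank_approx_zero[OF assms(2)] assms(3)
      compact_op_bounded[OF assms(4)] rank_approx_singular_value[OF assms(4), of k]]
  by (intro singular_value_le_rank_approx compact_op_comp_left assms mult_nonneg_nonneg
      singular_value_nonneg) simp_all

lemma singular_value_comp_right:
  assumes "bounded_op A" "\<And>x. norm (A x) \<le> K * norm x" "K \<ge> 0" "compact_op T"
  shows "singular_value (T \<circ> A) k \<le> singular_value T k * K"
  using rank_approx_comp[OF compact_op_bounded[OF assms(4)] rank_approx_singular_value[OF assms(4), of k]
      singular_value_nonneg[OF assms(4)] assms(1) rank_approx_zero[OF assms(2)]]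
  by (intro singular_value_le_rank_approx compact_op_comp_right assms mult_nonneg_nonneg
      singular_value_nonneg) simp_all

lemma singular_value_adj:
  assumes "compact_op T"
  shows "singular_value (adj T) k \<le> singular_value T k"
  by (intro singular_value_le_rank_approx compact_op_adj rank_approx_adj compact_op_bounded
      rank_approx_singular_value singular_value_nonneg assms)

subsection \<open>The ideal of operators with logarithmically bounded partial sums\<close>

lemma weak_schatten_compact: "T \<in> weak_schatten n \<Longrightarrow> compact_op T"
  by (simp add: weak_schatten_def)

lemma weak_schatten_bounded: "T \<in> weak_schatten n \<Longrightarrow> bounded_op T"
  by (simp add: weak_schatten_def compact_op_bounded)

lemma weak_schatten_1_iff:
  "T \<in> weak_schatten 1 \<longleftrightarrow>
     compact_op T \<and> (\<lambda>N. \<Sum>k\<le>N. singular_value T k) \<in> O(\<lambda>N. ln (real N))"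
  by (simp add: weak_schatten_def)

text \<open>Terms are paired as 2k and 2k + 1. Sums and products only bound singular values at the
  doubled index, and this is why the doubling costs no more than a factor 2 in partial sums.\<close>

lemma sum_decseq_le:
  fixes p :: "nat \<Rightarrow> real"
  assumes "decseq p" "\<And>k. p (2 * k) \<le> a k"
  shows "(\<Sum>k<2 * M. p k) \<le> 2 * (\<Sum>k<M. a k)"
proof (induction M)
  case (Suc M)
  have "p (2 * M + 1) \<le> p (2 * M)" using assms(1) by (simp add: decseq_def)
  then have "p (2 * M) + p (2 * M + 1) \<le> 2 * a M" using assms(2)[of M] by simp
  then show ?case using Suc by simp
qed simp

lemma sum_singular_value_le:
  assumes "compact_op P" "\<And>k. singular_value P (2 * k) \<le> a k"
  shows "(\<Sum>k<N. singular_value P k) \<le> 2 * (\<Sum>k<N. a k)"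
proof -
  have "(\<Sum>k<N. singular_value P k) \<le> (\<Sum>k<2 * N. singular_value P k)"
    by (rule sum_mono2) (auto intro: singular_value_nonneg assms)
  also have "\<dots> \<le> 2 * (\<Sum>k<N. a k)"
    by (rule sum_decseq_le[OF singular_value_decseq[OF assms(1)] assms(2)])
  finally show ?thesis .
qed

lemma weak_schatten_1_dominated:
  assumes "compact_op P" "\<And>k. singular_value P (2 * k) \<le> a k"
    "(\<lambda>N. \<Sum>k\<le>N. a k) \<in> O(\<lambda>N. ln (real N))"
  shows "P \<in> weak_schatten 1"
proof -
  have "(\<lambda>N. \<Sum>k\<le>N. singular_value P k) \<in> O(\<lambda>N. \<Sum>k\<le>N. a k)"
  proof (rule bigoI[of _ 2], rule always_eventually, rule allI)
    fix N
    have "0 \<le> (\<Sum>k\<le>N. singular_value P k)"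
      by (intro sum_nonneg singular_value_nonneg assms)
    moreover have "(\<Sum>k\<le>N. singular_value P k) \<le> 2 * (\<Sum>k\<le>N. a k)"
      using sum_singular_value_le[OF assms(1,2), of "Suc N"] by (simp only: lessThan_Suc_atMost)
    ultimately show "norm (\<Sum>k\<le>N. singular_value P k) \<le> 2 * norm (\<Sum>k\<le>N. a k)"
      by simp
  qed
  then show ?thesis
    using assms(1,3) unfolding weak_schatten_1_iff by (blast intro: landau_o.big_trans)
qed

lemma singular_value_double_le: "compact_op T \<Longrightarrow> singular_value T (2 * k) \<le> singular_value T k"
  using singular_value_decseq[of T] by (simp add: decseq_def)

lemma weak_schatten_1_le:
  assumes "compact_op P" "\<And>k. singular_value P (2 * k) \<le> K * singular_value T k" "T \<in> weak_schatten 1"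
  shows "P \<in> weak_schatten 1"
proof (rule weak_schatten_1_dominated[OF assms(1,2)])
  show "(\<lambda>N. \<Sum>k\<le>N. K * singular_value T k) \<in> O(\<lambda>N. ln (real N))"
    using assms(3) unfolding weak_schatten_1_iff sum_distrib_left[symmetric]
    by (auto intro: landau_o.big.cmult_in_iff'[THEN iffD2] landau_o.big.cmult')
qed

lemma weak_schatten_1_comp_left:
  assumes "bounded_op A" "T \<in> weak_schatten 1"
  shows "A \<circ> T \<in> weak_schatten 1"
proof -
  note cpt = weak_schatten_compact[OF assms(2)]
  obtain K where K: "K > 0" "\<And>x. norm (A x) \<le> K * norm x"
    using bounded_op_bound[OF assms(1)] by blast
  have "singular_value (A \<circ> T) (2 * k) \<le> K * singular_value T k" for k
    using singular_value_comp_left[OF assms(1) K(2) _ cpt, of "2 * k"]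
      mult_left_mono[OF singular_value_double_le[OF cpt], of K k] K(1) by linarith
  then show ?thesis
    by (rule weak_schatten_1_le[OF compact_op_comp_left[OF assms(1) cpt] _ assms(2)])
qed

lemma weak_schatten_1_comp_right:
  assumes "T \<in> weak_schatten 1" "bounded_op A"
  shows "T \<circ> A \<in> weak_schatten 1"
proof -
  note cpt = weak_schatten_compact[OF assms(1)]
  obtain K where K: "K > 0" "\<And>x. norm (A x) \<le> K * norm x"
    using bounded_op_bound[OF assms(2)] by blast
  have "singular_value (T \<circ> A) (2 * k) \<le> K * singular_value T k" for k
  proof -
    have "singular_value (T \<circ> A) (2 * k) \<le> singular_value T (2 * k) * K"
      by (rule singular_value_comp_right[OF assms(2) K(2) _ cpt]) (use K(1) in simp)
    also have "\<dots> \<le> singular_value T k * K"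
      by (rule mult_right_mono[OF singular_value_double_le[OF cpt]]) (use K(1) in simp)
    finally show ?thesis by (simp only: mult.commute)
  qed
  then show ?thesis
    by (rule weak_schatten_1_le[OF compact_op_comp_right[OF cpt assms(2)] _ assms(1)])
qed

lemma weak_schatten_1_scaleC:
  assumes "T \<in> weak_schatten 1"
  shows "(\<lambda>x. c *\<^sub>C T x) \<in> weak_schatten 1"
  using weak_schatten_1_comp_left[OF bounded_op_scaleC[OF bounded_op_id(2), of c] assms]
  by (simp add: o_def)

lemma weak_schatten_1_add:
  assumes "S \<in> weak_schatten 1" "T \<in> weak_schatten 1"
  shows "(\<lambda>x. S x + T x) \<in> weak_schatten 1"
proof (rule weak_schatten_1_dominated)
  note cpt = assms[THEN weak_schatten_compact]
  show "compact_op (\<lambda>x. S x + T x)" by (intro compact_op_add cpt)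
  show "singular_value (\<lambda>x. S x + T x) (2 * k) \<le> singular_value S k + singular_value T k" for k
    using singular_value_add[OF cpt, of k k] by (simp add: mult_2)
  show "(\<lambda>N. \<Sum>k\<le>N. singular_value S k + singular_value T k) \<in> O(\<lambda>N. ln (real N))"
    using assms unfolding weak_schatten_1_iff by (auto simp: sum.distrib intro: sum_in_bigo)
qed

lemma weak_schatten_1_diff:
  assumes "S \<in> weak_schatten 1" "T \<in> weak_schatten 1"
  shows "(\<lambda>x. S x - T x) \<in> weak_schatten 1"
  using weak_schatten_1_add[OF assms(1) weak_schatten_1_scaleC[OF assms(2), of "-1"]]
  by (simp add: minus_eq_scaleC[symmetric])

text \<open>The logarithmic means converge to 0, so every \<open>\<omega>\<close> that extends the
  ordinary limit sends them to 0.\<close>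

definition dixmier_negligible :: "('h::complex_hilbert_space \<Rightarrow> 'h) \<Rightarrow> bool" where
  "dixmier_negligible T \<longleftrightarrow>
     compact_op T \<and> (\<lambda>N. (\<Sum>k<N. singular_value T k) / ln (real N)) \<longlonglongrightarrow> 0"

lemma dixmier_negligible_dominated:
  assumes "compact_op P" "\<And>k. singular_value P (2 * k) \<le> a k"
    "(\<lambda>N. (\<Sum>k<N. a k) / ln (real N)) \<longlonglongrightarrow> 0"
  shows "dixmier_negligible P"
  unfolding dixmier_negligible_def
proof (intro conjI assms(1))
  have "(\<lambda>N. 2 * ((\<Sum>k<N. a k) / ln (real N))) \<longlonglongrightarrow> 2 * 0"
    by (intro tendsto_mult tendsto_const assms(3))
  then have lim: "(\<lambda>N. 2 * ((\<Sum>k<N. a k) / ln (real N))) \<longlonglongrightarrow> 0" by simp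
  have ln: "0 \<le> ln (real N)" for N by (cases N) auto
  show "(\<lambda>N. (\<Sum>k<N. singular_value P k) / ln (real N)) \<longlonglongrightarrow> 0"
  proof (rule tendsto_sandwich[OF always_eventually always_eventually tendsto_const lim];
      intro allI)
    fix N
    show "0 \<le> (\<Sum>k<N. singular_value P k) / ln (real N)"
      by (intro divide_nonneg_nonneg sum_nonneg singular_value_nonneg assms(1) ln)
    show "(\<Sum>k<N. singular_value P k) / ln (real N) \<le> 2 * ((\<Sum>k<N. a k) / ln (real N))"
      using divide_right_mono[OF sum_singular_value_le[OF assms(1,2), of N] ln] by simp
  qed
qed

text \<open>Beyond some \<open>M\<close> the weights are below \<epsilon>, so that part is at most
  \<epsilon> times a logarithmically bounded sum; the terms before \<open>M\<close> contribute a
  constant, negligible against the logarithm.\<close>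

lemma weighted_sum_little_log:
  fixes s c :: "nat \<Rightarrow> real"
  assumes "\<And>k. s k \<ge> 0" "(\<lambda>N. \<Sum>k\<le>N. s k) \<in> O(\<lambda>N. ln (real N))"
    "\<And>k. c k \<ge> 0" "c \<longlonglongrightarrow> 0"
  shows "(\<lambda>N. (\<Sum>k<N. s k * c k) / ln (real N)) \<longlonglongrightarrow> 0"
proof (rule LIMSEQ_I)
  fix r :: real assume r: "0 < r"
  obtain C where C: "C > 0" "\<forall>\<^sub>F N in sequentially. norm (\<Sum>k\<le>N. s k) \<le> C * norm (ln (real N))"
    using landau_o.bigE[OF assms(2)] by blast
  \<comment> \<open>Leaves r/2 for the tail and r/2 for the constant head \<open>A\<close>.\<close>
  define \<epsilon> where "\<epsilon> = r / (2 * C)"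
  have \<epsilon>: "\<epsilon> > 0" using r C(1) by (simp add: \<epsilon>_def)
  obtain M where M: "\<And>k. k \<ge> M \<Longrightarrow> c k < \<epsilon>"
    using order_tendstoD(2)[OF assms(4) \<epsilon>] by (auto simp: eventually_sequentially)
  define A where "A = (\<Sum>k<M. s k * c k)"
  have ln_top: "filterlim (\<lambda>N. ln (real N)) at_top sequentially"
    by (rule filterlim_compose[OF ln_at_top filterlim_real_sequentially])
  have "(\<lambda>N. A / ln (real N)) \<longlonglongrightarrow> 0"
    by (rule tendsto_divide_0[OF tendsto_const filterlim_at_top_imp_at_infinity[OF ln_top]])
  then have ev1: "\<forall>\<^sub>F N in sequentially. A / ln (real N) < r / 2"
    by (rule order_tendstoD(2)) (use r in simp)
  have ev2: "\<forall>\<^sub>F N in sequentially. 0 < ln (real N)"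
    using ln_top unfolding filterlim_at_top_dense by blast
  have est: "(\<Sum>k<N. s k * c k) \<le> A + \<epsilon> * (\<Sum>k\<le>N. s k)" for N
  proof -
    have "(\<Sum>k<N. s k * c k) \<le> (\<Sum>k<N. (if k < M then s k * c k else 0) + \<epsilon> * s k)"
    proof (rule sum_mono)
      fix k
      show "s k * c k \<le> (if k < M then s k * c k else 0) + \<epsilon> * s k"
        using M[of k] assms(1)[of k] \<epsilon> mult_left_mono[of "c k" \<epsilon> "s k"]
        by (cases "k < M") (auto simp: mult.commute)
    qed
    also have "\<dots> = (\<Sum>k<N. if k < M then s k * c k else 0) + \<epsilon> * (\<Sum>k<N. s k)"
      by (simp add: sum.distrib sum_distrib_left)
    also have "(\<Sum>k<N. if k < M then s k * c k else 0) = (\<Sum>k\<in>{..<N} \<inter> {..<M}. s k * c k)"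
      by (simp add: sum.inter_restrict)
    also have "\<dots> \<le> A"
      unfolding A_def by (rule sum_mono2) (auto intro: assms mult_nonneg_nonneg)
    also have "(\<Sum>k<N. s k) \<le> (\<Sum>k\<le>N. s k)"
      by (rule sum_mono2) (auto intro: assms)
    finally show ?thesis using \<epsilon> by simp
  qed
  have "\<forall>\<^sub>F N in sequentially. norm ((\<Sum>k<N. s k * c k) / ln (real N) - 0) < r"
    using ev1 ev2 C(2)
  proof eventually_elim
    case (elim N)
    have "\<epsilon> * (\<Sum>k\<le>N. s k) \<le> \<epsilon> * (C * ln (real N))"
      by (rule mult_left_mono) (use elim \<epsilon> in auto)
    also have "\<dots> = r / 2 * ln (real N)" using C(1) by (simp add: \<epsilon>_def)
    finally have "(\<Sum>k<N. s k * c k) \<le> A + r / 2 * ln (real N)" using est[of N] by linarith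
    also have "\<dots> < r * ln (real N)"
      using elim(1,2) by (simp add: field_simps)
    finally have "(\<Sum>k<N. s k * c k) / ln (real N) < r" using elim(2) by (simp add: field_simps)
    moreover have "0 \<le> (\<Sum>k<N. s k * c k) / ln (real N)"
      using elim(2) by (intro divide_nonneg_pos sum_nonneg mult_nonneg_nonneg assms)
    ultimately show ?case by simp
  qed
  then show "\<exists>no. \<forall>n\<ge>no. norm ((\<Sum>k<n. s k * c k) / ln (real n) - 0) < r"
    by (simp add: eventually_sequentially)
qed

lemma dixmier_negligible_comp_compact:
  assumes "S \<in> weak_schatten 1" "compact_op T"
  shows "dixmier_negligible (S \<circ> T)"
proof -
  note cpt = weak_schatten_compact[OF assms(1)] assms(2)
  show ?thesis
  proof (rule dixmier_negligible_dominated)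
    show "compact_op (S \<circ> T)" by (intro compact_op_comp_left compact_op_bounded cpt)
    show "singular_value (S \<circ> T) (2 * k) \<le> singular_value S k * singular_value T k" for k
      using singular_value_comp[OF cpt, of k k] by (simp add: mult_2)
    show "(\<lambda>N. (\<Sum>k<N. singular_value S k * singular_value T k) / ln (real N)) \<longlonglongrightarrow> 0"
      by (rule weighted_sum_little_log)
        (use assms cpt in \<open>auto simp: weak_schatten_1_iff simp del: One_nat_def
          intro: singular_value_nonneg singular_value_tendsto\<close>)
  qed
qed

subsection \<open>Powers of operators in weak Schatten ideals\<close>

text \<open>Singular values of order k^(-p), phrased so that merely bounded factors take part with p
  = 0. The shift to k + 1 avoids \<open>0 powr (- p)\<close>, which is 0.\<close>

definition rank_decay :: "real \<Rightarrow> ('h::complex_hilbert_space \<Rightarrow> 'h) \<Rightarrow> bool" where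
  "rank_decay p T \<longleftrightarrow> bounded_op T \<and>
     (\<exists>C\<ge>0. \<forall>k. rank_approx k T (C * (real k + 1) powr (- p)))"

lemma rank_approx_mono:
  assumes "rank_approx k T c" "k \<le> l" "c \<le> d"
  shows "rank_approx l T d"
proof -
  obtain f g where fg: "\<And>x. norm (T x - (\<Sum>j<k. cinner (f j) x *\<^sub>C g j)) \<le> c * norm x"
    using assms(1) unfolding rank_approx_def by blast
  have "(\<Sum>j<l. cinner (f j) x *\<^sub>C (if j < k then g j else 0)) = (\<Sum>j<k. cinner (f j) x *\<^sub>C g j)" for x
    by (rule sum.mono_neutral_cong_right) (use assms(2) in \<open>auto simp: scaleC.zero_right\<close>)
  then have "norm (T x - (\<Sum>j<l. cinner (f j) x *\<^sub>C (if j < k then g j else 0))) \<le> d * norm x" for x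
    using fg[of x] mult_right_mono[OF assms(3), of "norm x"] by simp
  then show ?thesis
    unfolding rank_approx_def by (intro exI[of _ f] exI[of _ "\<lambda>j. if j < k then g j else 0"] allI)
qed

lemma rank_decay_bounded:
  assumes "bounded_op T"
  shows "rank_decay 0 T"
proof -
  obtain K where "K > 0" "\<And>x. norm (T x) \<le> K * norm x"
    using bounded_op_bound[OF assms] by blast
  then show ?thesis
    unfolding rank_decay_def
    by (intro conjI assms exI[of _ K]) (auto intro!: rank_approx_mono[OF rank_approx_zero])
qed

lemma powr_minus_half:
  fixes x :: real
  assumes "x \<ge> 0"
  shows "(x / 2) powr (- r) = 2 powr r * x powr (- r)"
  using assms by (simp add: powr_divide powr_minus field_simps)

text \<open>Each factor receives rank h = k div 2. As h + 1 is at least (k + 1)/2, this loses only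
  the factor 2^(p+q), and the exponents add.\<close>

lemma rank_decay_comp:
  assumes "rank_decay p S" "rank_decay q T" "p \<ge> 0" "q \<ge> 0"
  shows "rank_decay (p + q) (S \<circ> T)"
proof -
  obtain C where C: "C \<ge> 0" "\<And>k. rank_approx k S (C * (real k + 1) powr (- p))" and S: "bounded_op S"
    using assms(1) unfolding rank_decay_def by blast
  obtain D where D: "D \<ge> 0" "\<And>k. rank_approx k T (D * (real k + 1) powr (- q))" and T: "bounded_op T"
    using assms(2) unfolding rank_decay_def by blast
  have "rank_approx k (S \<circ> T) (C * D * 2 powr (p + q) * (real k + 1) powr (- (p + q)))" for k
  proof (rule rank_approx_mono)
    define h where "h = k div 2"
    show "rank_approx (h + h) (S \<circ> T) (C * (real h + 1) powr (- p) * (D * (real h + 1) powr (- q)))"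
      by (rule rank_approx_comp[OF S C(2) _ T D(2)]) (use C(1) in simp)
    show "h + h \<le> k" by (simp add: h_def)
    have "(real h + 1) powr (- (p + q)) \<le> ((real k + 1) / 2) powr (- (p + q))"
      by (rule powr_mono2') (use assms(3,4) in \<open>auto simp: h_def\<close>)
    also have "\<dots> = 2 powr (p + q) * (real k + 1) powr (- (p + q))"
      by (rule powr_minus_half) simp
    finally have "C * D * (real h + 1) powr (- (p + q))
        \<le> C * D * (2 powr (p + q) * (real k + 1) powr (- (p + q)))"
      using C(1) D(1) by (intro mult_left_mono) auto
    moreover have "(real h + 1) powr (- p) * (real h + 1) powr (- q) = (real h + 1) powr (- (p + q))"
      by (simp add: powr_add[symmetric])
    ultimately show "C * (real h + 1) powr (- p) * (D * (real h + 1) powr (- q))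
        \<le> C * D * 2 powr (p + q) * (real k + 1) powr (- (p + q))"
      by (simp add: mult_ac)
  qed
  then show ?thesis
    unfolding rank_decay_def using bounded_op_comp[OF S T] C(1) D(1)
    by (intro conjI exI[of _ "C * D * 2 powr (p + q)"]) auto
qed

lemma rank_decay_power:
  assumes "rank_decay p T" "p \<ge> 0"
  shows "rank_decay (real k * p) (T ^^ k)"
proof (induction k)
  case 0
  then show ?case using rank_decay_bounded[OF bounded_op_id(2)] by simp
next
  case (Suc k)
  from rank_decay_comp[OF assms(1) Suc] assms(2) show ?case
    by (simp add: algebra_simps del: o_apply)
qed

lemma rank_decay_weak_schatten:
  assumes "T \<in> weak_schatten n" "n \<ge> 2"
  shows "rank_decay (1 / real n) T"
proof -
  define p where "p = 1 / real n"
  have cpt: "compact_op T" and O: "singular_value T \<in> O(\<lambda>k. real k powr - p)"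
    using assms by (auto simp: weak_schatten_def p_def)
  obtain c where c: "c > 0"
    "\<forall>\<^sub>F k in sequentially. norm (singular_value T k) \<le> c * norm (real k powr - p)"
    using landau_o.bigE[OF O] by blast
  then obtain M where M: "\<And>k. k \<ge> M \<Longrightarrow> \<bar>singular_value T k\<bar> \<le> c * real k powr - p"
    by (auto simp: eventually_sequentially)
  \<comment> \<open>The first summand serves all k at least M and at least 1, where k is at least (k
    + 1)/2; the second serves the finitely many k up to M, by monotonicity of the singular
    values.\<close>
  define C where "C = c * 2 powr p + singular_value T 0 * (real M + 1) powr p"
  have nn: "singular_value T k \<ge> 0" for k by (rule singular_value_nonneg[OF cpt])
  have p0: "p \<ge> 0" by (simp add: p_def)
  have "singular_value T k \<le> C * (real k + 1) powr (- p)" for k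
  proof (cases "M \<le> k \<and> 1 \<le> k")
    case True
    have "real k powr - p \<le> ((real k + 1) / 2) powr (- p)"
      by (rule powr_mono2') (use True p0 in auto)
    also have "\<dots> = 2 powr p * (real k + 1) powr (- p)"
      by (rule powr_minus_half) simp
    finally have "c * real k powr - p \<le> c * (2 powr p * (real k + 1) powr (- p))"
      using c(1) by (intro mult_left_mono) auto
    then have "singular_value T k \<le> c * 2 powr p * (real k + 1) powr (- p)"
      using M[of k] True by simp
    also have "\<dots> \<le> C * (real k + 1) powr (- p)"
      unfolding C_def by (intro mult_right_mono) (use nn in auto)
    finally show ?thesis .
  next
    case False
    then have kM: "k \<le> M" by linarith
    have "1 \<le> (real M + 1) powr p * (real k + 1) powr (- p)"
      using powr_mono2[of p "real k + 1" "real M + 1"] kM p0 by (simp add: powr_minus field_simps)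
    then have "singular_value T 0 * 1 \<le> singular_value T 0 * ((real M + 1) powr p * (real k + 1) powr (- p))"
      by (rule mult_left_mono[OF _ nn])
    moreover have "singular_value T k \<le> singular_value T 0"
      using singular_value_decseq[OF cpt] by (simp add: decseq_def)
    ultimately have "singular_value T k \<le> singular_value T 0 * (real M + 1) powr p * (real k + 1) powr (- p)"
      by (simp add: mult.assoc)
    also have "\<dots> \<le> C * (real k + 1) powr (- p)"
      unfolding C_def by (intro mult_right_mono) (use c in auto)
    finally show ?thesis .
  qed
  then have "rank_approx k T (C * (real k + 1) powr (- p))" for k
    by (rule rank_approx_mono[OF rank_approx_singular_value[OF cpt] order_refl])
  moreover have "C \<ge> 0" using c(1) nn by (simp add: C_def)
  ultimately show ?thesis
    using compact_op_bounded[OF cpt] unfolding rank_decay_def p_def by blast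
qed

lemma weak_schatten_1_rank_decay:
  assumes "compact_op T" "rank_decay 1 T"
  shows "T \<in> weak_schatten 1"
proof -
  obtain C where C: "C \<ge> 0" "\<And>k. rank_approx k T (C * (real k + 1) powr (- 1))"
    using assms(2) unfolding rank_decay_def by auto
  have sv: "singular_value T k \<le> C * inverse (real (Suc k))" for k
    using singular_value_le_rank_approx[OF assms(1) C(2), of k] C(1)
    by (simp add: powr_minus add.commute)
  show ?thesis
  proof (rule weak_schatten_1_dominated[OF assms(1)])
    show "singular_value T (2 * k) \<le> C * inverse (real (Suc k))" for k
      using sv[of k] singular_value_double_le[OF assms(1), of k] by linarith
    have "(\<Sum>k\<le>N. C * inverse (real (Suc k))) = C * harm (Suc N)" for N
      by (simp only: harm_altdef lessThan_Suc_atMost sum_distrib_left)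
    moreover have "(\<lambda>N. C * harm (Suc N)) \<in> O(\<lambda>N. ln (real N))"
    \<comment> \<open>For N at least 3 one has 1 <= ln N and N + 1 <= N^2, so 1 + ln (N + 1) is at
      most 3 ln N.\<close>
    proof (rule bigoI[of _ "C * 3"], rule eventually_sequentiallyI[of 3])
      fix N :: nat assume N: "3 \<le> N"
      have "harm (Suc N) - ln (real (Suc N)) \<le> harm (Suc 0) - ln (real (Suc 0))"
        using decseq_harm_diff_ln by (rule decseqD) simp
      then have "harm (Suc N) \<le> 1 + ln (real (Suc N))" by (simp add: harm_expand)
      also have "\<dots> \<le> ln (real N) + ln (real N ^ 2)"
      proof (rule add_mono)
        have "exp 1 \<le> real N" using exp_le N by linarith
        then show "1 \<le> ln (real N)" using N by (subst ln_ge_iff) auto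
        have "real (Suc N) \<le> 3 * real N" using N by simp
        also have "\<dots> \<le> real N ^ 2" unfolding power2_eq_square by (rule mult_right_mono) (use N in auto)
        finally show "ln (real (Suc N)) \<le> ln (real N ^ 2)" using N by simp
      qed
      also have "\<dots> = 3 * ln (real N)" using N by (simp add: ln_realpow)
      finally have "C * harm (Suc N) \<le> C * (3 * ln (real N))" using C(1) by (rule mult_left_mono)
      then show "norm (C * harm (Suc N)) \<le> C * 3 * norm (ln (real N))"
        using C(1) N harm_nonneg[of "Suc N", where 'a=real] by (simp add: abs_mult mult.assoc)
    qed
    ultimately show "(\<lambda>N. \<Sum>k\<le>N. C * inverse (real (Suc k))) \<in> O(\<lambda>N. ln (real N))" by simp
  qed
qed

lemma compact_op_power:
  assumes "compact_op T" "k \<ge> 1"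
  shows "compact_op (T ^^ k)"
proof -
  obtain j where "k = Suc j" using assms(2) by (cases k) auto
  then show ?thesis
    using compact_op_comp_right[OF assms(1) bounded_op_power[OF compact_op_bounded[OF assms(1)]], of j]
    by (simp del: o_apply)
qed

text \<open>The decay exponents k/n, 0 and (n - k)/n add up to 1. For n = 1 no decay rate is known,
  but the product is then \<open>T \<circ> d\<close> and the ideal property suffices.\<close>

lemma weak_schatten_1_power_product:
  assumes "T \<in> weak_schatten n" "1 \<le> k" "k \<le> n" "bounded_op d"
  shows "(T ^^ k) \<circ> d \<circ> (T ^^ (n - k)) \<in> weak_schatten 1"
proof -
  note cpt = weak_schatten_compact[OF assms(1)]
  note b = compact_op_bounded[OF cpt]
  consider "n = 1" | "n \<ge> 2" using assms(2,3) by linarith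
  then show ?thesis
  proof cases
    case 1
    then have "k = 1" using assms(2,3) by simp
    then show ?thesis using 1 assms(1,4) weak_schatten_1_comp_right[of T d] by simp
  next
    case 2
    note decay = rank_decay_power[OF rank_decay_weak_schatten[OF assms(1) 2]]
    have "rank_decay (real k * (1 / real n) + 0 + real (n - k) * (1 / real n)) ((T ^^ k) \<circ> d \<circ> (T ^^ (n - k)))"
      by (intro rank_decay_comp decay rank_decay_bounded assms(4)) auto
    moreover have "real k * (1 / real n) + 0 + real (n - k) * (1 / real n) = 1"
      using assms(3) 2 by (simp add: field_simps of_nat_diff)
    ultimately have "rank_decay 1 ((T ^^ k) \<circ> d \<circ> (T ^^ (n - k)))" by metis
    moreover have "compact_op ((T ^^ k) \<circ> d \<circ> (T ^^ (n - k)))"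
      by (intro compact_op_comp_right compact_op_power cpt assms bounded_op_power b)
    ultimately show ?thesis by (intro weak_schatten_1_rank_decay)
  qed
qed

subsection \<open>Decomposition into positive operators\<close>

lemma compact_self_adjoint_parts:
  assumes cpt: "compact_op T" and sa: "\<And>x y. cinner (T x) y = cinner x (T y)"
  shows "\<exists>P N. compact_op P \<and> positive_op P \<and> (\<forall>k. singular_value P k \<le> singular_value T k) \<and>
    compact_op N \<and> positive_op N \<and> (\<forall>k. singular_value N k \<le> singular_value T k) \<and>
    (\<forall>x. T x = P x - N x)"
proof -
  note b = compact_op_bounded[OF cpt]
  obtain e l where es: "eigensystem T e l"
    using compact_self_adjoint_eigensystem[OF cpt sa] by blast
  note os = eigensystem_orthosystem[OF es] and l = eigensystem_bounded[OF es]
  \<comment> \<open>\<open>c\<close> is the indicator of the positive eigenvalues and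
    \<open>d\<close> minus that of the others, so c T and d T are the positive and negative parts.
    Both multipliers are contractions, so no singular value grows.\<close>
  define c where "c k = (if l k > 0 then 1 else 0 :: real)" for k
  define d where "d k = (if l k > 0 then 0 else - 1 :: real)" for k
  have c: "\<forall>k. \<bar>c k\<bar> \<le> 1" and d: "\<forall>k. \<bar>d k\<bar> \<le> 1" by (auto simp: c_def d_def)
  have part: "compact_op (diag e a \<circ> T) \<and> positive_op (diag e a \<circ> T) \<and>
      (\<forall>k. singular_value (diag e a \<circ> T) k \<le> singular_value T k)"
    if a: "\<forall>k. \<bar>a k\<bar> \<le> 1" and nn: "\<And>k. 0 \<le> a k * l k" for a
  proof (intro conjI allI)
    show "compact_op (diag e a \<circ> T)"
      by (rule compact_op_comp_left[OF bounded_op_diag[OF os a] cpt])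
    have bd: "\<forall>k. \<bar>a k * l k\<bar> \<le> \<bar>l 0\<bar>"
      using mult_mono[OF a[rule_format] l[rule_format]] by (simp add: abs_mult)
    have "diag e a \<circ> T = diag e (\<lambda>k. a k * l k)"
      by (rule ext) (simp add: eigensystem_diag[OF es b] diag_diag[OF os a l])
    then show "positive_op (diag e a \<circ> T)"
      using positive_op_diag[OF os bd nn] by simp
    show "singular_value (diag e a \<circ> T) k \<le> singular_value T k" for k
      using singular_value_comp_left[OF bounded_op_diag[OF os a] norm_diag_le[OF os a] _ cpt, of k]
      by simp
  qed
  have "T x = (diag e c \<circ> T) x - (diag e d \<circ> T) x" for x
  proof -
    have "diag e c (T x) = diag e (\<lambda>k. l k + d k * l k) x"
      unfolding eigensystem_diag[OF es b] diag_diag[OF os c l]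
      by (rule arg_cong2[of _ _ _ _ "diag e"]) (auto simp: c_def d_def)
    also have "\<dots> = diag e l x + diag e (\<lambda>k. d k * l k) x"
    proof (rule diag_add[OF os l])
      show "\<forall>k. \<bar>d k * l k\<bar> \<le> \<bar>l 0\<bar>"
        using mult_mono[OF d[rule_format] l[rule_format]] by (simp add: abs_mult)
    qed
    finally show ?thesis
      by (simp add: eigensystem_diag[OF es b] diag_diag[OF os d l])
  qed
  moreover have "0 \<le> c k * l k" "0 \<le> d k * l k" for k by (auto simp: c_def d_def)
  ultimately show ?thesis
    using part[OF c] part[OF d]
    by (intro exI[of _ "diag e c \<circ> T"] exI[of _ "diag e d \<circ> T"]) blast
qed

lemma singular_value_scaleC:
  assumes "compact_op T"
  shows "singular_value (\<lambda>x. c *\<^sub>C T x) k \<le> cmod c * singular_value T k"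
  using singular_value_comp_left[OF bounded_op_scaleC[OF bounded_op_id(2), of c] _ _ assms, of "cmod c"]
  by (simp add: o_def norm_scaleC)

text \<open>The values c = 1/2 and c = -i/2 give the real and imaginary parts of \<open>T\<close>.
  Modulus 1/2 balances the two summands, so that the last bound has constant 1.\<close>

lemma compact_self_adjoint_combination:
  fixes T :: "'h::complex_hilbert_space \<Rightarrow> 'h"
  assumes cpt: "compact_op T" and c: "cmod c = 1 / 2"
  defines "A \<equiv> \<lambda>x. c *\<^sub>C T x + cnj c *\<^sub>C adj T x"
  shows "compact_op A" "cinner (A x) y = cinner x (A y)"
    "singular_value A (2 * k) \<le> singular_value T k"
proof -
  note b = compact_op_bounded[OF cpt] and cpt' = compact_op_adj[OF cpt]
  show "compact_op A" unfolding A_def by (intro compact_op_add compact_op_scaleC cpt cpt')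
  show "cinner (A x) y = cinner x (A y)"
    by (simp add: A_def cinner_add_left cinner_add_right cinner_scaleC_left cinner_scaleC_right
        cinner_adj_left[OF b] cinner_adj_right[OF b])
  have "singular_value A (2 * k)
      \<le> singular_value (\<lambda>x. c *\<^sub>C T x) k + singular_value (\<lambda>x. cnj c *\<^sub>C adj T x) k"
    unfolding A_def mult_2 by (intro singular_value_add compact_op_scaleC cpt cpt')
  also have "\<dots> \<le> cmod c * singular_value T k + cmod (cnj c) * singular_value (adj T) k"
    by (intro add_mono singular_value_scaleC cpt cpt')
  also have "\<dots> \<le> singular_value T k"
    using singular_value_adj[OF cpt, of k] by (simp add: c)
  finally show "singular_value A (2 * k) \<le> singular_value T k" .
qed

text \<open>Carries properties of \<open>Tr\<close> from positive operators to all of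
  \<open>weak_schatten 1\<close>: linearity reassembles \<open>Tr T\<close>, and the bound at index
  2k keeps every piece in the ideal, and negligible if \<open>T\<close> is.\<close>

lemma compact_positive_decomposition:
  assumes cpt: "compact_op T"
  shows "\<exists>P :: nat \<Rightarrow> _.
    (\<forall>j. compact_op (P j) \<and> positive_op (P j) \<and> (\<forall>k. singular_value (P j) (2 * k) \<le> singular_value T k)) \<and>
    (\<forall>x. T x = (P 0 x - P 1 x) + \<i> *\<^sub>C (P 2 x - P 3 x))"
proof -
  note b = compact_op_bounded[OF cpt]
  have parts: "\<exists>P N. compact_op P \<and> positive_op P \<and> (\<forall>k. singular_value P (2 * k) \<le> singular_value T k) \<and>
      compact_op N \<and> positive_op N \<and> (\<forall>k. singular_value N (2 * k) \<le> singular_value T k) \<and>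
      (\<forall>x. c *\<^sub>C T x + cnj c *\<^sub>C adj T x = P x - N x)" if c: "cmod c = 1 / 2" for c
    using compact_self_adjoint_parts[OF compact_self_adjoint_combination(1,2)[OF cpt c]]
      compact_self_adjoint_combination(3)[OF cpt c]
    by (meson order_trans)
  obtain P N where PN: "compact_op P" "positive_op P" "\<forall>k. singular_value P (2 * k) \<le> singular_value T k"
      "compact_op N" "positive_op N" "\<forall>k. singular_value N (2 * k) \<le> singular_value T k"
      "\<forall>x. (1 / 2) *\<^sub>C T x + cnj (1 / 2) *\<^sub>C adj T x = P x - N x"
    using parts[of "1 / 2"] by auto
  obtain Q R where QR: "compact_op Q" "positive_op Q" "\<forall>k. singular_value Q (2 * k) \<le> singular_value T k"
      "compact_op R" "positive_op R" "\<forall>k. singular_value R (2 * k) \<le> singular_value T k"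
      "\<forall>x. (- \<i> / 2) *\<^sub>C T x + cnj (- \<i> / 2) *\<^sub>C adj T x = Q x - R x"
    using parts[of "- \<i> / 2"] by (auto simp: norm_divide)
  define F where "F j = (if j = 0 then P else if j = 1 then N else if j = 2 then Q else R)" for j :: nat
  have "T x = (F 0 x - F 1 x) + \<i> *\<^sub>C (F 2 x - F 3 x)" for x
  proof -
    have "T x = (1 / 2 + 1 / 2) *\<^sub>C T x + (1 / 2 - 1 / 2) *\<^sub>C adj T x"
      by (simp add: scaleC_one scaleC.zero_left)
    also have "\<dots> = ((1 / 2) *\<^sub>C T x + cnj (1 / 2) *\<^sub>C adj T x)
        + \<i> *\<^sub>C ((- \<i> / 2) *\<^sub>C T x + cnj (- \<i> / 2) *\<^sub>C adj T x)"
      unfolding scaleC_add_right scaleC_add_left scaleC.diff_left scaleC_scaleC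
      by (simp add: scaleC.minus_left)
    finally show ?thesis using PN(7) QR(7) by (simp add: F_def)
  qed
  then show ?thesis using PN QR by (intro exI[of _ F]) (auto simp: F_def)
qed

subsection \<open>The Dixmier trace\<close>

lemma norm_unitary:
  fixes U V :: "'h::complex_hilbert_space \<Rightarrow> 'h"
  assumes "\<And>x y. cinner (U x) y = cinner x (V y)" "\<And>x. V (U x) = x"
  shows "norm (U x) \<le> 1 * norm x"
proof -
  have "complex_of_real ((norm (U x))\<^sup>2) = complex_of_real ((norm x)\<^sup>2)"
    by (simp only: cinner_self[symmetric] assms)
  then show ?thesis by (simp only: of_real_eq_iff) simp
qed

text \<open>Conjugation by contractions does not increase singular values; conjugating back gives
  the reverse inequality.\<close>

lemma singular_value_unitary_conjugate:
  fixes U V T :: "'h::complex_hilbert_space \<Rightarrow> 'h"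
  assumes bU: "bounded_op U" and bV: "bounded_op V"
    and adj: "\<And>x y. cinner (U x) y = cinner x (V y)"
    and inv: "\<And>x. V (U x) = x" "\<And>x. U (V x) = x" and cpt: "compact_op T"
  shows "singular_value (U \<circ> T \<circ> V) = singular_value T"
proof -
  have adj': "cinner (V x) y = cinner x (U y)" for x y
    using adj[of y x] cinner_commute by metis
  note nU = norm_unitary[of U V, OF adj inv(1)] and nV = norm_unitary[of V U, OF adj' inv(2)]
  have le: "singular_value (U \<circ> T \<circ> V) k \<le> singular_value T k"
    if "compact_op T" "bounded_op U" "bounded_op V" "\<And>x. norm (U x) \<le> 1 * norm x" "\<And>x. norm (V x) \<le> 1 * norm x"
    for U V T :: "'h \<Rightarrow> 'h" and k
    using singular_value_comp_right[OF that(3,5) _ compact_op_comp_left[OF that(2,1)], of k]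
      singular_value_comp_left[OF that(2,4) _ that(1), of k] by simp
  have "V \<circ> (U \<circ> T \<circ> V) \<circ> U = T" by (rule ext) (simp add: inv)
  then have "singular_value T k \<le> singular_value (U \<circ> T \<circ> V) k" for k
    using le[of "U \<circ> T \<circ> V" V U k] compact_op_comp_right[OF compact_op_comp_left[OF bU cpt] bV]
      bU bV nU nV by simp
  then show ?thesis
    by (intro ext order_antisym le cpt bU bV nU nV)
qed

text \<open>Solving y - i A y = x means finding a fixed point of y -> x + i A y, a contraction with
  factor 1/2. The bound 2 for \<open>R\<close> comes from |R x| <= |x| + |R x|/2.\<close>

lemma inverse_one_minus_i_contraction:
  fixes A :: "'h::complex_hilbert_space \<Rightarrow> 'h"
  assumes b: "bounded_op A" and half: "\<And>x. norm (A x) \<le> 1 / 2 * norm x"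
  obtains R where "bounded_op R" "\<And>x. R x - \<i> *\<^sub>C A (R x) = x" "\<And>x. R (x - \<i> *\<^sub>C A x) = x"
proof -
  have "\<exists>!y. x + \<i> *\<^sub>C A y = y" for x
  proof (rule banach_fix_type[of "1 / 2"])
    have "dist (x + \<i> *\<^sub>C A y) (x + \<i> *\<^sub>C A z) \<le> 1 / 2 * dist y z" for y z
      using half[of "y - z"]
      by (simp add: dist_norm scaleC.diff_right[symmetric] bounded_opD(5)[OF b, symmetric] norm_scaleC)
    then show "\<forall>y z. dist (x + \<i> *\<^sub>C A y) (x + \<i> *\<^sub>C A z) \<le> 1 / 2 * dist y z" by blast
  qed auto
  then have ex1: "\<exists>!y. y - \<i> *\<^sub>C A y = x" for x
    by (simp add: algebra_simps) metis
  define R where "R x = (THE y. y - \<i> *\<^sub>C A y = x)" for x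
  have R: "R x - \<i> *\<^sub>C A (R x) = x" for x
    unfolding R_def by (rule theI'[OF ex1])
  have uniq: "y = z" if "y - \<i> *\<^sub>C A y = z - \<i> *\<^sub>C A z" for y z
    using ex1[of "z - \<i> *\<^sub>C A z"] that by blast
  have R': "R (x - \<i> *\<^sub>C A x) = x" for x
    by (rule uniq) (rule R)
  have "bounded_op R"
  proof (rule bounded_opI[of _ 2])
    show "R (x + y) = R x + R y" for x y
    proof (rule uniq)
      have "R x + R y - \<i> *\<^sub>C A (R x + R y) = (R x - \<i> *\<^sub>C A (R x)) + (R y - \<i> *\<^sub>C A (R y))"
        by (simp add: bounded_opD(1)[OF b] scaleC_add_right)
      then show "R (x + y) - \<i> *\<^sub>C A (R (x + y)) = R x + R y - \<i> *\<^sub>C A (R x + R y)"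
        by (simp only: R)
    qed
    show "R (c *\<^sub>C x) = c *\<^sub>C R x" for c x
    proof (rule uniq)
      have "c *\<^sub>C R x - \<i> *\<^sub>C A (c *\<^sub>C R x) = c *\<^sub>C (R x - \<i> *\<^sub>C A (R x))"
        by (simp add: bounded_opD(2)[OF b] scaleC_scaleC scaleC.diff_right mult.commute)
      then show "R (c *\<^sub>C x) - \<i> *\<^sub>C A (R (c *\<^sub>C x)) = c *\<^sub>C R x - \<i> *\<^sub>C A (c *\<^sub>C R x)"
        by (simp only: R)
    qed
    show "norm (R x) \<le> 2 * norm x" for x
    proof -
      have "norm (R x) \<le> norm (R x - \<i> *\<^sub>C A (R x)) + norm (\<i> *\<^sub>C A (R x))"
        using norm_triangle_ineq[of "R x - \<i> *\<^sub>C A (R x)" "\<i> *\<^sub>C A (R x)"] by simp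
      also have "\<dots> \<le> norm x + 1 / 2 * norm (R x)"
        using half[of "R x"] by (simp add: R norm_scaleC)
      finally show ?thesis by simp
    qed
  qed
  from that[OF this R R'] show ?thesis .
qed

section \<open>Linearity, vanishing, unitary invariance and commutation for the Dixmier
  trace\<close>

context
  fixes Tr :: "('h::complex_hilbert_space \<Rightarrow> 'h) \<Rightarrow> complex"
  assumes dix: "dixmier_trace Tr"
begin

lemma dixmier_trace_add:
  "S \<in> weak_schatten 1 \<Longrightarrow> T \<in> weak_schatten 1 \<Longrightarrow> Tr (\<lambda>x. S x + T x) = Tr S + Tr T"
  using dix unfolding dixmier_trace_def by blast

lemma dixmier_trace_scaleC: "T \<in> weak_schatten 1 \<Longrightarrow> Tr (\<lambda>x. c *\<^sub>C T x) = c * Tr T"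
  using dix unfolding dixmier_trace_def by blast

lemma dixmier_trace_diff:
  assumes "S \<in> weak_schatten 1" "T \<in> weak_schatten 1"
  shows "Tr (\<lambda>x. S x - T x) = Tr S - Tr T"
  using dixmier_trace_add[OF assms(1) weak_schatten_1_scaleC[OF assms(2), of "-1"]]
    dixmier_trace_scaleC[OF assms(2), of "-1"]
  by (simp add: minus_eq_scaleC[symmetric])

lemma dixmier_trace_zero: "Tr (\<lambda>x. 0) = 0"
proof -
  have "compact_op (\<lambda>x::'h. 0)"
    unfolding compact_op_iff_seq by (auto intro!: bounded_op_zero exI[of _ "\<lambda>n. n"] strict_monoI)
  moreover from this have "singular_value (\<lambda>x::'h. 0) k = 0" for k
    using singular_value_le_rank_approx[of "\<lambda>x::'h. 0" k 0] singular_value_nonneg[of "\<lambda>x::'h. 0" k]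
      rank_approx_mono[OF rank_approx_zero[of "\<lambda>x::'h. 0" 0], of k 0] by force
  ultimately have "(\<lambda>x::'h. 0) \<in> weak_schatten 1"
    unfolding weak_schatten_1_iff by simp
  from dixmier_trace_scaleC[OF this, of 0] show ?thesis by (simp add: scaleC.zero_left)
qed

lemma dixmier_trace_cong_singular_values:
  assumes "S \<in> weak_schatten 1" "positive_op S" "T \<in> weak_schatten 1" "positive_op T"
    "singular_value S = singular_value T"
  shows "Tr S = Tr T"
proof -
  obtain \<omega> where "\<And>T. T \<in> weak_schatten 1 \<Longrightarrow> positive_op T \<Longrightarrow>
      Tr T = complex_of_real (\<omega> (\<lambda>N. (\<Sum>k<N. singular_value T k) / ln (real N)))"
    using dix unfolding dixmier_trace_def by blast
  then show ?thesis using assms by simp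
qed

lemma dixmier_trace_positive_negligible:
  assumes "T \<in> weak_schatten 1" "positive_op T" "dixmier_negligible T"
  shows "Tr T = 0"
proof -
  obtain \<omega> where "dixmier_limit \<omega>" and \<omega>: "\<And>T. T \<in> weak_schatten 1 \<Longrightarrow> positive_op T \<Longrightarrow>
      Tr T = complex_of_real (\<omega> (\<lambda>N. (\<Sum>k<N. singular_value T k) / ln (real N)))"
    using dix unfolding dixmier_trace_def by blast
  then have "\<omega> (\<lambda>N. (\<Sum>k<N. singular_value T k) / ln (real N)) = 0"
    using assms(3) unfolding dixmier_limit_def dixmier_negligible_def by blast
  then show ?thesis using \<omega>[OF assms(1,2)] by simp
qed

lemma dixmier_trace_decomposition:
  assumes P: "\<And>j::nat. P j \<in> weak_schatten 1" and T: "\<And>x. T x = (P 0 x - P 1 x) + \<i> *\<^sub>C (P 2 x - P 3 x)"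
  shows "Tr T = (Tr (P 0) - Tr (P 1)) + \<i> * (Tr (P 2) - Tr (P 3))"
proof -
  have "T = (\<lambda>x. (\<lambda>x. P 0 x - P 1 x) x + (\<lambda>x. \<i> *\<^sub>C (\<lambda>x. P 2 x - P 3 x) x) x)"
    by (rule ext) (simp only: T)
  then show ?thesis
    by (simp only: dixmier_trace_add[OF weak_schatten_1_diff weak_schatten_1_scaleC[OF weak_schatten_1_diff]]
        dixmier_trace_scaleC[OF weak_schatten_1_diff] dixmier_trace_diff P)
qed

lemma dixmier_trace_negligible:
  assumes T: "T \<in> weak_schatten 1" and neg: "dixmier_negligible T"
  shows "Tr T = 0"
proof -
  obtain P :: "nat \<Rightarrow> 'h \<Rightarrow> 'h" where P: "\<And>j. compact_op (P j)" "\<And>j. positive_op (P j)"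
      "\<And>j k. singular_value (P j) (2 * k) \<le> singular_value T k"
      "\<And>x. T x = (P 0 x - P 1 x) + \<i> *\<^sub>C (P 2 x - P 3 x)"
    using compact_positive_decomposition[OF weak_schatten_compact[OF T]] by blast
  have P1: "P j \<in> weak_schatten 1" for j
    by (rule weak_schatten_1_le[OF P(1) _ T, of j 1]) (simp add: P(3))
  have "dixmier_negligible (P j)" for j
    by (rule dixmier_negligible_dominated[OF P(1) P(3)])
      (use neg in \<open>simp add: dixmier_negligible_def\<close>)
  then have "Tr (P j) = 0" for j
    by (rule dixmier_trace_positive_negligible[OF P1 P(2)])
  then show ?thesis
    by (simp add: dixmier_trace_decomposition[OF P1 P(4)])
qed

text \<open>As \<open>V\<close> is the adjoint of \<open>U\<close>, conjugation turns the four
  positive pieces into positive ones with the same singular values, which determine the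
  trace.\<close>

lemma dixmier_trace_unitary_conjugate:
  assumes bU: "bounded_op U" and bV: "bounded_op V"
    and adj: "\<And>x y. cinner (U x) y = cinner x (V y)"
    and inv: "\<And>x. V (U x) = x" "\<And>x. U (V x) = x" and T: "T \<in> weak_schatten 1"
  shows "Tr (U \<circ> T \<circ> V) = Tr T"
proof -
  obtain P :: "nat \<Rightarrow> 'h \<Rightarrow> 'h" where P: "\<And>j. compact_op (P j)" "\<And>j. positive_op (P j)"
      "\<And>j k. singular_value (P j) (2 * k) \<le> singular_value T k"
      "\<And>x. T x = (P 0 x - P 1 x) + \<i> *\<^sub>C (P 2 x - P 3 x)"
    using compact_positive_decomposition[OF weak_schatten_compact[OF T]] by blast
  have P1: "P j \<in> weak_schatten 1" for j
    by (rule weak_schatten_1_le[OF P(1) _ T, of j 1]) (simp add: P(3))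
  define Q where "Q j = U \<circ> P j \<circ> V" for j
  have Q1: "Q j \<in> weak_schatten 1" for j
    unfolding Q_def by (intro weak_schatten_1_comp_left weak_schatten_1_comp_right P1 bU bV)
  have "cinner x (U (P j (V x))) = cinner (V x) (P j (V x))" for x j
    using adj[of "P j (V x)" x] cinner_commute by metis
  then have Q2: "positive_op (Q j)" for j
    using P(2) unfolding positive_op_def Q_def by simp
  have "Tr (Q j) = Tr (P j)" for j
    by (rule dixmier_trace_cong_singular_values[OF Q1 Q2 P1 P(2)])
      (unfold Q_def, rule singular_value_unitary_conjugate[OF bU bV adj inv P(1)])
  moreover have "(U \<circ> T \<circ> V) x = (Q 0 x - Q 1 x) + \<i> *\<^sub>C (Q 2 x - Q 3 x)" for x
    by (simp add: Q_def P(4)[of "V x"] bounded_opD[OF bU])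
  ultimately show ?thesis
    by (simp add: dixmier_trace_decomposition[OF P1 P(4)] dixmier_trace_decomposition[OF Q1])
qed

text \<open>These operators form a linear space that contains the unitaries and is stable under
  bounded inverses; the lemmas below enlarge it step by step to all bounded operators.\<close>

definition tracial :: "('h \<Rightarrow> 'h) \<Rightarrow> bool" where
  "tracial A \<longleftrightarrow> bounded_op A \<and> (\<forall>T\<in>weak_schatten 1. Tr (A \<circ> T) = Tr (T \<circ> A))"

lemma tracial_id: "tracial (\<lambda>x. x)"
  unfolding tracial_def by (auto simp: o_def bounded_op_id)

lemma tracial_add:
  assumes "tracial A" "tracial B"
  shows "tracial (\<lambda>x. A x + B x)"
  unfolding tracial_def
proof (intro conjI ballI)
  have A: "bounded_op A" and B: "bounded_op B" using assms by (auto simp: tracial_def)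
  then show "bounded_op (\<lambda>x. A x + B x)" by (rule bounded_op_add)
  fix T :: "'h \<Rightarrow> 'h" assume T: "T \<in> weak_schatten 1"
  have "Tr ((\<lambda>x. A x + B x) \<circ> T) = Tr (\<lambda>x. (A \<circ> T) x + (B \<circ> T) x)" by (simp add: o_def)
  also have "\<dots> = Tr (A \<circ> T) + Tr (B \<circ> T)"
    by (intro dixmier_trace_add weak_schatten_1_comp_left A B T)
  also have "\<dots> = Tr (T \<circ> A) + Tr (T \<circ> B)" using assms T by (simp add: tracial_def)
  also have "\<dots> = Tr (\<lambda>x. (T \<circ> A) x + (T \<circ> B) x)"
    by (intro dixmier_trace_add[symmetric] weak_schatten_1_comp_right A B T)
  also have "\<dots> = Tr (T \<circ> (\<lambda>x. A x + B x))"
    by (simp add: o_def bounded_opD(1)[OF weak_schatten_bounded[OF T]])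
  finally show "Tr ((\<lambda>x. A x + B x) \<circ> T) = Tr (T \<circ> (\<lambda>x. A x + B x))" .
qed

lemma tracial_scaleC:
  assumes "tracial A"
  shows "tracial (\<lambda>x. c *\<^sub>C A x)"
  unfolding tracial_def
proof (intro conjI ballI)
  have A: "bounded_op A" using assms by (auto simp: tracial_def)
  then show "bounded_op (\<lambda>x. c *\<^sub>C A x)" by (rule bounded_op_scaleC)
  fix T :: "'h \<Rightarrow> 'h" assume T: "T \<in> weak_schatten 1"
  have "Tr ((\<lambda>x. c *\<^sub>C A x) \<circ> T) = Tr (\<lambda>x. c *\<^sub>C (A \<circ> T) x)" by (simp add: o_def)
  also have "\<dots> = c * Tr (A \<circ> T)"
    by (intro dixmier_trace_scaleC weak_schatten_1_comp_left A T)
  also have "\<dots> = c * Tr (T \<circ> A)" using assms T by (simp add: tracial_def)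
  also have "\<dots> = Tr (\<lambda>x. c *\<^sub>C (T \<circ> A) x)"
    by (intro dixmier_trace_scaleC[symmetric] weak_schatten_1_comp_right A T)
  also have "\<dots> = Tr (T \<circ> (\<lambda>x. c *\<^sub>C A x))"
    by (simp add: o_def bounded_opD(2)[OF weak_schatten_bounded[OF T]])
  finally show "Tr ((\<lambda>x. c *\<^sub>C A x) \<circ> T) = Tr (T \<circ> (\<lambda>x. c *\<^sub>C A x))" .
qed

text \<open>Invariance is applied to T U, since U (T U) V = U T.\<close>

lemma tracial_unitary:
  assumes bU: "bounded_op U" and bV: "bounded_op V"
    and adj: "\<And>x y. cinner (U x) y = cinner x (V y)"
    and inv: "\<And>x. V (U x) = x" "\<And>x. U (V x) = x"
  shows "tracial U"
  unfolding tracial_def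
proof (intro conjI ballI bU)
  fix T :: "'h \<Rightarrow> 'h" assume T: "T \<in> weak_schatten 1"
  have "U \<circ> (T \<circ> U) \<circ> V = U \<circ> T" by (rule ext) (simp add: inv)
  then show "Tr (U \<circ> T) = Tr (T \<circ> U)"
    using dixmier_trace_unitary_conjugate[OF bU bV adj inv weak_schatten_1_comp_right[OF T bU]] by simp
qed

text \<open>Commuting \<open>R\<close> past K T K gives T K on one side and K T on the
  other.\<close>

lemma tracial_inverse:
  assumes R: "tracial R" and K: "bounded_op K" and inv: "\<And>x. R (K x) = x" "\<And>x. K (R x) = x"
  shows "tracial K"
  unfolding tracial_def
proof (intro conjI ballI K)
  fix T :: "'h \<Rightarrow> 'h" assume T: "T \<in> weak_schatten 1"
  have "K \<circ> T \<circ> K \<in> weak_schatten 1"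
    by (intro weak_schatten_1_comp_left weak_schatten_1_comp_right K T)
  then have "Tr (R \<circ> (K \<circ> T \<circ> K)) = Tr ((K \<circ> T \<circ> K) \<circ> R)" using R by (simp add: tracial_def)
  moreover have "R \<circ> (K \<circ> T \<circ> K) = T \<circ> K" "(K \<circ> T \<circ> K) \<circ> R = K \<circ> T"
    by (auto simp: inv)
  ultimately show "Tr (K \<circ> T) = Tr (T \<circ> K)" by simp
qed

text \<open>\<open>(I - \<i>A)\<^sup>-\<^sup>1\<close> is an affine function of the Cayley transform of \<open>A\<close>, which is unitary.\<close>

lemma tracial_self_adjoint_contraction:
  assumes b: "bounded_op A" and half: "\<And>x. norm (A x) \<le> 1 / 2 * norm x"
    and sa: "\<And>x y. cinner (A x) y = cinner x (A y)"
  shows "tracial A"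
proof -
  define B where "B x = (- 1) *\<^sub>C A x" for x
  have bB: "bounded_op B" unfolding B_def by (rule bounded_op_scaleC[OF b])
  have halfB: "norm (B x) \<le> 1 / 2 * norm x" for x using half[of x] by (simp add: B_def norm_scaleC)
  define K L where "K x = x - \<i> *\<^sub>C A x" and "L x = x + \<i> *\<^sub>C A x" for x
  have L_eq: "x - \<i> *\<^sub>C B x = L x" for x
    by (simp add: B_def L_def scaleC_scaleC scaleC.minus_left)
  obtain R where R: "bounded_op R" "\<And>x. K (R x) = x" "\<And>x. R (K x) = x"
    using inverse_one_minus_i_contraction[OF b half] unfolding K_def by blast
  obtain S where S: "bounded_op S" "\<And>x. L (S x) = x" "\<And>x. S (L x) = x"
    using inverse_one_minus_i_contraction[OF bB halfB] unfolding L_eq by blast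
  have bK: "bounded_op K" and bL: "bounded_op L"
    unfolding K_def L_def
    by (intro bounded_op_diff bounded_op_add bounded_op_id bounded_op_scaleC b)+
  have KL: "K (L x) = L (K x)" for x
    by (simp add: K_def L_def bounded_opD[OF b] scaleC_add_right scaleC.diff_right)
  have KL_adj: "cinner (K x) y = cinner x (L y)" "cinner (L x) y = cinner x (K y)" for x y
    by (simp_all add: K_def L_def cinner_add_left cinner_add_right cinner.diff_left cinner.diff_right
        cinner_scaleC_left cinner_scaleC_right sa)
  have RS: "L (R x) = R (L x)" "K (S x) = S (K x)" for x
    by (metis KL R(2,3)) (metis KL S(2,3))
  \<comment> \<open>\<open>U\<close> = (1 + iA)(1 - iA)^(-1) is the Cayley transform and
    \<open>V\<close> = (1 - iA)(1 + iA)^(-1) its adjoint and inverse.\<close>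
  define U V where "U = L \<circ> R" and "V = K \<circ> S"
  have "tracial U"
  proof (rule tracial_unitary)
    show "bounded_op U" "bounded_op V"
      unfolding U_def V_def by (intro bounded_op_comp bK bL R S)+
    show "V (U x) = x" "U (V x) = x" for x
      by (simp_all add: U_def V_def R S)
    show "cinner (U x) y = cinner x (V y)" for x y
    proof -
      have "cinner (L (R x)) y = cinner (L (R x)) (L (S y))" by (simp only: S(2))
      also have "\<dots> = cinner (R x) (L (K (S y)))" by (simp only: KL_adj KL)
      also have "\<dots> = cinner x (K (S y))" by (simp only: KL_adj(1)[symmetric] R(2))
      finally show ?thesis by (simp add: U_def V_def)
    qed
  qed
  from tracial_scaleC[OF tracial_add[OF this tracial_id], of "1 / 2"]
  have "tracial (\<lambda>x. (1 / 2) *\<^sub>C (U x + x))" .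
  \<comment> \<open>From L + K = 2 follows (U + 1)/2 = R. Inverting gives \<open>K\<close>, and then
    A = i (K - 1).\<close>
  moreover have "(1 / 2) *\<^sub>C (U x + x) = R x" for x
  proof -
    have "U x + x = L (R x) + K (R x)" by (simp add: U_def R)
    also have "\<dots> = 2 *\<^sub>C R x"
      using scaleC_add_left[of 1 1 "R x"] by (simp add: L_def K_def scaleC_one)
    finally show ?thesis by (simp add: scaleC_scaleC scaleC_one)
  qed
  ultimately have "tracial R" by simp
  from tracial_inverse[OF this bK R(3,2)] have "tracial K" .
  from tracial_scaleC[OF tracial_add[OF this tracial_scaleC[OF tracial_id, of "-1"]], of \<i>]
  have "tracial (\<lambda>x. \<i> *\<^sub>C (K x + (- 1) *\<^sub>C x))" .
  moreover have "\<i> *\<^sub>C (K x + (- 1) *\<^sub>C x) = A x" for x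
    by (simp add: K_def minus_eq_scaleC[symmetric] scaleC.minus_right scaleC_scaleC scaleC.minus_left scaleC_one)
  ultimately show ?thesis by simp
qed

lemma tracial_self_adjoint:
  assumes b: "bounded_op A" and sa: "\<And>x y. cinner (A x) y = cinner x (A y)"
  shows "tracial A"
proof -
  obtain K where K: "K > 0" "\<And>x. norm (A x) \<le> K * norm x"
    using bounded_op_bound[OF b] by blast
  \<comment> \<open>Rescales \<open>A\<close> to norm at most 1/2, as the contraction case
    requires.\<close>
  define c where "c = 1 / (2 * K)"
  have "norm (complex_of_real c *\<^sub>C A x) \<le> 1 / 2 * norm x" for x
  proof -
    have "norm (complex_of_real c *\<^sub>C A x) = c * norm (A x)"
      using K(1) by (simp add: norm_scaleC c_def norm_divide norm_mult)
    also have "\<dots> \<le> c * (K * norm x)"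
      by (rule mult_left_mono[OF K(2)]) (use K(1) in \<open>simp add: c_def\<close>)
    also have "\<dots> = 1 / 2 * norm x" using K(1) by (simp add: c_def)
    finally show ?thesis .
  qed
  then have "tracial (\<lambda>x. complex_of_real c *\<^sub>C A x)"
    by (intro tracial_self_adjoint_contraction bounded_op_scaleC b)
      (simp_all add: cinner_scaleC_left cinner_scaleC_right sa)
  from tracial_scaleC[OF this, of "complex_of_real (2 * K)"] show ?thesis
    using K(1) by (simp add: scaleC_scaleC c_def scaleC_one)
qed

theorem dixmier_trace_commute:
  assumes b: "bounded_op A" and T: "T \<in> weak_schatten 1"
  shows "Tr (A \<circ> T) = Tr (T \<circ> A)"
proof -
  note b' = bounded_op_adj[OF b]
  \<comment> \<open>Self-adjoint operators with A = (X - iY)/2.\<close>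
  define X Y where "X x = A x + adj A x" and "Y x = \<i> *\<^sub>C A x + (- \<i>) *\<^sub>C adj A x" for x
  have "tracial X" "tracial Y"
    unfolding X_def Y_def
    by (intro tracial_self_adjoint bounded_op_add bounded_op_scaleC b b';
        simp add: cinner_add_left cinner_add_right cinner_scaleC_left cinner_scaleC_right
          cinner.diff_left cinner.diff_right scaleC.minus_left
          cinner_adj_left[OF b] cinner_adj_right[OF b])+
  from tracial_scaleC[OF tracial_add[OF this(1) tracial_scaleC[OF this(2), of "- \<i>"]], of "1 / 2"]
  have "tracial (\<lambda>x. (1 / 2) *\<^sub>C (X x + (- \<i>) *\<^sub>C Y x))" .
  moreover have "(1 / 2) *\<^sub>C (X x + (- \<i>) *\<^sub>C Y x) = A x" for x
  proof -
    have "X x + (- \<i>) *\<^sub>C Y x = 2 *\<^sub>C A x"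
      using scaleC_add_left[of 1 1 "A x"]
      by (simp add: X_def Y_def scaleC_add_right scaleC.diff_right scaleC_scaleC scaleC.minus_left scaleC_one)
    then show ?thesis by (simp add: scaleC_scaleC scaleC_one)
  qed
  ultimately have "tracial A" by simp
  then show ?thesis using T by (simp add: tracial_def)
qed

end

subsection \<open>The absolute value of an invertible self-adjoint operator\<close>

lemma dense_orthogonal_zero:
  assumes "closure S = UNIV" "\<And>w. w \<in> S \<Longrightarrow> cinner z w = 0"
  shows "z = 0"
proof -
  have "closed {w. cinner z w = 0}"
    by (rule closed_Collect_eq[OF
          bounded_linear.continuous_on[OF cinner.bounded_linear_right continuous_on_id]
          continuous_on_const])
  then have "closure S \<subseteq> {w. cinner z w = 0}"
    by (rule closure_minimal[rotated]) (use assms(2) in auto)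
  then have "cinner z z = 0" using assms(1) by blast
  then show ?thesis by (simp add: cinner_self)
qed

text \<open>\<open>adjoint_op\<close> picks its value by a description, which satisfies the defining
  equation only because density of the domain makes the solution unique.\<close>

lemma self_adjoint_symmetric:
  assumes sa: "self_adjoint A" and "A u = Some x" "A v = Some y"
  shows "cinner u y = cinner x v"
proof -
  define P where "P z \<longleftrightarrow> (\<forall>w\<in>dom A. cinner u (the (A w)) = cinner z w)" for z
  have "adjoint_op A u = Some x" using assms by (simp add: self_adjoint_def)
  then have x: "x = (THE z. P z)" and ex: "\<exists>z. P z"
    unfolding adjoint_op_def P_def by (auto split: if_splits)
  have "z = z'" if "P z" "P z'" for z z'
  proof -
    have "z - z' = 0"
      by (rule dense_orthogonal_zero[of "dom A"])
        (use sa that in \<open>auto simp: self_adjoint_def P_def cinner.diff_left\<close>)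
    then show ?thesis by simp
  qed
  with ex have "P (THE z. P z)" by (metis theI)
  then have "P x" by (simp only: x[symmetric])
  then show ?thesis using assms(3) unfolding P_def by (metis domI option.sel)
qed

lemma linear_op_add:
  assumes "linear_op A" "A u = Some x" "A v = Some y"
  shows "A (u + v) = Some (x + y)"
proof -
  have "u + v \<in> dom A"
    using assms unfolding linear_op_def complex_vector.subspace_def by blast
  moreover have "the (A (u + v)) = x + y"
    using assms unfolding linear_op_def by (metis domI option.sel)
  ultimately show ?thesis by force
qed

lemma linear_op_scaleC:
  assumes "linear_op A" "A u = Some x"
  shows "A (c *\<^sub>C u) = Some (c *\<^sub>C x)"
proof -
  have "c *\<^sub>C u \<in> dom A"
    using assms unfolding linear_op_def complex_vector.subspace_def by blast
  moreover have "the (A (c *\<^sub>C u)) = c *\<^sub>C x"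
    using assms unfolding linear_op_def by (metis domI option.sel)
  ultimately show ?thesis by force
qed

lemma linear_op_zero:
  assumes "linear_op A"
  shows "A 0 = Some 0"
proof -
  have "0 \<in> dom A"
    using assms unfolding linear_op_def complex_vector.subspace_def by blast
  then obtain x where "A 0 = Some x" by blast
  from linear_op_scaleC[OF assms this, of 0] show ?thesis by (simp add: scaleC.zero_left)
qed

lemma inverse_op_iff:
  assumes "invertible_op D"
  shows "D x = Some y \<longleftrightarrow> inverse_op D y = x"
proof -
  have ex1: "\<exists>!x. D x = Some y" using assms by (simp add: invertible_op_def)
  show ?thesis unfolding inverse_op_def using theI'[OF ex1] ex1 by blast
qed

lemma inverse_op_linear_inj:
  assumes "invertible_op D" "linear_op D" "inverse_op D x = 0"
  shows "x = 0"
  using assms inverse_op_iff[OF assms(1), of 0 x] linear_op_zero[OF assms(2)] by simp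

lemma partial_eqI: "(\<And>x z. f x = Some z \<longleftrightarrow> g x = Some z) \<Longrightarrow> f = g"
  by (rule ext) (metis not_Some_eq)

context
  fixes D :: "'h::complex_hilbert_space \<rightharpoonup> 'h"
  assumes sa: "self_adjoint D" and inv: "invertible_op D" and cpt: "compact_op (inverse_op D)"
begin

lemma inverse_op_symmetric: "cinner (inverse_op D x) y = cinner x (inverse_op D y)"
  by (rule self_adjoint_symmetric[OF sa]) (simp_all add: inverse_op_iff[OF inv])

text \<open>The inverse of |D| has to be B = |T| for T the inverse of D, obtained by taking absolute
  values of the eigenvalues. Its partial inverse \<open>A\<close> is shown to meet the description
  of \<open>abs_op\<close>, and any competitor to coincide with it. The equation for
  \<open>adj B (B x)\<close> is what makes the singular values agree.\<close>

lemma abs_op_inverse: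
  "\<exists>B. compact_op B \<and> (\<forall>x. adj B (B x) = adj (inverse_op D) (inverse_op D x)) \<and>
     invertible_op (abs_op D) \<and> inverse_op (abs_op D) = B"
proof -
  define T where "T = inverse_op D"
  note T_sym = inverse_op_symmetric[folded T_def] and D_iff = inverse_op_iff[OF inv, folded T_def]
  have cT: "compact_op T" and bT: "bounded_op T"
    using cpt compact_op_bounded by (auto simp: T_def)
  have lin: "linear_op D" using sa by (simp add: self_adjoint_def)
  have T0: "x = 0" if "T x = 0" for x
    using inverse_op_linear_inj[OF inv lin] that by (simp add: T_def)
  obtain e l where es: "eigensystem T e l"
    using compact_self_adjoint_eigensystem[OF cT T_sym] by blast
  note os = eigensystem_orthosystem[OF es] and l = eigensystem_bounded[OF es]
  have l': "\<forall>k. \<bar>\<bar>l k\<bar>\<bar> \<le> \<bar>l 0\<bar>" using l by simp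
  have s: "\<forall>k. \<bar>sgn (l k)\<bar> \<le> 1" by (simp add: sgn_if)
  define B where "B = diag e (\<lambda>k. \<bar>l k\<bar>)"
  \<comment> \<open>\<open>V\<close> is the sign of \<open>T\<close>, as in a polar decomposition: V
    T = T V = B and B V = T. It transfers compactness and the range between \<open>T\<close> and
    \<open>B\<close>.\<close>
  define V where "V = diag e (\<lambda>k. sgn (l k))"
  have T_diag: "T x = diag e l x" for x by (rule eigensystem_diag[OF es bT])
  have VT: "V (T x) = B x" for x
    unfolding V_def B_def T_diag diag_diag[OF os s l]
    by (rule arg_cong2[of _ _ _ _ "diag e"]) (auto simp: abs_sgn mult.commute)
  have TV: "T (V x) = B x" for x
    unfolding V_def B_def T_diag diag_diag[OF os l s]
    by (rule arg_cong2[of _ _ _ _ "diag e"]) (auto simp: abs_sgn)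
  have BV: "B (V x) = T x" for x
    unfolding V_def B_def T_diag diag_diag[OF os l' s]
    by (rule arg_cong2[of _ _ _ _ "diag e"]) (auto simp: sgn_if)
  have BB: "B (B x) = T (T x)" for x
    unfolding B_def T_diag diag_diag[OF os l' l'] diag_diag[OF os l l] by simp
  have bV: "bounded_op V" unfolding V_def by (rule bounded_op_diag[OF os s])
  have bB: "bounded_op B" unfolding B_def by (rule bounded_op_diag[OF os l'])
  have B_sym: "cinner (B x) y = cinner x (B y)" for x y
    unfolding B_def by (rule diag_sym[OF os l'])
  have B_pos: "0 \<le> Re (cinner x (B x))" for x
    using positive_op_diag[OF os l'] by (simp add: B_def positive_op_def)
  have B0: "x = 0" if "B x = 0" for x
    using BB[of x] that T0 by (simp add: bounded_opD(3)[OF bB])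
  have B_inj: "x = y" if "B x = B y" for x y
    using B0[of "x - y"] that by (simp add: bounded_opD(5)[OF bB])
  have cB: "compact_op B"
    using compact_op_comp_left[OF bV cT] VT by (metis comp_apply ext)
  define A where "A y = (if \<exists>x. B x = y then Some (THE x. B x = y) else None)" for y
  have A_iff: "A y = Some x \<longleftrightarrow> B x = y" for x y
  proof -
    have "(THE x. B x = y) = z" if "B z = y" for z
      by (rule the_equality) (use that B_inj in auto)
    then show ?thesis unfolding A_def by auto
  qed
  have A_B: "A (B x) = Some x" for x by (simp add: A_iff)
  have domA: "dom A = range B" using A_iff by (auto simp: dom_def)
  have "range B = dom D"
  proof -
    have "range B = range T" using TV BV by (metis (no_types) antisym image_subsetI rangeI)
    also have "\<dots> = dom D" using D_iff by (auto simp: dom_def)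
    finally show ?thesis .
  qed
  then have dense: "closure (dom A) = UNIV" using sa domA by (simp add: self_adjoint_def)
  have A_lin: "linear_op A"
    unfolding linear_op_def domA complex_vector.subspace_def
  proof (intro conjI ballI allI)
    show "0 \<in> range B" using bounded_opD(3)[OF bB] by (metis rangeI)
    fix x y assume "x \<in> range B" "y \<in> range B"
    then obtain u v where uv: "x = B u" "y = B v" by blast
    then have "x + y = B (u + v)" by (simp add: bounded_opD(1)[OF bB])
    then show "x + y \<in> range B" "the (A (x + y)) = the (A x) + the (A y)"
      by (simp_all add: uv A_B)
  next
    fix c x assume "x \<in> range B"
    then obtain u where u: "x = B u" by blast
    then have "c *\<^sub>C x = B (c *\<^sub>C u)" by (simp add: bounded_opD(2)[OF bB])
    then show "c *\<^sub>C x \<in> range B" "the (A (c *\<^sub>C x)) = c *\<^sub>C the (A x)"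
      by (simp_all add: u A_B)
  qed
  \<comment> \<open>As \<open>A\<close> undoes \<open>B\<close>, the adjoint condition at
    \<open>y\<close> reads <y, w> = <B z, w> for all w, that is B z = y, the very condition defining
    \<open>A\<close>.\<close>
  have A_adj: "adjoint_op A = A"
  proof (rule ext)
    fix y
    have "(\<forall>x\<in>dom A. cinner y (the (A x)) = cinner z x) \<longleftrightarrow> B z = y" for z
    proof -
      have "(\<forall>x\<in>dom A. cinner y (the (A x)) = cinner z x) \<longleftrightarrow> (\<forall>w. cinner y w = cinner (B z) w)"
        by (simp add: domA A_B B_sym)
      also have "\<dots> \<longleftrightarrow> B z = y" using cinner_eqI_left[of y "B z"] by blast
      finally show ?thesis .
    qed
    then show "adjoint_op A y = A y" unfolding adjoint_op_def A_def by simp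
  qed
  have DD: "(adjoint_op D \<circ>\<^sub>m D) x = Some z \<longleftrightarrow> T (T z) = x" for x z
    using sa D_iff by (auto simp: self_adjoint_def map_comp_Some_iff)
  have "abs_op D = A"
    unfolding abs_op_def
  proof (rule the_equality)
    have "A \<circ>\<^sub>m A = adjoint_op D \<circ>\<^sub>m D"
    proof (rule partial_eqI)
      fix x z
      have "(A \<circ>\<^sub>m A) x = Some z \<longleftrightarrow> B (B z) = x"
        using A_iff by (auto simp: map_comp_Some_iff)
      then show "(A \<circ>\<^sub>m A) x = Some z \<longleftrightarrow> (adjoint_op D \<circ>\<^sub>m D) x = Some z"
        by (simp add: DD BB)
    qed
    moreover have "\<forall>x\<in>dom A. 0 \<le> Re (cinner x (the (A x)))"
      using B_pos by (auto simp: domA A_B B_sym)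
    ultimately show "self_adjoint A \<and> (\<forall>x\<in>dom A. 0 \<le> Re (cinner x (the (A x)))) \<and>
        A \<circ>\<^sub>m A = adjoint_op D \<circ>\<^sub>m D"
      using A_lin A_adj dense by (simp add: self_adjoint_def)
  next
    fix A' assume "self_adjoint A' \<and> (\<forall>x\<in>dom A'. 0 \<le> Re (cinner x (the (A' x)))) \<and>
        A' \<circ>\<^sub>m A' = adjoint_op D \<circ>\<^sub>m D"
    then have sa': "self_adjoint A'" and pos': "\<forall>x\<in>dom A'. 0 \<le> Re (cinner x (the (A' x)))"
      and sq: "A' \<circ>\<^sub>m A' = adjoint_op D \<circ>\<^sub>m D" by auto
    have lin': "linear_op A'" using sa' by (simp add: self_adjoint_def)
    have sq_iff: "(\<exists>u. A' x = Some u \<and> A' u = Some z) \<longleftrightarrow> T (T z) = x" for x z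
      using DD[of x z] unfolding sq[symmetric] by (auto simp: map_comp_Some_iff)
    \<comment> \<open>The difference is sent to 0 by \<open>A'\<close>, and so is 0 itself; squaring
      gives u - v = T (T 0) = 0. Surjectivity comes likewise from the square, so \<open>A'\<close>
      has an inverse \<open>Q\<close> with Q Q = T T.\<close>
    have inj': "u = v" if "A' u = Some w" "A' v = Some w" for u v w
    proof -
      have "A' (u + (- 1) *\<^sub>C v) = Some (w + (- 1) *\<^sub>C w)"
        by (intro linear_op_add linear_op_scaleC lin' that)
      then have "A' (u - v) = Some 0" by (simp add: minus_eq_scaleC[symmetric])
      then have "T (T 0) = u - v" using sq_iff linear_op_zero[OF lin'] by blast
      then show ?thesis by (simp add: bounded_opD(3)[OF bT])
    qed
    have "\<exists>!u. A' u = Some w" for w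
    proof -
      have "\<exists>u. A' u = Some w" using sq_iff[of "T (T w)" w] by blast
      then show ?thesis using inj' by blast
    qed
    then obtain Q where Q: "\<And>w. A' (Q w) = Some w" by metis
    have Q_iff: "A' u = Some w \<longleftrightarrow> Q w = u" for u w using Q inj' by metis
    have QQ: "Q (Q w) = T (T w)" for w using sq_iff[of "Q (Q w)" w] Q by metis
    have Q_add: "Q (x + y) = Q x + Q y" for x y
      using linear_op_add[OF lin' Q Q, of x y] by (simp add: Q_iff)
    have Q_scale: "Q (c *\<^sub>C x) = c *\<^sub>C Q x" for c x
      using linear_op_scaleC[OF lin' Q, of c x] by (simp add: Q_iff)
    have Q_sym: "cinner (Q x) y = cinner x (Q y)" for x y
      by (rule self_adjoint_symmetric[OF sa' Q Q])
    have Q_pos: "0 \<le> Re (cinner x (Q x))" for x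
      using pos' Q[of x] by (metis Q_sym domI option.sel)
    \<comment> \<open>On \<open>e k\<close> the square of \<open>Q\<close> is r^2 with r = |l k|, so
      y = (Q - r) e_k satisfies Q y = - r y. Positivity of \<open>Q\<close> forces y = 0 when r is
      nonzero.\<close>
    have Q_e: "Q (e k) = complex_of_real \<bar>l k\<bar> *\<^sub>C e k" for k
    proof (cases "l k = 0")
      case True
      then have "e k = 0" using es unfolding eigensystem_def by (metis)
      then show ?thesis using Q_scale[of 0 0] by (simp add: scaleC.zero_left scaleC.zero_right)
    next
      case False
      define r where "r = complex_of_real \<bar>l k\<bar>"
      define y where "y = Q (e k) + (- r) *\<^sub>C e k"
      have "T (e k) = complex_of_real (l k) *\<^sub>C e k"
        using es unfolding eigensystem_def by (simp add: scaleR_eq_scaleC)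
      then have "Q (Q (e k)) = complex_of_real (l k * l k) *\<^sub>C e k"
        by (simp add: QQ bounded_opD(2)[OF bT] scaleC_scaleC)
      also have "complex_of_real (l k * l k) = r * r"
        unfolding r_def of_real_mult[symmetric] abs_mult_self_eq ..
      finally have "Q y = (- r) *\<^sub>C y"
        unfolding y_def Q_add Q_scale
        by (simp only: scaleC_add_right scaleC_scaleC minus_mult_minus add.commute)
      then have "Re (cinner y (Q y)) = - \<bar>l k\<bar> * (norm y)\<^sup>2"
        by (simp add: r_def cinner_scaleC_right cinner_self scaleC.minus_left cinner.minus_right
            flip: of_real_power)
      then have "\<bar>l k\<bar> * (norm y)\<^sup>2 \<le> 0" using Q_pos[of y] by simp
      then have "y = 0" using False by (simp add: mult_le_0_iff)
      then show ?thesis by (simp add: y_def r_def scaleC.minus_left)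
    qed
    \<comment> \<open>Both are symmetric and agree on the eigenvectors, so Q x - B x is orthogonal
      to all of them, hence in the kernel of \<open>T\<close>, which is trivial.\<close>
    have QB: "Q x = B x" for x
    proof -
      have "cinner (e k) (Q x - B x) = 0" for k
        by (simp add: cinner.diff_right Q_sym[symmetric] Q_e cinner_scaleC_left
            B_def cinner_diag[OF os l'])
      then have "T (Q x - B x) = 0" by (rule eigensystem_orthogonal_kernel[OF es])
      then show ?thesis using T0[of "Q x - B x"] by simp
    qed
    show "A' = A"
      by (rule partial_eqI) (simp add: Q_iff A_iff QB)
  qed
  moreover have "inverse_op A = B"
    by (rule ext) (simp add: inverse_op_def A_iff)
  moreover have "invertible_op A"
    using bB by (simp add: invertible_op_def \<open>inverse_op A = B\<close> A_iff)
  moreover have "adj B = B" "adj T = T"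
    by (auto intro!: adj_eqI B_sym T_sym)
  ultimately show ?thesis
    using cB BB unfolding T_def[symmetric] by (intro exI[of _ B]) simp
qed

text \<open>\<open>singular_value\<close> refers to an operator only through its composite with its
  adjoint on the left, and these composites coincide for the inverses of D and |D|.\<close>

lemma abs_op_weak_schatten:
  assumes "inverse_op D \<in> weak_schatten n"
  shows "invertible_op (abs_op D)" "inverse_op (abs_op D) \<in> weak_schatten n"
proof -
  obtain B where B: "compact_op B" "\<forall>x. adj B (B x) = adj (inverse_op D) (inverse_op D x)"
    and A: "invertible_op (abs_op D)" "inverse_op (abs_op D) = B"
    using abs_op_inverse by blast
  have "singular_value B = singular_value (inverse_op D)"
    unfolding singular_value_def using B(2) by simp
  then have "B \<in> weak_schatten n"
    using assms B(1) unfolding weak_schatten_def mem_Collect_eq by metis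
  with A show "invertible_op (abs_op D)" "inverse_op (abs_op D) \<in> weak_schatten n" by simp_all
qed

end

subsection \<open>Twisted commutators\<close>

text \<open>Multiplying E a - \<sigma>(a) E = d by the inverse S of E on both sides gives a S - S
  \<sigma>(a) = S d S. \<open>E\<close> is kept general so as to be D or |D|.\<close>

lemma twisted_commutator_intertwines:
  assumes btc: "bounded_twisted_commutators \<sigma> \<pi> E" and inv: "invertible_op E"
  shows "\<exists>d. bounded_op d \<and>
    (\<forall>x. \<pi> a (inverse_op E x) - inverse_op E (\<pi> (\<sigma> a) x) = inverse_op E (d (inverse_op E x)))"
proof -
  define S where "S = inverse_op E"
  note iff = inverse_op_iff[OF inv, folded S_def]
  have bS: "bounded_op S" using inv by (simp add: invertible_op_def S_def)
  obtain d where d: "bounded_op d" "\<forall>x\<in>dom E. d x = the (E (\<pi> a x)) - \<pi> (\<sigma> a) (the (E x))"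
    and dom: "\<forall>x\<in>dom E. \<pi> a x \<in> dom E"
    using btc unfolding bounded_twisted_commutators_def extends_twisted_commutator_def by blast
  have "\<pi> a (S x) - S (\<pi> (\<sigma> a) x) = S (d (S x))" for x
  proof -
    have E: "E (S x) = Some x" by (simp add: iff)
    then have "\<pi> a (S x) \<in> dom E" using dom by blast
    then obtain w where w: "E (\<pi> a (S x)) = Some w" by blast
    have "d (S x) = w - \<pi> (\<sigma> a) x" using d(2) E w by force
    then show ?thesis using w by (simp add: bounded_opD(5)[OF bS] iff)
  qed
  with d(1) show ?thesis unfolding S_def by blast
qed

text \<open>Moving c through one factor S at a time applies \<sigma> once and leaves one error S d S
  in place of S; thus every error term contains m + 1 factors S.\<close>

lemma power_commutator_sum:
  assumes bS: "bounded_op S"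
    and d: "\<And>a x. \<pi> a (S x) - S (\<pi> (\<sigma> a) x) = S (d a (S x))"
  shows "\<pi> c ((S ^^ m) x) - (S ^^ m) (\<pi> ((\<sigma> ^^ m) c) x)
    = (\<Sum>k<m. (S ^^ Suc k) (d ((\<sigma> ^^ k) c) ((S ^^ (m - k)) x)))"
proof (induction m arbitrary: x)
  case (Suc m)
  have bSm: "bounded_op (S ^^ m)" by (rule bounded_op_power[OF bS])
  have \<sigma>_Suc: "(\<sigma> ^^ Suc m) c = \<sigma> ((\<sigma> ^^ m) c)" by simp
  have S_Suc: "(S ^^ Suc k) y = (S ^^ k) (S y)" for k y by (simp only: funpow_Suc_right o_apply)
  have "\<pi> c ((S ^^ Suc m) x) - (S ^^ Suc m) (\<pi> ((\<sigma> ^^ Suc m) c) x)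
      = (\<pi> c ((S ^^ m) (S x)) - (S ^^ m) (\<pi> ((\<sigma> ^^ m) c) (S x)))
        + (S ^^ m) (\<pi> ((\<sigma> ^^ m) c) (S x) - S (\<pi> (\<sigma> ((\<sigma> ^^ m) c)) x))"
    by (simp add: S_Suc \<sigma>_Suc bounded_opD(5)[OF bSm] del: funpow.simps)
  also have "\<dots> = (\<Sum>k<m. (S ^^ Suc k) (d ((\<sigma> ^^ k) c) ((S ^^ (m - k)) (S x))))
      + (S ^^ Suc m) (d ((\<sigma> ^^ m) c) (S x))"
    by (simp only: Suc d S_Suc)
  also have "(\<Sum>k<m. (S ^^ Suc k) (d ((\<sigma> ^^ k) c) ((S ^^ (m - k)) (S x))))
      = (\<Sum>k<m. (S ^^ Suc k) (d ((\<sigma> ^^ k) c) ((S ^^ (Suc m - k)) x)))"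
    by (rule sum.cong) (simp_all only: S_Suc[symmetric] lessThan_iff Suc_diff_le less_imp_le)
  finally show ?case by simp
qed simp

lemma dixmier_trace_sum_zero:
  fixes m :: nat
  assumes dix: "dixmier_trace Tr"
    and F: "\<And>k. k < m \<Longrightarrow> F k \<in> weak_schatten 1" "\<And>k. k < m \<Longrightarrow> Tr (F k) = 0"
  shows "Tr (\<lambda>x. \<Sum>k<m. F k x) = 0 \<and> (0 < m \<longrightarrow> (\<lambda>x. \<Sum>k<m. F k x) \<in> weak_schatten 1)"
  using F
proof (induction m)
  case 0
  then show ?case by (simp add: dixmier_trace_zero[OF dix])
next
  case (Suc m)
  show ?case
  proof (cases "m = 0")
    case True
    then show ?thesis using Suc.prems by simp
  next
    case False
    have IH: "Tr (\<lambda>x. \<Sum>k<m. F k x) = 0" "(\<lambda>x. \<Sum>k<m. F k x) \<in> weak_schatten 1"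
      using Suc False by auto
    have m: "F m \<in> weak_schatten 1" "Tr (F m) = 0" using Suc.prems by auto
    show ?thesis
      using dixmier_trace_add[OF dix IH(2) m(1)] weak_schatten_1_add[OF IH(2) m(1)] IH(1) m(2) by simp
  qed
qed

text \<open>Up to negligible terms c S^n equals S^n \<sigma>^n(c), and the bounded factor then moves
  cyclically under the trace.\<close>

lemma dixmier_trace_twist:
  assumes dix: "dixmier_trace Tr" and n: "n \<ge> 1" and S: "S \<in> weak_schatten n"
    and d: "\<And>a. \<exists>d. bounded_op d \<and> (\<forall>x. \<pi> a (S x) - S (\<pi> (\<sigma> a) x) = S (d (S x)))"
    and \<pi>: "\<And>a. bounded_op (\<pi> a)" and Z: "bounded_op Z"
  shows "Tr (Z \<circ> \<pi> c \<circ> (S ^^ n)) = Tr (\<pi> ((\<sigma> ^^ n) c) \<circ> Z \<circ> (S ^^ n))"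
proof -
  have bS: "bounded_op S" by (rule weak_schatten_bounded[OF S])
  obtain d where bd: "\<And>a. bounded_op (d a)"
    and d: "\<And>a x. \<pi> a (S x) - S (\<pi> (\<sigma> a) x) = S (d a (S x))"
    using d by metis
  have Sn: "S ^^ n \<in> weak_schatten 1"
    using weak_schatten_1_power_product[OF S n order_refl bounded_op_id(1)] by simp
  have left: "Z \<circ> \<pi> c \<circ> (S ^^ n) \<in> weak_schatten 1"
    by (intro weak_schatten_1_comp_left bounded_op_comp Z \<pi> Sn)
  have mid: "Z \<circ> (S ^^ n) \<in> weak_schatten 1"
    by (intro weak_schatten_1_comp_left Z Sn)
  then have right: "Z \<circ> (S ^^ n) \<circ> \<pi> ((\<sigma> ^^ n) c) \<in> weak_schatten 1"
    by (rule weak_schatten_1_comp_right[OF _ \<pi>])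
  \<comment> \<open>The last of the n + 1 factors is split off: the bracket holds n of them and lies
    in \<open>weak_schatten 1\<close>, and the separate compact \<open>S\<close> makes
    \<open>F k\<close> negligible.\<close>
  define F where "F k = Z \<circ> ((S ^^ Suc k) \<circ> d ((\<sigma> ^^ k) c) \<circ> (S ^^ (n - Suc k))) \<circ> S" for k
  have F: "F k \<in> weak_schatten 1" "Tr (F k) = 0" if "k < n" for k
  proof -
    have *: "Z \<circ> ((S ^^ Suc k) \<circ> d ((\<sigma> ^^ k) c) \<circ> (S ^^ (n - Suc k))) \<in> weak_schatten 1"
      by (intro weak_schatten_1_comp_left Z weak_schatten_1_power_product[OF S]) (use that bd in auto)
    then show "F k \<in> weak_schatten 1"
      unfolding F_def by (rule weak_schatten_1_comp_right[OF _ bS])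
    then show "Tr (F k) = 0"
      unfolding F_def
      by (rule dixmier_trace_negligible[OF dix _
            dixmier_negligible_comp_compact[OF * weak_schatten_compact[OF S]]])
  qed
  have "(\<lambda>x. (Z \<circ> \<pi> c \<circ> (S ^^ n)) x - (Z \<circ> (S ^^ n) \<circ> \<pi> ((\<sigma> ^^ n) c)) x) = (\<lambda>x. \<Sum>k<n. F k x)"
  proof (rule ext)
    fix x
    have "(Z \<circ> \<pi> c \<circ> (S ^^ n)) x - (Z \<circ> (S ^^ n) \<circ> \<pi> ((\<sigma> ^^ n) c)) x
        = Z (\<pi> c ((S ^^ n) x) - (S ^^ n) (\<pi> ((\<sigma> ^^ n) c) x))"
      by (simp add: bounded_opD(5)[OF Z])
    also have "\<dots> = (\<Sum>k<n. Z ((S ^^ Suc k) (d ((\<sigma> ^^ k) c) ((S ^^ (n - k)) x))))"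
      by (simp only: power_commutator_sum[where \<pi> = \<pi> and \<sigma> = \<sigma> and d = d, OF bS d] bounded_opD(6)[OF Z])
    also have "\<dots> = (\<Sum>k<n. F k x)"
    proof (rule sum.cong[OF refl])
      fix k assume "k \<in> {..<n}"
      then have "n - k = Suc (n - Suc k)" by simp
      then have "(S ^^ (n - k)) x = (S ^^ (n - Suc k)) (S x)"
        by (simp only: funpow_Suc_right o_apply)
      then show "Z ((S ^^ Suc k) (d ((\<sigma> ^^ k) c) ((S ^^ (n - k)) x))) = F k x"
        unfolding F_def by (simp only: o_apply)
    qed
    finally show "(Z \<circ> \<pi> c \<circ> (S ^^ n)) x - (Z \<circ> (S ^^ n) \<circ> \<pi> ((\<sigma> ^^ n) c)) x = (\<Sum>k<n. F k x)" .
  qed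
  with dixmier_trace_diff[OF dix left right] dixmier_trace_sum_zero[OF dix, of n F] F
  have "Tr (Z \<circ> \<pi> c \<circ> (S ^^ n)) = Tr (Z \<circ> (S ^^ n) \<circ> \<pi> ((\<sigma> ^^ n) c))" by simp
  also have "\<dots> = Tr (\<pi> ((\<sigma> ^^ n) c) \<circ> (Z \<circ> (S ^^ n)))"
    by (rule dixmier_trace_commute[OF dix \<pi> mid, symmetric])
  finally show ?thesis by (simp only: o_assoc)
qed

lemma foldr_comp: "foldr (\<circ>) fs g = foldr (\<circ>) fs id \<circ> g"
  by (induction fs) (simp_all add: o_assoc)

section \<open>Uniqueness, linearity and the Leibniz rule of the twisted commutator\<close>

context
  fixes \<sigma> :: "'a::complex_algebra \<Rightarrow> 'a" and \<pi> :: "'a \<Rightarrow> 'h::complex_hilbert_space \<Rightarrow> 'h"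
    and D :: "'h \<rightharpoonup> 'h"
  assumes aut: "algebra_automorphism \<sigma>" and triple: "twisted_spectral_triple \<sigma> \<pi> D"
begin

lemma triple_action:
  "bounded_op (\<pi> a)" "\<pi> (a + b) x = \<pi> a x + \<pi> b x" "\<pi> (c *\<^sub>C a) x = c *\<^sub>C \<pi> a x"
  "\<pi> (a * b) x = \<pi> a (\<pi> b x)"
  using triple unfolding twisted_spectral_triple_def bounded_action_def by (auto simp: o_def)

lemma automorphism:
  "\<sigma> (a + b) = \<sigma> a + \<sigma> b" "\<sigma> (c *\<^sub>C a) = c *\<^sub>C \<sigma> a" "\<sigma> (a * b) = \<sigma> a * \<sigma> b"
  using aut unfolding algebra_automorphism_def clinear_iff by auto

lemma automorphism_inv: "\<sigma> (inv \<sigma> a) = a"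
  using aut by (simp add: algebra_automorphism_def bij_is_surj surj_f_inv_f)

lemma automorphism_inj: "\<sigma> a = \<sigma> b \<Longrightarrow> a = b"
  using aut by (simp add: algebra_automorphism_def bij_is_inj inj_eq)

lemma inv_automorphism_power:
  "(inv \<sigma> ^^ j) (a + b) = (inv \<sigma> ^^ j) a + (inv \<sigma> ^^ j) b"
  "(inv \<sigma> ^^ j) (c *\<^sub>C a) = c *\<^sub>C (inv \<sigma> ^^ j) a"
  "(inv \<sigma> ^^ j) (a * b) = (inv \<sigma> ^^ j) a * (inv \<sigma> ^^ j) b"
proof -
  have "inv \<sigma> (a + b) = inv \<sigma> a + inv \<sigma> b" "inv \<sigma> (c *\<^sub>C a) = c *\<^sub>C inv \<sigma> a"
    "inv \<sigma> (a * b) = inv \<sigma> a * inv \<sigma> b" for a b c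
    by (rule automorphism_inj, simp add: automorphism automorphism_inv)+
  then show "(inv \<sigma> ^^ j) (a + b) = (inv \<sigma> ^^ j) a + (inv \<sigma> ^^ j) b"
    "(inv \<sigma> ^^ j) (c *\<^sub>C a) = c *\<^sub>C (inv \<sigma> ^^ j) a"
    "(inv \<sigma> ^^ j) (a * b) = (inv \<sigma> ^^ j) a * (inv \<sigma> ^^ j) b"
    by (induction j) simp_all
qed

lemma automorphism_power_inv: "(\<sigma> ^^ j) ((inv \<sigma> ^^ j) a) = a"
proof (induction j)
  case (Suc j)
  have "(\<sigma> ^^ Suc j) ((inv \<sigma> ^^ Suc j) a) = (\<sigma> ^^ j) (\<sigma> (inv \<sigma> ((inv \<sigma> ^^ j) a)))"
    by (simp add: funpow_swap1)
  then show ?case by (simp only: automorphism_inv Suc)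
qed simp

abbreviation (input) tc :: "'a \<Rightarrow> 'h \<Rightarrow> 'h" where "tc \<equiv> twisted_commutator \<sigma> \<pi> D"

lemma triple_dense_domain: "closure (dom D) = UNIV" and triple_linear_op: "linear_op D"
  and btc: "bounded_twisted_commutators \<sigma> \<pi> D"
  using triple unfolding twisted_spectral_triple_def self_adjoint_def by auto

text \<open>Two bounded operators that agree on a dense domain are equal.\<close>

lemma extends_twisted_commutator_unique:
  assumes "extends_twisted_commutator \<sigma> \<pi> D a T" "extends_twisted_commutator \<sigma> \<pi> D a T'"
  shows "T = T'"
proof -
  have b: "bounded_op T" "bounded_op T'" and eq: "\<And>x. x \<in> dom D \<Longrightarrow> T x = T' x"
    using assms unfolding extends_twisted_commutator_def by auto
  have "closed {x. T x = T' x}"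
    by (rule closed_Collect_eq[OF bounded_linear.continuous_on[OF bounded_opD(7)[OF b(1)] continuous_on_id]
          bounded_linear.continuous_on[OF bounded_opD(7)[OF b(2)] continuous_on_id]])
  then have "closure (dom D) \<subseteq> {x. T x = T' x}"
    by (rule closure_minimal[rotated]) (use eq in auto)
  then show ?thesis using triple_dense_domain by auto
qed

lemma extends_twisted_commutator_self: "extends_twisted_commutator \<sigma> \<pi> D a (tc a)"
proof -
  obtain T where "extends_twisted_commutator \<sigma> \<pi> D a T"
    using btc unfolding bounded_twisted_commutators_def by blast
  then show ?thesis
    unfolding twisted_commutator_def
    by (rule theI[of "extends_twisted_commutator \<sigma> \<pi> D a"])
      (rule extends_twisted_commutator_unique[OF _ \<open>extends_twisted_commutator \<sigma> \<pi> D a T\<close>])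
qed

lemma twisted_commutator_unique: "extends_twisted_commutator \<sigma> \<pi> D a T \<Longrightarrow> tc a = T"
  by (rule extends_twisted_commutator_unique[OF extends_twisted_commutator_self])

lemma bounded_twisted_commutator: "bounded_op (tc a)"
  using extends_twisted_commutator_self unfolding extends_twisted_commutator_def by blast

lemma twisted_commutator_cases:
  assumes "D x = Some y"
  obtains w where "D (\<pi> a x) = Some w" "tc a x = w - \<pi> (\<sigma> a) y"
proof -
  have "\<pi> a x \<in> dom D" using btc assms unfolding bounded_twisted_commutators_def by blast
  then obtain w where w: "D (\<pi> a x) = Some w" by blast
  moreover have "tc a x = w - \<pi> (\<sigma> a) y"
    using extends_twisted_commutator_self[of a] assms w unfolding extends_twisted_commutator_def by force
  ultimately show ?thesis by (rule that)
qed

lemma twisted_commutator_eqI: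
  assumes "bounded_op T"
    "\<And>x y. D x = Some y \<Longrightarrow> D (\<pi> a x) = Some (T x + \<pi> (\<sigma> a) y)"
  shows "tc a = T"
  by (rule twisted_commutator_unique) (use assms in \<open>force simp: extends_twisted_commutator_def\<close>)

text \<open>Stated with \<open>Some\<close>, so that value and domain travel together; applying it
  twice yields the Leibniz rule.\<close>

lemma apply_twisted_commutator:
  assumes "D x = Some y"
  shows "D (\<pi> a x) = Some (tc a x + \<pi> (\<sigma> a) y)"
  using assms by (elim twisted_commutator_cases[of x y a]) simp

lemma twisted_commutator_add: "tc (a + b) x = tc a x + tc b x"
proof -
  have "tc (a + b) = (\<lambda>x. tc a x + tc b x)"
  proof (rule twisted_commutator_eqI)
    show "bounded_op (\<lambda>x. tc a x + tc b x)" by (intro bounded_op_add bounded_twisted_commutator)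
    fix x y assume "D x = Some y"
    from linear_op_add[OF triple_linear_op apply_twisted_commutator[OF this, of a] apply_twisted_commutator[OF this, of b]]
    show "D (\<pi> (a + b) x) = Some (tc a x + tc b x + \<pi> (\<sigma> (a + b)) y)"
      by (simp add: triple_action automorphism algebra_simps)
  qed
  then show ?thesis by simp
qed

lemma twisted_commutator_scaleC: "tc (c *\<^sub>C a) x = c *\<^sub>C tc a x"
proof -
  have "tc (c *\<^sub>C a) = (\<lambda>x. c *\<^sub>C tc a x)"
  proof (rule twisted_commutator_eqI)
    show "bounded_op (\<lambda>x. c *\<^sub>C tc a x)" by (intro bounded_op_scaleC bounded_twisted_commutator)
    fix x y assume "D x = Some y"
    from linear_op_scaleC[OF triple_linear_op apply_twisted_commutator[OF this, of a], of c]
    show "D (\<pi> (c *\<^sub>C a) x) = Some (c *\<^sub>C tc a x + \<pi> (\<sigma> (c *\<^sub>C a)) y)"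
      by (simp add: triple_action automorphism scaleC_add_right)
  qed
  then show ?thesis by simp
qed

lemma twisted_commutator_mult: "tc (a * b) x = tc a (\<pi> b x) + \<pi> (\<sigma> a) (tc b x)"
proof -
  have "tc (a * b) = (\<lambda>x. (tc a \<circ> \<pi> b) x + (\<pi> (\<sigma> a) \<circ> tc b) x)"
  proof (rule twisted_commutator_eqI)
    show "bounded_op (\<lambda>x. (tc a \<circ> \<pi> b) x + (\<pi> (\<sigma> a) \<circ> tc b) x)"
      by (intro bounded_op_add bounded_op_comp bounded_twisted_commutator triple_action)
    fix x y assume "D x = Some y"
    from apply_twisted_commutator[OF apply_twisted_commutator[OF this, of b], of a]
    show "D (\<pi> (a * b) x) = Some ((tc a \<circ> \<pi> b) x + (\<pi> (\<sigma> a) \<circ> tc b) x + \<pi> (\<sigma> (a * b)) y)"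
      by (simp add: triple_action automorphism bounded_opD(1)[OF triple_action(1)] add.assoc)
  qed
  then show ?thesis by simp
qed

subsection \<open>The cocycle identity\<close>

text \<open>The part under the trace between the grading and the power of the inverse. The length
  \<open>m\<close> varies separately, for induction on the last factor.\<close>

definition chain_op :: "nat \<Rightarrow> (nat \<Rightarrow> 'a) \<Rightarrow> 'h \<Rightarrow> 'h" where
  "chain_op m a = \<pi> (a 0) \<circ> twisted_commutator_product \<sigma> \<pi> D m a"

lemma chain_op_0: "chain_op 0 a = \<pi> (a 0)"
  by (simp add: chain_op_def twisted_commutator_product_def)

lemma chain_op_Suc: "chain_op (Suc m) a x = chain_op m a (tc ((inv \<sigma> ^^ Suc m) (a (Suc m))) x)"
proof -
  define f where "f = (\<lambda>j. tc ((inv \<sigma> ^^ j) (a j)))"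
  have "foldr (\<circ>) (map f [1..<Suc (Suc m)]) id = foldr (\<circ>) (map f [1..<Suc m]) id \<circ> f (Suc m)"
    by (simp add: foldr_comp[of _ "f (Suc m)"])
  then have "chain_op (Suc m) a x = chain_op m a (f (Suc m) x)"
    unfolding chain_op_def twisted_commutator_product_def f_def[symmetric] by (simp only: o_apply)
  then show ?thesis by (simp only: f_def)
qed

lemma bounded_chain_op: "bounded_op (chain_op m a)"
proof (induction m)
  case (Suc m)
  have "chain_op (Suc m) a = chain_op m a \<circ> tc ((inv \<sigma> ^^ Suc m) (a (Suc m)))"
    by (rule ext) (simp only: chain_op_Suc o_apply)
  then show ?case by (simp only: bounded_op_comp[OF Suc bounded_twisted_commutator])
qed (simp add: chain_op_0 triple_action)

lemma chain_op_cong: "(\<And>j. j \<le> m \<Longrightarrow> a j = b j) \<Longrightarrow> chain_op m a = chain_op m b"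
  by (induction m) (simp_all add: chain_op_0 chain_op_Suc fun_eq_iff del: funpow.simps)

lemma chain_op_add:
  "j \<le> m \<Longrightarrow> chain_op m (a(j := x + y)) z = chain_op m (a(j := x)) z + chain_op m (a(j := y)) z"
proof (induction m arbitrary: z)
  case (Suc m)
  show ?case
  proof (cases "j = Suc m")
    case True
    have "chain_op m (a(Suc m := u)) = chain_op m a" for u by (rule chain_op_cong) simp
    then show ?thesis
      by (simp only: True chain_op_Suc fun_upd_same inv_automorphism_power twisted_commutator_add
          bounded_opD(1)[OF bounded_chain_op])
  qed (use Suc in \<open>simp add: chain_op_Suc del: funpow.simps\<close>)
qed (simp add: chain_op_0 triple_action)

lemma chain_op_scaleC:
  "j \<le> m \<Longrightarrow> chain_op m (a(j := c *\<^sub>C x)) z = c *\<^sub>C chain_op m (a(j := x)) z"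
proof (induction m arbitrary: z)
  case (Suc m)
  show ?case
  proof (cases "j = Suc m")
    case True
    have "chain_op m (a(Suc m := u)) = chain_op m a" for u by (rule chain_op_cong) simp
    then show ?thesis
      by (simp only: True chain_op_Suc fun_upd_same inv_automorphism_power twisted_commutator_scaleC
          bounded_opD(2)[OF bounded_chain_op])
  qed (use Suc in \<open>simp add: chain_op_Suc del: funpow.simps\<close>)
qed (simp add: chain_op_0 triple_action)

text \<open>Literally the argument of the i-th summand in \<open>hochschild_b\<close>, so that
  unfolding makes the two match.\<close>

definition merge_entries :: "nat \<Rightarrow> (nat \<Rightarrow> 'a) \<Rightarrow> nat \<Rightarrow> 'a" where
  "merge_entries i a = (\<lambda>j. if j < i then a j else if j = i then a i * a (i + 1) else a (j + 1))"

text \<open>By the twisted Leibniz rule the sum telescopes.\<close>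

lemma alternating_chain_sum:
  "(\<Sum>i\<le>m. (- 1) ^ i *\<^sub>C chain_op m (merge_entries i a) x)
    = (- 1) ^ m *\<^sub>C chain_op m a (\<pi> ((inv \<sigma> ^^ m) (a (Suc m))) x)"
proof (induction m arbitrary: x)
  case 0
  show ?case by (simp add: chain_op_0 merge_entries_def triple_action)
next
  case (Suc m)
  define t where "t b = (inv \<sigma> ^^ Suc m) b" for b
  define u where "u = tc (t (a (Suc (Suc m)))) x"
  have \<sigma>t: "\<sigma> (t b) = (inv \<sigma> ^^ m) b" for b by (simp add: t_def automorphism_inv)
  have low: "chain_op (Suc m) (merge_entries i a) x = chain_op m (merge_entries i a) u" if "i \<le> m" for i
    using that by (simp add: chain_op_Suc merge_entries_def t_def u_def del: funpow.simps)
  have "chain_op m (merge_entries (Suc m) a) = chain_op m a"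
    by (rule chain_op_cong) (simp add: merge_entries_def)
  \<comment> \<open>The Leibniz rule splits the last factor d(t(a_{m+1}) t(a_{m+2})). Since \<sigma>
    t is the m-th power of the inverse automorphism, the second part cancels against the induction
    hypothesis applied to \<open>u\<close>.\<close>
  then have top: "chain_op (Suc m) (merge_entries (Suc m) a) x
      = chain_op (Suc m) a (\<pi> (t (a (Suc (Suc m)))) x) + chain_op m a (\<pi> ((inv \<sigma> ^^ m) (a (Suc m))) u)"
    by (simp add: chain_op_Suc merge_entries_def inv_automorphism_power(3) twisted_commutator_mult
        bounded_opD(1)[OF bounded_chain_op] t_def[symmetric] u_def \<sigma>t del: funpow.simps)
  have "(\<Sum>i\<le>Suc m. (- 1) ^ i *\<^sub>C chain_op (Suc m) (merge_entries i a) x)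
      = (\<Sum>i\<le>m. (- 1) ^ i *\<^sub>C chain_op m (merge_entries i a) u)
        + (- 1) ^ Suc m *\<^sub>C chain_op (Suc m) (merge_entries (Suc m) a) x"
    by (simp add: low)
  also have "\<dots> = (- 1) ^ Suc m *\<^sub>C chain_op (Suc m) a (\<pi> (t (a (Suc (Suc m)))) x)"
    by (simp add: Suc top scaleC_add_right scaleC.minus_left)
  finally show ?case by (simp only: t_def)
qed

text \<open>Covers both cases: \<open>S\<close> is the inverse of D with G = \<gamma>, or the
  inverse of |D| with G = id. \<open>S\<close> enters only through its ideal and the relation in
  \<open>d\<close>, while the commutators inside \<open>chain_op\<close> are always those of
  D.\<close>

theorem hochschild_cocycle_chain_op:
  assumes dix: "dixmier_trace Tr" and n: "n \<ge> 1" and S: "S \<in> weak_schatten n"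
    and d: "\<And>a. \<exists>d. bounded_op d \<and> (\<forall>x. \<pi> a (S x) - S (\<pi> (\<sigma> a) x) = S (d (S x)))"
    and G: "bounded_op G" "\<And>a. G \<circ> \<pi> a = \<pi> a \<circ> G"
  shows "hochschild_cocycle n (\<lambda>a. Tr (G \<circ> chain_op n a \<circ> (S ^^ n)))"
proof -
  define \<Psi> where "\<Psi> a = Tr (G \<circ> chain_op n a \<circ> (S ^^ n))" for a
  have Sn: "S ^^ n \<in> weak_schatten 1"
    using weak_schatten_1_power_product[OF S n order_refl bounded_op_id(1)] by simp
  have W: "G \<circ> X \<circ> (S ^^ n) \<in> weak_schatten 1" if "bounded_op X" for X
    by (intro weak_schatten_1_comp_left bounded_op_comp G that Sn)
  have Tr_sum: "Tr (\<lambda>x. \<Sum>i\<le>m. c i *\<^sub>C (G \<circ> X i \<circ> (S ^^ n)) x)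
        = (\<Sum>i\<le>m. c i * Tr (G \<circ> X i \<circ> (S ^^ n)))
      \<and> (\<lambda>x. \<Sum>i\<le>m. c i *\<^sub>C (G \<circ> X i \<circ> (S ^^ n)) x) \<in> weak_schatten 1"
    if "\<And>i. bounded_op (X i)" for c X and m :: nat
  proof (induction m)
    case 0
    then show ?case
      using dixmier_trace_scaleC[OF dix W[OF that]] weak_schatten_1_scaleC[OF W[OF that]]
      by (simp del: o_apply One_nat_def)
  next
    case (Suc m)
    note 1 = weak_schatten_1_scaleC[OF W[OF that], of "c (Suc m)" "Suc m"]
    show ?case
      using dixmier_trace_add[OF dix conjunct2[OF Suc] 1] weak_schatten_1_add[OF conjunct2[OF Suc] 1]
        dixmier_trace_scaleC[OF dix W[OF that]] conjunct1[OF Suc]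
      by (simp del: o_apply One_nat_def)
  qed
  have "multilinear_form n \<Psi>"
    unfolding multilinear_form_def
  proof (intro conjI allI impI)
    fix a b :: "nat \<Rightarrow> 'a" assume "\<forall>j\<le>n. a j = b j"
    then show "\<Psi> a = \<Psi> b" unfolding \<Psi>_def using chain_op_cong[of n a b] by simp
  next
    fix a :: "nat \<Rightarrow> 'a" and j x y assume j: "j \<le> n"
    have "G \<circ> chain_op n (a(j := x + y)) \<circ> (S ^^ n)
        = (\<lambda>z. (G \<circ> chain_op n (a(j := x)) \<circ> (S ^^ n)) z + (G \<circ> chain_op n (a(j := y)) \<circ> (S ^^ n)) z)"
      by (rule ext) (simp add: chain_op_add[OF j] bounded_opD(1)[OF G(1)])
    then show "\<Psi> (a(j := x + y)) = \<Psi> (a(j := x)) + \<Psi> (a(j := y))"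
      unfolding \<Psi>_def using dixmier_trace_add[OF dix W W] bounded_chain_op by simp
  next
    fix a :: "nat \<Rightarrow> 'a" and j c x assume j: "j \<le> n"
    have "G \<circ> chain_op n (a(j := c *\<^sub>C x)) \<circ> (S ^^ n)
        = (\<lambda>z. c *\<^sub>C (G \<circ> chain_op n (a(j := x)) \<circ> (S ^^ n)) z)"
      by (rule ext) (simp add: chain_op_scaleC[OF j] bounded_opD(2)[OF G(1)])
    then show "\<Psi> (a(j := c *\<^sub>C x)) = c * \<Psi> (a(j := x))"
      unfolding \<Psi>_def using dixmier_trace_scaleC[OF dix W] bounded_chain_op by simp
  qed
  moreover have "hochschild_b n \<Psi> a = 0" for a
  proof -
    define c where "c = (inv \<sigma> ^^ n) (a (Suc n))"
    \<comment> \<open>The arguments of the cyclic term of \<open>hochschild_b\<close>; their chain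
      is the old one multiplied by a_{n+1} on the left.\<close>
    define b where "b j = (if j = 0 then a (n + 1) * a 0 else a j)" for j
    have "chain_op m b = \<pi> (a (Suc n)) \<circ> chain_op m a" if "m \<le> n" for m
      using that
    proof (induction m)
      case 0
      show ?case by (rule ext) (simp add: chain_op_0 b_def triple_action)
    next
      case (Suc m)
      then show ?case by (intro ext) (simp add: chain_op_Suc b_def del: funpow.simps)
    qed
    then have last: "chain_op n b = \<pi> (a (Suc n)) \<circ> chain_op n a" by simp
    have "(\<Sum>i\<le>n. (- 1) ^ i * \<Psi> (merge_entries i a))
        = Tr (\<lambda>x. \<Sum>i\<le>n. (- 1) ^ i *\<^sub>C (G \<circ> chain_op n (merge_entries i a) \<circ> (S ^^ n)) x)"
      unfolding \<Psi>_def
      by (rule conjunct1[OF Tr_sum[OF bounded_chain_op], symmetric])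
    also have "(\<lambda>x. \<Sum>i\<le>n. (- 1) ^ i *\<^sub>C (G \<circ> chain_op n (merge_entries i a) \<circ> (S ^^ n)) x)
        = (\<lambda>x. (- 1) ^ n *\<^sub>C (G \<circ> (chain_op n a \<circ> \<pi> c) \<circ> (S ^^ n)) x)"
    proof (rule ext)
      fix x
      have "(\<Sum>i\<le>n. (- 1) ^ i *\<^sub>C (G \<circ> chain_op n (merge_entries i a) \<circ> (S ^^ n)) x)
          = G (\<Sum>i\<le>n. (- 1) ^ i *\<^sub>C chain_op n (merge_entries i a) ((S ^^ n) x))"
        by (simp add: bounded_opD(2,6)[OF G(1)])
      also have "\<dots> = (- 1) ^ n *\<^sub>C (G \<circ> (chain_op n a \<circ> \<pi> c) \<circ> (S ^^ n)) x"
        by (simp add: alternating_chain_sum bounded_opD(2)[OF G(1)] c_def)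
      finally show "(\<Sum>i\<le>n. (- 1) ^ i *\<^sub>C (G \<circ> chain_op n (merge_entries i a) \<circ> (S ^^ n)) x)
          = (- 1) ^ n *\<^sub>C (G \<circ> (chain_op n a \<circ> \<pi> c) \<circ> (S ^^ n)) x" .
    qed
    also have "Tr \<dots> = (- 1) ^ n * Tr (G \<circ> (chain_op n a \<circ> \<pi> c) \<circ> (S ^^ n))"
      by (rule dixmier_trace_scaleC[OF dix W[OF bounded_op_comp[OF bounded_chain_op triple_action(1)]]])
    also have "G \<circ> (chain_op n a \<circ> \<pi> c) \<circ> (S ^^ n) = (G \<circ> chain_op n a) \<circ> \<pi> c \<circ> (S ^^ n)"
      by (simp only: o_assoc)
    also have "Tr \<dots> = Tr (\<pi> ((\<sigma> ^^ n) c) \<circ> (G \<circ> chain_op n a) \<circ> (S ^^ n))"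
      by (rule dixmier_trace_twist[where \<pi> = \<pi> and \<sigma> = \<sigma>, OF dix n S d triple_action(1) bounded_op_comp[OF G(1) bounded_chain_op]])
    \<comment> \<open>Here \<sigma>^n(c) = a_{n+1}, which commutes with \<open>G\<close> and so
      reaches the front of the chain. The cyclic term carries the opposite sign (-1)^(n+1).\<close>
    also have "\<pi> ((\<sigma> ^^ n) c) \<circ> (G \<circ> chain_op n a) \<circ> (S ^^ n) = G \<circ> chain_op n b \<circ> (S ^^ n)"
      unfolding last c_def automorphism_power_inv o_assoc G(2) ..
    finally have "(\<Sum>i\<le>n. (- 1) ^ i * \<Psi> (merge_entries i a)) = (- 1) ^ n * \<Psi> b"
      unfolding \<Psi>_def .
    then show ?thesis
      unfolding hochschild_b_def merge_entries_def b_def by simp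
  qed
  ultimately show ?thesis unfolding hochschild_cocycle_def \<Psi>_def by blast
qed

end

theorem proposition3p10:
  fixes \<sigma> :: "'a::complex_algebra \<Rightarrow> 'a"
    and \<pi> :: "'a \<Rightarrow> 'h::complex_hilbert_space \<Rightarrow> 'h"
    and D :: "'h \<rightharpoonup> 'h"
    and \<gamma> :: "'h \<Rightarrow> 'h"
    and Tr :: "('h \<Rightarrow> 'h) \<Rightarrow> complex"
    and n :: nat
  assumes "algebra_automorphism \<sigma>"
    and "dixmier_trace Tr"
    and "n \<ge> 1"
  shows "(graded_twisted_spectral_triple \<sigma> \<pi> D \<gamma> \<and> even n \<and>
          invertible_op D \<and> inverse_op D \<in> weak_schatten n
            \<longrightarrow> hochschild_cocycle n (graded_character Tr \<sigma> \<pi> D \<gamma> n)) \<and>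
         (twisted_spectral_triple \<sigma> \<pi> D \<and> lipschitz_regular \<sigma> \<pi> D \<and> odd n \<and>
          invertible_op D \<and> inverse_op D \<in> weak_schatten n
            \<longrightarrow> hochschild_cocycle n (ungraded_character Tr \<sigma> \<pi> D n))"
proof (intro conjI impI; elim conjE)
  assume graded: "graded_twisted_spectral_triple \<sigma> \<pi> D \<gamma>" and inv: "invertible_op D"
    and S: "inverse_op D \<in> weak_schatten n"
  then have triple: "twisted_spectral_triple \<sigma> \<pi> D" and \<gamma>: "bounded_op \<gamma>" "\<And>a. \<gamma> \<circ> \<pi> a = \<pi> a \<circ> \<gamma>"
    by (auto simp: graded_twisted_spectral_triple_def)
  have btc: "bounded_twisted_commutators \<sigma> \<pi> D"
    using triple by (simp add: twisted_spectral_triple_def)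
  have "graded_character Tr \<sigma> \<pi> D \<gamma> n = (\<lambda>a. Tr (\<gamma> \<circ> chain_op \<sigma> \<pi> D n a \<circ> (inverse_op D ^^ n)))"
    by (rule ext) (simp only: graded_character_def chain_op_def[OF assms(1) triple] o_assoc)
  moreover have "\<exists>d. bounded_op d \<and> (\<forall>x. \<pi> a (inverse_op D x) - inverse_op D (\<pi> (\<sigma> a) x)
      = inverse_op D (d (inverse_op D x)))" for a
    by (rule twisted_commutator_intertwines[OF btc inv])
  ultimately show "hochschild_cocycle n (graded_character Tr \<sigma> \<pi> D \<gamma> n)"
    using hochschild_cocycle_chain_op[OF assms(1) triple assms(2,3) S _ \<gamma>] by simp
next
  assume triple: "twisted_spectral_triple \<sigma> \<pi> D" and lip: "lipschitz_regular \<sigma> \<pi> D"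
    and inv: "invertible_op D" and S: "inverse_op D \<in> weak_schatten n"
  have sa: "self_adjoint D" using triple by (simp add: twisted_spectral_triple_def)
  \<comment> \<open>Here \<open>S\<close> is the inverse of |D|; Lipschitz regularity provides its
    intertwining relation, with commutators of |D| that occur only in the error terms.\<close>
  note abs = abs_op_weak_schatten[OF sa inv weak_schatten_compact[OF S] S]
  have "ungraded_character Tr \<sigma> \<pi> D n
      = (\<lambda>a. Tr (id \<circ> chain_op \<sigma> \<pi> D n a \<circ> (inverse_op (abs_op D) ^^ n)))"
    by (rule ext) (simp only: ungraded_character_def chain_op_def[OF assms(1) triple] o_assoc id_o)
  moreover have "\<exists>d. bounded_op d \<and>
      (\<forall>x. \<pi> a (inverse_op (abs_op D) x) - inverse_op (abs_op D) (\<pi> (\<sigma> a) x)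
        = inverse_op (abs_op D) (d (inverse_op (abs_op D) x)))" for a
    by (rule twisted_commutator_intertwines[OF lip[unfolded lipschitz_regular_def] abs(1)])
  ultimately show "hochschild_cocycle n (ungraded_character Tr \<sigma> \<pi> D n)"
    using hochschild_cocycle_chain_op[OF assms(1) triple assms(2,3) abs(2) _ bounded_op_id(1)]
    by simp
qed

end
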